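(* Let $H:\mathbb{R}\times\mathbb{R}^N\to\mathbb{R}$ be a continuous function and let $L(x,t,\xi)=H(t,\xi)$ for every $(x,t,\xi)\in\Omega\times\mathbb{R}\times\mathbb{R}^N$. Assume that the following two conditions hold: (i) for every $t\in\mathbb{R}$, there exists $\zeta\in\mathbb{R}^N$ such that $$\forall\xi\in\mathbb{R}^N,\quad H(t,\xi)\geq H(t,0)+\langle\zeta,\xi\rangle;$$ (ii) there exist $c,d\in\mathbb{R}$ such that for every $t\in\mathbb{R}$, $$H(t,0)\geq c|t|^{p^{\#}}+d.$$ Then $\mathcal L$ is $L^\infty(\Omega)$-regular at every $u\in\mathcal A$.
   Context: Let $N\ge 1$, let $\Omega\subset\mathbb{R}^N$ be a bounded open set, $1\leq p\leq N$, and $\varphi\in W^{1,p}(\mathbb{R}^N)\cap L^\infty(\mathbb{R}^N)$. Set $p^{\#}:=\frac{Np}{N-p}$ if $1\le p<N$ and $p^{\#}:=N$ if $p=N$. $W^{1,p}_0(\Omega)$ is the closure in $W^{1,p}(\Omega)$ of the $C^1$ functions with compact support in $\Omega$, and $W^{1,p}_\varphi(\Omega)=\varphi+W^{1,p}_0(\Omega)$. Given $L:\Omega\times\mathbb{R}\times\mathbb{R}^N\to\mathbb{R}$, set $\mathcal L(u)=\int_\Omega L(x,u(x),\nabla u(x))\,dx$, and let $\mathcal A=\{u\in W^{1,p}_\varphi(\Omega): L(x,u,\nabla u)\in L^1(\Omega)\}$. The functional $\mathcal L$ is said to be $L^\infty(\Omega)$-regular at $u\in\mathcal A$ if there exists a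 sequence $(u_k)_{k\ge1}\subset\mathcal A\cap L^\infty(\Omega)$ such that $u_k\to u$ in $W^{1,p}(\Omega)$ and $L(x,u_k,\nabla u_k)\to L(x,u,\nabla u)$ in $L^1(\Omega)$. *)

theory Defs
  imports "HOL-Analysis.Analysis"
begin

text \<open>
  Elements of the function spaces below are total functions rather than equivalence classes; all
  conditions depend only on the values on \<open>\<Omega>\<close>, up to null sets (except for \<open>C1c\<close>).
\<close>

definition Lp :: "'a::euclidean_space set \<Rightarrow> real \<Rightarrow> ('a \<Rightarrow> 'b::euclidean_space) set" where
  "Lp \<Omega> p = {f \<in> borel_measurable (lebesgue_on \<Omega>).
     integrable (lebesgue_on \<Omega>) (\<lambda>x. norm (f x) powr p)}"

definition Lp_norm :: "'a::euclidean_space set \<Rightarrow> real \<Rightarrow> ('a \<Rightarrow> 'b::euclidean_space) \<Rightarrow> real" where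
  "Lp_norm \<Omega> p f = (LINT x|lebesgue_on \<Omega>. norm (f x) powr p) powr (1 / p)"

definition Linf :: "'a::euclidean_space set \<Rightarrow> ('a \<Rightarrow> real) set" where
  "Linf \<Omega> = {f \<in> borel_measurable (lebesgue_on \<Omega>).
     \<exists>C. AE x in lebesgue_on \<Omega>. \<bar>f x\<bar> \<le> C}"

definition locally_integrable_on ::
    "('a::euclidean_space \<Rightarrow> 'b::euclidean_space) \<Rightarrow> 'a set \<Rightarrow> bool" (infixr "locally'_integrable'_on" 46) where
  "f locally_integrable_on \<Omega> \<longleftrightarrow> (\<forall>K. compact K \<and> K \<subseteq> \<Omega> \<longrightarrow> set_integrable lebesgue K f)"

text \<open>A \<open>C\<^sup>1\<close> function with compact support in the open set \<open>\<Omega>\<close> is identified with its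
  extension by zero, which is \<open>C\<^sup>1\<close> on the whole space.\<close>

definition C1c :: "'a::euclidean_space set \<Rightarrow> ('a \<Rightarrow> real) set" where
  "C1c \<Omega> = {v. (\<exists>v'. (\<forall>x. GDERIV v x :> v' x) \<and> continuous_on UNIV v') \<and>
     compact (closure {x. v x \<noteq> 0}) \<and> closure {x. v x \<noteq> 0} \<subseteq> \<Omega>}"

text \<open>Weak first derivatives are tested against \<open>C\<^sup>1\<close> functions with compact support, as in
  Gilbarg and Trudinger.  The identity is vector valued: its components along the basis
  vectors are the integration by parts formulas for the partial derivatives.\<close>

definition has_weak_gradient ::
    "'a::euclidean_space set \<Rightarrow> ('a \<Rightarrow> real) \<Rightarrow> ('a \<Rightarrow> 'a) \<Rightarrow> bool" where
  "has_weak_gradient \<Omega> u g \<longleftrightarrow>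
     u locally_integrable_on \<Omega> \<and> g locally_integrable_on \<Omega> \<and>
     (\<forall>v\<in>C1c \<Omega>. \<forall>v'. (\<forall>x. GDERIV v x :> v' x) \<longrightarrow>
        (LINT x|lebesgue_on \<Omega>. u x *\<^sub>R v' x) = - (LINT x|lebesgue_on \<Omega>. v x *\<^sub>R g x))"

text \<open>For open \<open>\<Omega>\<close> a weak gradient is unique up to null sets, so the choice is immaterial.\<close>

definition weak_gradient :: "'a::euclidean_space set \<Rightarrow> ('a \<Rightarrow> real) \<Rightarrow> 'a \<Rightarrow> 'a" where
  "weak_gradient \<Omega> u = (SOME g. has_weak_gradient \<Omega> u g)"

definition W1p :: "'a::euclidean_space set \<Rightarrow> real \<Rightarrow> ('a \<Rightarrow> real) set" where
  "W1p \<Omega> p = {u \<in> Lp \<Omega> p. \<exists>g\<in>Lp \<Omega> p. has_weak_gradient \<Omega> u g}"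

definition W1p_norm :: "'a::euclidean_space set \<Rightarrow> real \<Rightarrow> ('a \<Rightarrow> real) \<Rightarrow> real" where
  "W1p_norm \<Omega> p u = Lp_norm \<Omega> p u + Lp_norm \<Omega> p (weak_gradient \<Omega> u)"

definition W1p0 :: "'a::euclidean_space set \<Rightarrow> real \<Rightarrow> ('a \<Rightarrow> real) set" where
  "W1p0 \<Omega> p = {u \<in> W1p \<Omega> p. \<exists>v :: nat \<Rightarrow> 'a \<Rightarrow> real. (\<forall>k. v k \<in> C1c \<Omega>) \<and>
     (\<lambda>k. W1p_norm \<Omega> p (\<lambda>x. v k x - u x)) \<longlonglongrightarrow> 0}"

definition W1p_bdry :: "'a::euclidean_space set \<Rightarrow> real \<Rightarrow> ('a \<Rightarrow> real) \<Rightarrow> ('a \<Rightarrow> real) set" where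
  "W1p_bdry \<Omega> p \<phi> = (\<lambda>w x. \<phi> x + w x) ` W1p0 \<Omega> p"

definition sharp_exponent :: "nat \<Rightarrow> real \<Rightarrow> real" where
  "sharp_exponent N p = (if p < real N then real N * p / (real N - p) else real N)"

definition lagrangian_along ::
    "'a::euclidean_space set \<Rightarrow> ('a \<Rightarrow> real \<Rightarrow> 'a \<Rightarrow> real) \<Rightarrow> ('a \<Rightarrow> real) \<Rightarrow> 'a \<Rightarrow> real" where
  "lagrangian_along \<Omega> L u x = L x (u x) (weak_gradient \<Omega> u x)"

definition admissible ::
    "'a::euclidean_space set \<Rightarrow> real \<Rightarrow> ('a \<Rightarrow> real) \<Rightarrow> ('a \<Rightarrow> real \<Rightarrow> 'a \<Rightarrow> real) \<Rightarrow> ('a \<Rightarrow> real) set" where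
  "admissible \<Omega> p \<phi> L =
     {u \<in> W1p_bdry \<Omega> p \<phi>. integrable (lebesgue_on \<Omega>) (lagrangian_along \<Omega> L u)}"

text \<open>Regularity, at \<open>u\<close>, of the functional \<open>u \<mapsto> \<integral>\<^sub>\<Omega> L(x, u, \<nabla>u) dx\<close> on \<open>admissible \<Omega> p \<phi> L\<close>;
  it is stated through the Lagrangian \<open>L\<close>, since it depends on the integrand and not only
  on the value of the integral.\<close>

definition Linf_regular_at ::
    "'a::euclidean_space set \<Rightarrow> real \<Rightarrow> ('a \<Rightarrow> real) \<Rightarrow> ('a \<Rightarrow> real \<Rightarrow> 'a \<Rightarrow> real) \<Rightarrow> ('a \<Rightarrow> real) \<Rightarrow> bool" where
  "Linf_regular_at \<Omega> p \<phi> L u \<longleftrightarrow>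
     (\<exists>U :: nat \<Rightarrow> 'a \<Rightarrow> real.
        (\<forall>k. U k \<in> admissible \<Omega> p \<phi> L \<inter> Linf \<Omega>) \<and>
        (\<lambda>k. W1p_norm \<Omega> p (\<lambda>x. U k x - u x)) \<longlonglongrightarrow> 0 \<and>
        (\<lambda>k. LINT x|lebesgue_on \<Omega>. \<bar>lagrangian_along \<Omega> L (U k) x - lagrangian_along \<Omega> L u x\<bar>)
          \<longlonglongrightarrow> 0)"

end

theory Submission
  imports Defs
begin

text \<open>
  The approximating functions are the truncations \<open>U k = max (- s k) (min u (t k))\<close>, whose gradient
  is that of \<open>u\<close> where \<open>- s k \<le> u \<le> t k\<close> and zero elsewhere. The only error that is not the tail of
  an integral is \<open>\<bar>H (t, 0)\<bar>\<close> times the measure of \<open>{u > t}\<close>, and it has to vanish for suitable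
  levels \<open>t\<close>.

  Since \<open>\<nabla>u\<close> integrates to zero over each band \<open>{a < u \<le> b}\<close> above the bound of \<open>\<phi>\<close>, the subgradients
  \<open>\<zeta>\<close> of condition (i) drop out and \<open>H (u, 0)\<close> has a smaller integral over the band than \<open>H (u, \<nabla>u)\<close>.
  The growth condition (ii) and the Sobolev embedding control the negative part of \<open>H (u, 0)\<close>, so its
  positive part is integrable on \<open>{u > a}\<close>. Levels \<open>t\<close> at which the positive part of \<open>H (\<cdot>, 0)\<close> is within 1
  of its infimum over all higher levels then do the job.
\<close>

section \<open>Spaces of \<open>p\<close>-integrable functions\<close>

text \<open>The obstacle is that nothing bounds \<open>H (t, 0)\<close> from above or tames its
  oscillation in \<open>t\<close>: along badly chosen levels \<open>\<bar>H (t, 0)\<bar>\<close>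
  times the measure of \<open>{u > t}\<close> need not tend to zero. At an almost minimal level the
  positive part at \<open>t\<close> exceeds the positive part at \<open>u x\<close> by at most 1
  wherever \<open>u x > t\<close>. The product is then dominated by one fixed integrable function
  integrated over \<open>{u > t}\<close>, so this error becomes a tail as well.

  The second difficulty is that subgradients depend on \<open>t\<close> without any regularity.
  Formally, \<zeta>(u) \<bullet> \<nabla>u is the divergence of a primitive of \<zeta> evaluated at
  u, and this has zero integral if \<zeta> vanishes at all levels below the bound of \<phi>. On a
  bounded band finitely many constant vectors replace \<zeta>, and the identity reduces to the
  vanishing integrals of band gradients.

  The Sobolev embedding is derived from L1 estimates for translations: an averaging argument yields
  a weak inequality between two levels, and truncation at dyadic levels makes it strong. Lower
  truncation levels are obtained from upper ones by reflecting \<open>u\<close> and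
  \<open>H\<close>.\<close>

definition mem_Lp :: "'a measure \<Rightarrow> real \<Rightarrow> ('a \<Rightarrow> 'b::euclidean_space) \<Rightarrow> bool" where
  "mem_Lp M p f \<longleftrightarrow> f \<in> borel_measurable M \<and> integrable M (\<lambda>x. norm (f x) powr p)"

text \<open>The root is omitted, so the triangle inequality holds only up to the factor
  \<open>2 powr p\<close>. That suffices for every convergence statement and avoids Minkowski's
  inequality. The measure is a parameter because mollification lives on \<open>lborel\<close> and
  the Sobolev spaces on \<open>lebesgue_on \<Omega>\<close>.\<close>

definition Lp_pow :: "'a measure \<Rightarrow> real \<Rightarrow> ('a \<Rightarrow> 'b::euclidean_space) \<Rightarrow> real" where
  "Lp_pow M p f = (\<integral>x. norm (f x) powr p \<partial>M)"

lemma norm_integral_le: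
  fixes f :: "'a \<Rightarrow> 'b::euclidean_space"
  assumes "integrable M f" "integrable M g" "\<And>x. norm (f x) \<le> g x"
  shows "norm (\<integral>x. f x \<partial>M) \<le> (\<integral>x. g x \<partial>M)"
proof -
  have "norm (\<integral>x. f x \<partial>M) \<le> (\<integral>x. norm (f x) \<partial>M)"
    by (rule integral_norm_bound)
  also have "\<dots> \<le> (\<integral>x. g x \<partial>M)"
    using assms by (intro integral_mono) auto
  finally show ?thesis .
qed

lemma Lp_iff: "f \<in> Lp \<Omega> p \<longleftrightarrow> mem_Lp (lebesgue_on \<Omega>) p f"
  by (simp add: Lp_def mem_Lp_def)

lemma Lp_norm_eq: "Lp_norm \<Omega> p f = Lp_pow (lebesgue_on \<Omega>) p f powr (1 / p)"
  by (simp add: Lp_norm_def Lp_pow_def)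

lemma Lp_pow_nonneg: "0 \<le> Lp_pow M p f"
  unfolding Lp_pow_def by (rule Bochner_Integration.integral_nonneg) auto

lemma powr_add_le:
  fixes x y p :: real
  assumes "0 \<le> x" "0 \<le> y" "0 \<le> p"
  shows "(x + y) powr p \<le> 2 powr p * (x powr p + y powr p)"
proof -
  have "(x + y) powr p \<le> (2 * max x y) powr p"
    using assms by (intro powr_mono2) auto
  also have "\<dots> = 2 powr p * max x y powr p"
    using assms by (simp add: powr_mult)
  also have "max x y powr p \<le> x powr p + y powr p"
    by (simp add: max_def)
  finally show ?thesis by simp
qed

lemma mem_Lp_bound:
  fixes f :: "'a \<Rightarrow> 'b::euclidean_space" and g :: "'a \<Rightarrow> 'c::euclidean_space"
  assumes "mem_Lp M p g" "f \<in> borel_measurable M" "AE x in M. norm (f x) \<le> B * norm (g x)"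
    "0 \<le> B" "0 \<le> p"
  shows "mem_Lp M p f"
proof -
  have "AE x in M. norm (norm (f x) powr p) \<le> norm (B powr p * norm (g x) powr p)"
    using assms(3)
  proof eventually_elim
    case (elim x)
    then have "norm (f x) powr p \<le> (B * norm (g x)) powr p"
      using assms by (intro powr_mono2) auto
    then show ?case using assms by (simp add: powr_mult)
  qed
  moreover have "(\<lambda>x. norm (f x) powr p) \<in> borel_measurable M"
    using assms(2) by measurable
  moreover have "integrable M (\<lambda>x. B powr p * norm (g x) powr p)"
    using assms(1) by (simp add: mem_Lp_def)
  ultimately have "integrable M (\<lambda>x. norm (f x) powr p)"
    using Bochner_Integration.integrable_bound by blast
  then show ?thesis
    using assms(2) by (simp add: mem_Lp_def)
qed

lemma mem_Lp_cong_AE: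
  assumes "mem_Lp M p g" "f \<in> borel_measurable M" "AE x in M. f x = g x" "0 \<le> p"
  shows "mem_Lp M p f"
  by (rule mem_Lp_bound[where B = 1 and g = g]) (use assms in auto)

lemma mem_Lp_add:
  assumes f: "mem_Lp M p f" and g: "mem_Lp M p g" and p: "0 \<le> p"
  shows "mem_Lp M p (\<lambda>x. f x + g x)"
    and "Lp_pow M p (\<lambda>x. f x + g x) \<le> 2 powr p * (Lp_pow M p f + Lp_pow M p g)"
proof -
  have le: "norm (f x + g x) powr p \<le> 2 powr p * (norm (f x) powr p + norm (g x) powr p)" for x
  proof -
    have "norm (f x + g x) powr p \<le> (norm (f x) + norm (g x)) powr p"
      using p by (intro powr_mono2 norm_triangle_ineq) auto
    also have "\<dots> \<le> 2 powr p * (norm (f x) powr p + norm (g x) powr p)"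
      using p by (intro powr_add_le) auto
    finally show ?thesis .
  qed
  have [measurable]: "f \<in> borel_measurable M" "g \<in> borel_measurable M"
    using f g by (auto simp: mem_Lp_def)
  have i: "integrable M (\<lambda>x. 2 powr p * (norm (f x) powr p + norm (g x) powr p))"
    using f g by (auto simp: mem_Lp_def)
  have i2: "integrable M (\<lambda>x. norm (f x + g x) powr p)"
    by (rule Bochner_Integration.integrable_bound[OF i]) (use le in \<open>auto intro!: AE_I2 order_trans[OF le]\<close>)
  then show "mem_Lp M p (\<lambda>x. f x + g x)" by (simp add: mem_Lp_def)
  have "Lp_pow M p (\<lambda>x. f x + g x) \<le> (\<integral>x. 2 powr p * (norm (f x) powr p + norm (g x) powr p) \<partial>M)"
    unfolding Lp_pow_def by (rule integral_mono[OF i2 i le])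
  also have "\<dots> = 2 powr p * (Lp_pow M p f + Lp_pow M p g)"
    using f g by (simp add: mem_Lp_def Lp_pow_def)
  finally show "Lp_pow M p (\<lambda>x. f x + g x) \<le> 2 powr p * (Lp_pow M p f + Lp_pow M p g)" .
qed

lemma mem_Lp_uminus: "mem_Lp M p f \<Longrightarrow> mem_Lp M p (\<lambda>x. - f x)"
  by (auto simp: mem_Lp_def)

lemma Lp_pow_uminus: "Lp_pow M p (\<lambda>x. - f x) = Lp_pow M p f"
  by (auto simp: Lp_pow_def)

lemma Lp_pow_minus_commute: "Lp_pow M p (\<lambda>x. f x - g x) = Lp_pow M p (\<lambda>x. g x - f x)"
  by (auto simp: Lp_pow_def norm_minus_commute)

lemma mem_Lp_diff:
  assumes f: "mem_Lp M p f" and g: "mem_Lp M p g" and p: "0 \<le> p"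
  shows "mem_Lp M p (\<lambda>x. f x - g x)"
    and "Lp_pow M p (\<lambda>x. f x - g x) \<le> 2 powr p * (Lp_pow M p f + Lp_pow M p g)"
  using mem_Lp_add[OF f mem_Lp_uminus[OF g] p] by (simp_all add: Lp_pow_uminus)

lemma Lp_pow_mono:
  assumes "mem_Lp M p g" "mem_Lp M p f" "AE x in M. norm (f x) \<le> norm (g x)" "0 \<le> p"
  shows "Lp_pow M p f \<le> Lp_pow M p g"
  unfolding Lp_pow_def
proof (rule integral_mono_AE)
  show "AE x in M. norm (f x) powr p \<le> norm (g x) powr p"
    using assms(3) by eventually_elim (use assms in \<open>auto intro: powr_mono2\<close>)
qed (use assms in \<open>auto simp: mem_Lp_def\<close>)

lemma Lp_pow_scale:
  fixes f :: "'a \<Rightarrow> 'b::euclidean_space"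
  assumes "0 \<le> B" shows "Lp_pow M p (\<lambda>x. B *\<^sub>R f x) = B powr p * Lp_pow M p f"
  using assms by (simp add: Lp_pow_def powr_mult)

lemma Lp_pow_cong_AE:
  assumes "AE x in M. f x = g x" "f \<in> borel_measurable M" "g \<in> borel_measurable M"
  shows "Lp_pow M p f = Lp_pow M p g"
  unfolding Lp_pow_def by (rule integral_cong_AE) (use assms in auto)

lemma Lp_tendsto_add:
  assumes "\<And>n::nat. mem_Lp M p (\<lambda>x. f n x - f' x)" "\<And>n. mem_Lp M p (\<lambda>x. g n x - g' x)" "0 \<le> p"
    and "(\<lambda>n. Lp_pow M p (\<lambda>x. f n x - f' x)) \<longlonglongrightarrow> 0" "(\<lambda>n. Lp_pow M p (\<lambda>x. g n x - g' x)) \<longlonglongrightarrow> 0"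
  shows "(\<lambda>n. Lp_pow M p (\<lambda>x. (f n x + g n x) - (f' x + g' x))) \<longlonglongrightarrow> 0"
proof (rule tendsto_sandwich[where f = "\<lambda>_. 0"])
  show "\<forall>\<^sub>F n in sequentially. Lp_pow M p (\<lambda>x. (f n x + g n x) - (f' x + g' x))
     \<le> 2 powr p * (Lp_pow M p (\<lambda>x. f n x - f' x) + Lp_pow M p (\<lambda>x. g n x - g' x))"
  proof (intro always_eventually allI)
    fix n
    have "(\<lambda>x. (f n x + g n x) - (f' x + g' x)) = (\<lambda>x. (f n x - f' x) + (g n x - g' x))"
      by (auto simp: algebra_simps)
    then show "Lp_pow M p (\<lambda>x. (f n x + g n x) - (f' x + g' x))
     \<le> 2 powr p * (Lp_pow M p (\<lambda>x. f n x - f' x) + Lp_pow M p (\<lambda>x. g n x - g' x))"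
      using mem_Lp_add(2)[OF assms(1)[of n] assms(2)[of n] assms(3)] by simp
  qed
  show "(\<lambda>n. 2 powr p * (Lp_pow M p (\<lambda>x. f n x - f' x) + Lp_pow M p (\<lambda>x. g n x - g' x))) \<longlonglongrightarrow> 0"
    using tendsto_mult[OF tendsto_const[of "2 powr p"] tendsto_add[OF assms(4,5)]] by simp
qed (auto simp: Lp_pow_nonneg)

lemma Lp_dominated_convergence:
  fixes f :: "nat \<Rightarrow> 'a \<Rightarrow> 'b::euclidean_space" and h :: "'a \<Rightarrow> 'c::euclidean_space"
  assumes m: "\<And>n. f n \<in> borel_measurable M" "f' \<in> borel_measurable M"
    and h: "mem_Lp M p h" and p: "0 < p"
    and b: "\<And>n. AE x in M. norm (f n x - f' x) \<le> B * norm (h x)" and "0 \<le> B"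
    and lim: "AE x in M. (\<lambda>n. f n x) \<longlonglongrightarrow> f' x"
  shows "(\<lambda>n. Lp_pow M p (\<lambda>x. f n x - f' x)) \<longlonglongrightarrow> 0"
proof -
  have "(\<lambda>n. \<integral>x. norm (f n x - f' x) powr p \<partial>M) \<longlonglongrightarrow> (\<integral>x. 0 \<partial>M)"
  proof (rule integral_dominated_convergence[where w = "\<lambda>x. B powr p * norm (h x) powr p"])
    show "integrable M (\<lambda>x. B powr p * norm (h x) powr p)" using h by (auto simp: mem_Lp_def)
    show "AE x in M. (\<lambda>n. norm (f n x - f' x) powr p) \<longlonglongrightarrow> 0"
      using lim
    proof eventually_elim
      case (elim x)
      then have "(\<lambda>n. norm (f n x - f' x)) \<longlonglongrightarrow> 0"
        by (simp add: tendsto_norm_zero_iff LIM_zero_iff)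
      then show ?case using tendsto_powr'[of _ 0 sequentially "\<lambda>_. p" p] p by force
    qed
    show "AE x in M. norm (norm (f n x - f' x) powr p) \<le> B powr p * norm (h x) powr p" for n
      using b[of n]
    proof eventually_elim
      case (elim x)
      then have "norm (f n x - f' x) powr p \<le> (B * norm (h x)) powr p"
        using p by (intro powr_mono2) auto
      then show ?case using \<open>0 \<le> B\<close> by (simp add: powr_mult)
    qed
  qed (use m in auto)
  then show ?thesis by (simp add: Lp_pow_def)
qed

text \<open>Either \<open>a \<le> s\<close>, or \<open>(a / s) powr (p - 1) \<ge> 1\<close>.
  Integrated, with the threshold \<open>s\<close> chosen afterwards, this one inequality replaces
  Hoelder's and Jensen's inequalities throughout.\<close>

lemma le_powr_threshold:
  fixes a s p :: real
  assumes "0 \<le> a" "0 < s" "1 \<le> p"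
  shows "a \<le> s + s powr (1 - p) * a powr p"
proof (cases "a \<le> s")
  case True then show ?thesis by (simp add: add_increasing2)
next
  case False
  then have a: "a > s" by simp
  have "s powr (1-p) * a powr p = a * (s powr (1 - p) * a powr (p - 1))"
    using a assms by (simp add: powr_diff)
  also have "s powr (1 - p) * a powr (p - 1) = (a / s) powr (p - 1)"
    using a assms by (simp add: powr_divide powr_diff)
  also have "a * (a / s) powr (p - 1) \<ge> a * 1"
    using a assms by (intro mult_left_mono ge_one_powr_ge_zero) auto
  finally show ?thesis using assms by linarith
qed

lemma (in finite_measure) mem_Lp_imp_integrable:
  assumes "mem_Lp M p f" "1 \<le> p"
  shows "integrable M f"
    and "0 < s \<Longrightarrow> (\<integral>x. norm (f x) \<partial>M) \<le> s * measure M (space M) + s powr (1 - p) * Lp_pow M p f"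
proof -
  have i: "integrable M (\<lambda>x. s + s powr (1 - p) * norm (f x) powr p)" for s
    using assms by (auto simp: mem_Lp_def)
  show *: "integrable M f"
    by (rule Bochner_Integration.integrable_bound[OF i[of 1]])
      (use assms le_powr_threshold[of _ 1 p] in \<open>auto simp: mem_Lp_def\<close>)
  assume "0 < s"
  have "(\<integral>x. norm (f x) \<partial>M) \<le> (\<integral>x. s + s powr (1 - p) * norm (f x) powr p \<partial>M)"
    by (rule integral_mono[OF _ i]) (use * assms le_powr_threshold[of _ s p] \<open>0 < s\<close> in auto)
  also have "\<dots> = s * measure M (space M) + s powr (1 - p) * Lp_pow M p f"
    using assms by (simp add: mem_Lp_def Lp_pow_def)
  finally show "(\<integral>x. norm (f x) \<partial>M) \<le> s * measure M (space M) + s powr (1 - p) * Lp_pow M p f" .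
qed

text \<open>The threshold \<open>s\<close> is fixed first, to make \<open>s\<close> times the total
  mass small. The possibly huge factor \<open>s powr (1 - p)\<close> is then a constant in front of
  a null sequence.\<close>

lemma (in finite_measure) L1_tendsto_of_Lp:
  assumes "\<And>n::nat. mem_Lp M p (f n)" "1 \<le> p" "(\<lambda>n. Lp_pow M p (f n)) \<longlonglongrightarrow> 0"
  shows "(\<lambda>n. \<integral>x. norm (f n x) \<partial>M) \<longlonglongrightarrow> 0"
proof (rule LIMSEQ_I)
  fix r :: real assume "0 < r"
  define m where "m = measure M (space M)"
  define s where "s = r / (2 * (m + 1))"
  have m: "m \<ge> 0" by (simp add: m_def)
  have s: "s > 0" using \<open>0 < r\<close> m by (simp add: s_def)
  have sm: "s * m < r / 2"
  proof -
    have "s * m < s * (m + 1)" using s by simp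
    also have "\<dots> = r / 2" using m by (simp add: s_def field_simps)
    finally show ?thesis .
  qed
  have "(\<lambda>n. s powr (1 - p) * Lp_pow M p (f n)) \<longlonglongrightarrow> 0"
    using tendsto_mult_left[OF assms(3), of "s powr (1-p)"] by simp
  then have "\<forall>\<^sub>F n in sequentially. s powr (1 - p) * Lp_pow M p (f n) < r / 2"
    using \<open>0 < r\<close> by (intro order_tendstoD(2)[where y = 0]) auto
  then obtain N where N: "\<And>n. n \<ge> N \<Longrightarrow> s powr (1 - p) * Lp_pow M p (f n) < r / 2"
    by (auto simp: eventually_sequentially)
  show "\<exists>no. \<forall>n\<ge>no. norm ((\<integral>x. norm (f n x) \<partial>M) - 0) < r"
  proof (intro exI allI impI)
    fix n assume "n \<ge> N"
    have "(\<integral>x. norm (f n x) \<partial>M) \<le> s * m + s powr (1 - p) * Lp_pow M p (f n)"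
      unfolding m_def by (rule mem_Lp_imp_integrable(2)[OF assms(1,2) s])
    also have "\<dots> < r" using N[OF \<open>n \<ge> N\<close>] sm by linarith
    finally show "norm ((\<integral>x. norm (f n x) \<partial>M) - 0) < r"
      by (simp add: Bochner_Integration.integral_nonneg)
  qed
qed

text \<open>The threshold bound restricted to \<open>E\<close> is optimised in \<open>s\<close>. At
  the optimum both terms are equal, whence the factor 2 in place of the sharp constant 1.\<close>

lemma Holder_set:
  assumes f: "mem_Lp M p f" and p: "1 \<le> p" and E: "E \<in> sets M" "emeasure M E < \<infinity>"
  shows "(\<integral>x. indicator E x * norm (f x) \<partial>M) \<le>
     2 * (\<integral>x. indicator E x * norm (f x) powr p \<partial>M) powr (1 / p) * measure M E powr (1 - 1 / p)"
proof -
  define G where "G = (\<integral>x. indicator E x * norm (f x) powr p \<partial>M)"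
  define m where "m = measure M E"
  note [measurable] = E(1)
  have [measurable]: "f \<in> borel_measurable M" using f by (simp add: mem_Lp_def)
  have G0: "0 \<le> G" unfolding G_def by (rule Bochner_Integration.integral_nonneg) auto
  have iG: "integrable M (\<lambda>x. indicator E x * norm (f x) powr p)"
    using f integrable_real_mult_indicator[OF E(1), of "\<lambda>x. norm (f x) powr p"] by (simp add: mem_Lp_def mult.commute)
  have iE: "integrable M (indicator E :: 'a \<Rightarrow> real)" using E by simp
  have *: "(\<integral>x. indicator E x * norm (f x) \<partial>M) \<le> s * m + s powr (1 - p) * G" if s: "s > 0" for s
  proof -
    have "(\<integral>x. indicator E x * norm (f x) \<partial>M)
        \<le> (\<integral>x. s * indicator E x + s powr (1 - p) * (indicator E x * norm (f x) powr p) \<partial>M)"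
    proof (rule Bochner_Integration.integral_mono_AE')
      show "integrable M (\<lambda>x. s * indicator E x + s powr (1 - p) * (indicator E x * norm (f x) powr p))"
        using iG iE by simp
    qed (use le_powr_threshold[OF _ s p] s in \<open>auto simp: indicator_def\<close>)
    also have "\<dots> = s * m + s powr (1 - p) * G"
      using iG iE by (simp add: m_def G_def)
    finally show ?thesis .
  qed
  show ?thesis
  proof (cases "G = 0 \<or> m = 0")
    case False
    then have pos: "G > 0" "m > 0" using G0 by (auto simp: m_def less_le)
    \<comment> \<open>The value that balances \<open>s * m\<close> against
      \<open>s powr (1 - p) * G\<close>.\<close>
    define s where "s = (G / m) powr (1 / p)"
    have s: "s > 0" using pos by (simp add: s_def)
    have 1: "s * m = G powr (1/p) * m powr (1 - 1/p)"
      using pos by (simp add: s_def powr_divide powr_diff)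
    have "s powr (1 - p) * G = s * (s powr (-p) * G)"
      using s by (simp add: powr_diff powr_minus field_simps)
    also have "s powr (-p) = m / G"
      using pos p by (simp add: s_def powr_powr powr_minus)
    finally have 2: "s powr (1 - p) * G = s * m" using pos by simp
    show ?thesis using *[OF s] 1 2 by (fold G_def m_def) linarith
  next
    case True
    \<comment> \<open>In the degenerate cases there is no positive balancing threshold, but then the
      left-hand side is zero.\<close>
    have "AE x in M. indicator E x * norm (f x) = 0"
    proof (cases "G = 0")
      case True
      then have "AE x in M. indicator E x * norm (f x) powr p = 0"
        using integral_nonneg_eq_0_iff_AE[OF iG] by (simp add: G_def)
      then show ?thesis by eventually_elim auto
    next
      case False
      then have "E \<in> null_sets M" using True E
        by (auto simp: m_def measure_def enn2real_eq_0_iff null_sets_def)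
      then have "AE x in M. x \<notin> E" by (rule AE_not_in)
      then show ?thesis by eventually_elim auto
    qed
    then have "(\<integral>x. indicator E x * norm (f x) \<partial>M) = 0"
      by (rule integral_eq_zero_AE)
    then show ?thesis using G0 by (fold G_def m_def) simp
  qed
qed

lemma Lp_AE_subseq:
  assumes "\<And>n::nat. mem_Lp M p (\<lambda>x. f n x - f' x)" "(\<lambda>n. Lp_pow M p (\<lambda>x. f n x - f' x)) \<longlonglongrightarrow> 0" "0 < p"
  obtains r :: "nat \<Rightarrow> nat" where "strict_mono r" "AE x in M. (\<lambda>n. f (r n) x) \<longlonglongrightarrow> f' x"
proof -
  obtain r :: "nat \<Rightarrow> nat" where r: "strict_mono r"
      "AE x in M. (\<lambda>n. norm (f (r n) x - f' x) powr p) \<longlonglongrightarrow> 0"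
    using tendsto_L1_AE_subseq[of M "\<lambda>n x. norm (f n x - f' x) powr p"] assms
    by (auto simp: mem_Lp_def Lp_pow_def)
  have "AE x in M. (\<lambda>n. f (r n) x) \<longlonglongrightarrow> f' x"
    using r(2)
  proof eventually_elim
    case (elim x)
    have "(\<lambda>n. (norm (f (r n) x - f' x) powr p) powr (1 / p)) \<longlonglongrightarrow> 0"
      using tendsto_powr'[OF elim tendsto_const[of "1/p"]] assms(3) by auto
    then have "(\<lambda>n. norm (f (r n) x - f' x)) \<longlonglongrightarrow> 0"
      using assms(3) by (simp add: powr_powr)
    then show ?case by (simp add: tendsto_norm_zero_iff LIM_zero_iff)
  qed
  with r(1) that show thesis by blast
qed

section \<open>Continuously differentiable functions\<close>

text \<open>The gradient is an explicit argument, so that approximation of a function together with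
  its gradient can be stated without a choice operator.\<close>

definition C1_fun :: "('a::euclidean_space \<Rightarrow> real) \<Rightarrow> ('a \<Rightarrow> 'a) \<Rightarrow> bool" where
  "C1_fun v v' \<longleftrightarrow> (\<forall>x. GDERIV v x :> v' x) \<and> continuous_on UNIV v'"

lemma GDERIV_unique:
  fixes f :: "'a::euclidean_space \<Rightarrow> real"
  assumes "GDERIV f x :> a" "GDERIV f x :> b"
  shows "a = b"
proof -
  have "(\<lambda>h. h \<bullet> a) = (\<lambda>h. h \<bullet> b)"
    using assms unfolding gderiv_def by (rule has_derivative_unique)
  then show ?thesis by (metis inner_commute vector_eq_rdot)
qed

lemma C1_fun_gderiv: "C1_fun v v' \<Longrightarrow> GDERIV v x :> v' x"
  by (simp add: C1_fun_def)

lemma C1_fun_continuous: "C1_fun v v' \<Longrightarrow> continuous_on UNIV v"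
  unfolding C1_fun_def gderiv_def
  using has_derivative_continuous by (fastforce intro: continuous_at_imp_continuous_on)

lemma C1_fun_continuous': "C1_fun v v' \<Longrightarrow> continuous_on UNIV v'"
  unfolding C1_fun_def by blast

lemma C1_fun_borel: "C1_fun v v' \<Longrightarrow> v \<in> borel_measurable borel" "C1_fun v v' \<Longrightarrow> v' \<in> borel_measurable borel"
  by (auto intro: borel_measurable_continuous_onI C1_fun_continuous C1_fun_continuous')

lemma C1_fun_add: "C1_fun v v' \<Longrightarrow> C1_fun w w' \<Longrightarrow> C1_fun (\<lambda>x. v x + w x) (\<lambda>x. v' x + w' x)"
  unfolding C1_fun_def by (auto intro: GDERIV_add continuous_intros)

lemma C1_fun_uminus: "C1_fun v v' \<Longrightarrow> C1_fun (\<lambda>x. - v x) (\<lambda>x. - v' x)"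
  unfolding C1_fun_def by (auto intro: GDERIV_minus continuous_intros)

lemma C1_fun_mult: "C1_fun v v' \<Longrightarrow> C1_fun w w' \<Longrightarrow> C1_fun (\<lambda>x. v x * w x) (\<lambda>x. v x *\<^sub>R w' x + w x *\<^sub>R v' x)"
  using C1_fun_continuous[of v v'] C1_fun_continuous[of w w']
  unfolding C1_fun_def by (auto intro!: GDERIV_mult continuous_intros)

lemma C1_fun_compose:
  assumes "C1_fun v v'" "\<And>r::real. (S has_real_derivative S' r) (at r)" "continuous_on UNIV S'"
  shows "C1_fun (\<lambda>x. S (v x)) (\<lambda>x. S' (v x) *\<^sub>R v' x)"
  unfolding C1_fun_def
proof safe
  show "GDERIV (\<lambda>x. S (v x)) x :> S' (v x) *\<^sub>R v' x" for x
    using assms by (intro GDERIV_DERIV_compose) (auto simp: C1_fun_def)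
  show "continuous_on UNIV (\<lambda>x. S' (v x) *\<^sub>R v' x)"
    using assms C1_fun_continuous[OF assms(1)] C1_fun_continuous'[OF assms(1)]
    by (intro continuous_intros continuous_on_compose2[OF assms(3)]) auto
qed

lemma C1_fun_support_deriv:
  assumes "C1_fun v v'" "closed K" "\<And>x. x \<notin> K \<Longrightarrow> v x = 0" "x \<notin> K"
  shows "v' x = 0"
proof -
  have "GDERIV (\<lambda>_. 0) x :> (0::'a)" by (rule GDERIV_const)
  then have "GDERIV v x :> 0"
    unfolding gderiv_def
    by (rule has_derivative_transform_within_open[where s = "- K"]) (use assms in auto)
  then show ?thesis using C1_fun_gderiv[OF assms(1)] GDERIV_unique by blast
qed

text \<open>The closure of the support is traded for an arbitrary compact \<open>K\<close> off which
  \<open>v\<close> vanishes. Such a \<open>K\<close> is easily passed on to products and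
  compositions.\<close>

lemma C1c_iff:
  "v \<in> C1c \<Omega> \<longleftrightarrow> (\<exists>v' K. C1_fun v v' \<and> compact K \<and> K \<subseteq> \<Omega> \<and> (\<forall>x. x \<notin> K \<longrightarrow> v x = 0))"
proof
  assume "v \<in> C1c \<Omega>"
  moreover have "x \<in> closure {x. v x \<noteq> 0}" if "v x \<noteq> 0" for x
    using that closure_subset by fastforce
  ultimately show "\<exists>v' K. C1_fun v v' \<and> compact K \<and> K \<subseteq> \<Omega> \<and> (\<forall>x. x \<notin> K \<longrightarrow> v x = 0)"
    unfolding C1c_def C1_fun_def by blast
next
  assume "\<exists>v' K. C1_fun v v' \<and> compact K \<and> K \<subseteq> \<Omega> \<and> (\<forall>x. x \<notin> K \<longrightarrow> v x = 0)"
  then obtain v' K where *: "C1_fun v v'" "compact K" "K \<subseteq> \<Omega>" "\<And>x. x \<notin> K \<Longrightarrow> v x = 0" by blast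
  have "closure {x. v x \<noteq> 0} \<subseteq> K"
    using * by (intro closure_minimal) (auto simp: compact_imp_closed)
  then show "v \<in> C1c \<Omega>"
    using * compact_Int_closed[OF *(2) closed_closure[of "{x. v x \<noteq> 0}"]]
    unfolding C1c_def C1_fun_def by (auto simp: inf.absorb2)
qed

lemma continuous_compact_support_bounded:
  fixes f :: "'a::euclidean_space \<Rightarrow> 'b::euclidean_space"
  assumes "continuous_on UNIV f" "compact K" "\<And>x. x \<notin> K \<Longrightarrow> f x = 0"
  obtains B where "B > 0" "\<And>x. norm (f x) \<le> B"
proof -
  have "bounded (f ` K)"
    using assms by (intro compact_imp_bounded compact_continuous_image) (auto intro: continuous_on_subset)
  then obtain B where "B > 0" "\<And>x. x \<in> K \<Longrightarrow> norm (f x) \<le> B"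
    by (auto simp: bounded_pos)
  with that[of B] assms(3) show thesis by (metis less_imp_le norm_zero)
qed

lemma continuous_compact_support_integrable:
  fixes f :: "'a::euclidean_space \<Rightarrow> 'b::euclidean_space"
  assumes "continuous_on UNIV f" "compact K" "\<And>x. x \<notin> K \<Longrightarrow> f x = 0"
  shows "integrable lborel f"
proof -
  have "integrable lborel (\<lambda>x. indicator K x *\<^sub>R f x)"
    using assms by (intro borel_integrable_compact) (auto intro: continuous_on_subset)
  moreover have "(\<lambda>x. indicator K x *\<^sub>R f x) = f"
    using assms(3) by (auto simp: indicator_def)
  ultimately show ?thesis by simp
qed

section \<open>Difference quotients and translations\<close>

lemma C1_fun_lipschitz:
  assumes v: "C1_fun v v'" and B: "\<And>x. norm (v' x) \<le> B"
  shows "\<bar>v y - v x\<bar> \<le> B * norm (y - x)"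
proof -
  have "norm (v y - v x) \<le> B * norm (y - x)"
  proof (rule differentiable_bound[of UNIV v "\<lambda>x h. h \<bullet> v' x"])
    fix x
    show "(v has_derivative (\<lambda>h. h \<bullet> v' x)) (at x within UNIV)"
      using C1_fun_gderiv[OF v] by (simp add: gderiv_def)
    show "onorm (\<lambda>h. h \<bullet> v' x) \<le> B"
    proof (rule onorm_bound)
      show "0 \<le> B" using B[of x] norm_ge_zero order_trans by blast
      show "norm (h \<bullet> v' x) \<le> B * norm h" for h
        using Cauchy_Schwarz_ineq2[of h "v' x"] B[of x] mult_left_mono[OF B[of x], of "norm h"]
        by (simp add: mult.commute)
    qed
  qed auto
  then show ?thesis by simp
qed

lemma C1_fun_quotient:
  assumes v: "C1_fun v v'"
  shows "(\<lambda>n. real (Suc n) * (v (x + (1 / real (Suc n)) *\<^sub>R h) - v x)) \<longlonglongrightarrow> h \<bullet> v' x"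
proof -
  have "((\<lambda>t. v (x + t *\<^sub>R h)) has_derivative (\<lambda>t. (t *\<^sub>R h) \<bullet> v' x)) (at 0)"
  proof (rule has_derivative_compose[of "\<lambda>t. x + t *\<^sub>R h" "\<lambda>t. t *\<^sub>R h" 0 UNIV v "\<lambda>k. k \<bullet> v' x"])
    show "((\<lambda>t. x + t *\<^sub>R h) has_derivative (\<lambda>t. t *\<^sub>R h)) (at 0)"
      by (auto intro!: derivative_eq_intros)
    show "(v has_derivative (\<lambda>k. k \<bullet> v' x)) (at (x + 0 *\<^sub>R h))"
      using C1_fun_gderiv[OF v, of x] by (simp add: gderiv_def)
  qed
  then have "((\<lambda>t. v (x + t *\<^sub>R h)) has_real_derivative (h \<bullet> v' x)) (at 0)"
    by (rule has_derivative_imp_has_field_derivative) (simp add: mult.commute)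
  then have lim: "((\<lambda>t. (v (x + t *\<^sub>R h) - v x) / t) \<longlongrightarrow> h \<bullet> v' x) (at 0)"
    by (simp add: DERIV_def)
  have "filterlim (\<lambda>n. 1 / real (Suc n)) (at 0) sequentially"
    unfolding filterlim_at
    using LIMSEQ_inverse_real_of_nat by (simp add: inverse_eq_divide)
  from filterlim_compose[OF lim this] show ?thesis
    by (simp add: mult.commute)
qed

lemma integrable_translation:
  fixes f :: "'a::euclidean_space \<Rightarrow> 'b::euclidean_space"
  assumes "f \<in> borel_measurable borel"
  shows "integrable lborel (\<lambda>x. f (x + h)) \<longleftrightarrow> integrable lborel f"
proof -
  have "integrable (distr lborel borel ((+) h)) f \<longleftrightarrow> integrable lborel (\<lambda>x. f (h + x))"
    using assms by (intro integrable_distr_eq) auto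
  then show ?thesis by (simp add: lborel_distr_plus add.commute)
qed

lemma integral_translation:
  fixes f :: "'a::euclidean_space \<Rightarrow> 'b::euclidean_space"
  assumes "f \<in> borel_measurable borel"
  shows "(\<integral>x. f (x + h) \<partial>lborel) = (\<integral>x. f x \<partial>lborel)"
proof -
  have "(\<integral>x. f x \<partial>distr lborel borel ((+) h)) = (\<integral>x. f (h + x) \<partial>lborel)"
    using assms by (intro integral_distr) auto
  then show ?thesis by (simp add: lborel_distr_plus add.commute)
qed

lemma nn_integral_translation:
  fixes f :: "'a::euclidean_space \<Rightarrow> ennreal"
  assumes "f \<in> borel_measurable borel"
  shows "(\<integral>\<^sup>+x. f (x + h) \<partial>lborel) = (\<integral>\<^sup>+x. f x \<partial>lborel)"
proof -
  have "(\<integral>\<^sup>+x. f x \<partial>distr lborel borel ((+) h)) = (\<integral>\<^sup>+x. f (h + x) \<partial>lborel)"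
    using assms by (intro nn_integral_distr) auto
  then show ?thesis by (simp add: lborel_distr_plus add.commute)
qed

text \<open>\<open>F\<close> is the identity when the integral of a gradient is computed and the
  absolute value when translations are estimated in L1.\<close>

lemma C1_fun_quotient_tendsto:
  fixes v :: "'a::euclidean_space \<Rightarrow> real" and F :: "real \<Rightarrow> real"
  assumes v: "C1_fun v v'" and K: "compact K" "\<And>x. x \<notin> K \<Longrightarrow> v x = 0"
    and F: "continuous_on UNIV F" "\<And>r. \<bar>F r\<bar> = \<bar>r\<bar>"
  shows "(\<lambda>n. \<integral>x. F (real (Suc n) * (v (x + (1 / real (Suc n)) *\<^sub>R h) - v x)) \<partial>lborel)
     \<longlonglongrightarrow> (\<integral>x. F (h \<bullet> v' x) \<partial>lborel)"
proof -
  obtain R where R: "K \<subseteq> cball 0 R"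
    using bounded_subset_ballD[OF compact_imp_bounded[OF K(1)], of 0] ball_subset_cball by blast
  obtain B where B: "B > 0" "\<And>x. norm (v' x) \<le> B"
    using continuous_compact_support_bounded[OF C1_fun_continuous'[OF v] K(1)]
      C1_fun_support_deriv[OF v compact_imp_closed[OF K(1)] K(2)] by blast
  have [measurable]: "v \<in> borel_measurable borel" "v' \<in> borel_measurable borel" "F \<in> borel_measurable borel"
    using C1_fun_borel[OF v] F by (auto intro: borel_measurable_continuous_onI)
  show ?thesis
  \<comment> \<open>The Lipschitz bound controls the quotients by \<open>B * norm h\<close>. Steps
    have length at most \<open>norm h\<close>, so all quotients vanish outside the ball of radius
    \<open>R + norm h\<close>.\<close>
  proof (rule integral_dominated_convergence[where w = "\<lambda>x. indicator (cball 0 (R + norm h)) x * (B * norm h)"])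
    show "integrable lborel (\<lambda>x::'a. indicator (cball 0 (R + norm h)) x * (B * norm h))"
      using borel_integrable_compact[of "cball 0 (R + norm h)" "\<lambda>_. B * norm h"] by simp
    show "AE x in lborel. (\<lambda>n. F (real (Suc n) * (v (x + (1 / real (Suc n)) *\<^sub>R h) - v x)))
        \<longlonglongrightarrow> F (h \<bullet> v' x)"
      by (rule AE_I2, rule isCont_tendsto_compose[OF _ C1_fun_quotient[OF v]])
        (use F in \<open>simp add: continuous_on_eq_continuous_at\<close>)
    show "AE x in lborel. norm (F (real (Suc n) * (v (x + (1 / real (Suc n)) *\<^sub>R h) - v x)))
          \<le> indicator (cball 0 (R + norm h)) x * (B * norm h)" for n
    proof (rule AE_I2)
      fix x
      define s where "s = 1 / real (Suc n)"
      have s: "0 \<le> s" "s \<le> 1" "real (Suc n) * s = 1" by (auto simp: s_def)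
      have "\<bar>v (x + s *\<^sub>R h) - v x\<bar> \<le> B * (s * norm h)"
        using C1_fun_lipschitz[OF v B(2), of "x + s *\<^sub>R h" x] s by simp
      then have "real (Suc n) * \<bar>v (x + s *\<^sub>R h) - v x\<bar> \<le> real (Suc n) * (B * (s * norm h))"
        by (rule mult_left_mono) simp
      also have "\<dots> = (real (Suc n) * s) * (B * norm h)" by (simp only: ac_simps)
      finally have 1: "real (Suc n) * \<bar>v (x + s *\<^sub>R h) - v x\<bar> \<le> B * norm h" by (simp only: s mult_1)
      have out: "v (x + s *\<^sub>R h) = 0 \<and> v x = 0" if "x \<notin> cball 0 (R + norm h)"
      proof -
        have x: "norm x > R + norm h" using that by simp
        have "norm x \<le> norm (x + s *\<^sub>R h) + norm (- (s *\<^sub>R h))"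
          using norm_triangle_ineq[of "x + s *\<^sub>R h" "- (s *\<^sub>R h)"] by simp
        moreover have "norm (- (s *\<^sub>R h)) \<le> norm h"
          using s by (simp add: mult_left_le_one_le)
        ultimately have "norm (x + s *\<^sub>R h) > R" "norm x > R"
          using x norm_ge_zero[of h] by linarith+
        then have "x + s *\<^sub>R h \<notin> K" "x \<notin> K" using R by (auto simp: subset_iff)
        then show ?thesis using K(2) by blast
      qed
      show "norm (F (real (Suc n) * (v (x + (1 / real (Suc n)) *\<^sub>R h) - v x))) \<le> indicator (cball 0 (R + norm h)) x * (B * norm h)"
      proof (cases "x \<in> cball 0 (R + norm h)")
        case True
        then show ?thesis using 1 by (simp add: F(2) abs_mult s_def del: of_nat_Suc)
      next
        case False
        then show ?thesis using out F(2)[of 0] by (simp add: s_def)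
      qed
    qed
  qed auto
qed

text \<open>Translation invariance makes the integral of every difference quotient zero, and the
  limit inherits this. No divergence theorem is involved.\<close>

lemma C1_integral_gradient_eq_0:
  assumes v: "C1_fun v v'" and K: "compact K" "\<And>x. x \<notin> K \<Longrightarrow> v x = 0"
  shows "(\<integral>x. v' x \<partial>lborel) = 0"
proof -
  have iv: "integrable lborel v"
    using continuous_compact_support_integrable[OF C1_fun_continuous[OF v] K] .
  have iv': "integrable lborel v'"
    using continuous_compact_support_integrable[OF C1_fun_continuous'[OF v] K(1)]
      C1_fun_support_deriv[OF v compact_imp_closed[OF K(1)] K(2)] by blast
  have "h \<bullet> (\<integral>x. v' x \<partial>lborel) = 0" for h
  proof -
    have "(\<integral>x. real (Suc n) * (v (x + (1 / real (Suc n)) *\<^sub>R h) - v x) \<partial>lborel) = 0" for n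
      using iv integral_translation[OF C1_fun_borel(1)[OF v]] integrable_translation[OF C1_fun_borel(1)[OF v]]
      by simp
    moreover have "(\<lambda>n. \<integral>x. real (Suc n) * (v (x + (1 / real (Suc n)) *\<^sub>R h) - v x) \<partial>lborel)
     \<longlonglongrightarrow> (\<integral>x. h \<bullet> v' x \<partial>lborel)"
      using C1_fun_quotient_tendsto[OF v K, of "\<lambda>x. x"] by simp
    ultimately have "(\<integral>x. h \<bullet> v' x \<partial>lborel) = 0"
      by (simp only: LIMSEQ_const_iff)
    then show ?thesis using iv' by simp
  qed
  then show ?thesis using inner_eq_zero_iff by blast
qed

text \<open>The L1 distance \<open>D h\<close> between \<open>v\<close> and its translate is
  subadditive in \<open>h\<close>, so \<open>D h\<close> is at most \<open>n\<close> times
  \<open>D (h / n)\<close>. As \<open>n\<close> grows, this bound tends to the integral of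
  \<open>\<bar>h \<bullet> v' x\<bar>\<close>.\<close>

lemma C1_translation_L1:
  assumes v: "C1_fun v v'" and K: "compact K" "\<And>x. x \<notin> K \<Longrightarrow> v x = 0"
  shows "(\<integral>x. \<bar>v (x + h) - v x\<bar> \<partial>lborel) \<le> norm h * (\<integral>x. norm (v' x) \<partial>lborel)"
proof -
  note vb = C1_fun_borel(1)[OF v]
  have [measurable]: "v \<in> borel_measurable borel" by (rule vb)
  have iv: "integrable lborel v"
    using continuous_compact_support_integrable[OF C1_fun_continuous[OF v] K] .
  have iv': "integrable lborel v'"
    using continuous_compact_support_integrable[OF C1_fun_continuous'[OF v] K(1)]
      C1_fun_support_deriv[OF v compact_imp_closed[OF K(1)] K(2)] by blast
  have ivt: "integrable lborel (\<lambda>x. v (x + k))" for k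
    using integrable_translation[OF vb] iv by blast
  have id: "integrable lborel (\<lambda>x. \<bar>v (x + k) - v (x + l)\<bar>)" for k l
    using ivt by auto
  define D where "D k = (\<integral>x. \<bar>v (x + k) - v x\<bar> \<partial>lborel)" for k
  have sub: "D (k + l) \<le> D k + D l" for k l
  proof -
    have "D (k + l) \<le> (\<integral>x. \<bar>v (x + l + k) - v (x + l)\<bar> + \<bar>v (x + l) - v x\<bar> \<partial>lborel)"
      unfolding D_def
    proof (rule integral_mono)
      show "integrable lborel (\<lambda>x. \<bar>v (x + l + k) - v (x + l)\<bar> + \<bar>v (x + l) - v x\<bar>)"
        using id[of "l + k" l] id[of l 0] by (auto simp: add.assoc)
      show "integrable lborel (\<lambda>x. \<bar>v (x + (k + l)) - v x\<bar>)" using id[of "k + l" 0] by simp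
    qed (simp add: add.commute add.left_commute)
    also have "\<dots> = (\<integral>x. \<bar>v (x + l + k) - v (x + l)\<bar> \<partial>lborel) + D l"
      unfolding D_def using id[of "l + k" l] id[of l 0] by (simp add: add.assoc)
    also have "(\<integral>x. \<bar>v (x + l + k) - v (x + l)\<bar> \<partial>lborel) = D k"
      unfolding D_def using integral_translation[of "\<lambda>x. \<bar>v (x + k) - v x\<bar>" l] by simp
    finally show ?thesis .
  qed
  have D0: "D 0 = 0" by (simp add: D_def)
  have mult: "D (real n *\<^sub>R k) \<le> real n * D k" for n k
  proof (induction n)
    case (Suc n)
    have "D (real (Suc n) *\<^sub>R k) \<le> D (real n *\<^sub>R k) + D k"
      using sub[of "real n *\<^sub>R k" k] by (simp add: algebra_simps)
    with Suc show ?case by (simp add: algebra_simps)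
  qed (simp add: D0)
  have "D h \<le> (\<integral>x. \<bar>real (Suc n) * (v (x + (1 / real (Suc n)) *\<^sub>R h) - v x)\<bar> \<partial>lborel)" for n
    using mult[of "Suc n" "(1 / real (Suc n)) *\<^sub>R h"]
    by (simp add: D_def abs_mult del: of_nat_Suc)
  then have "D h \<le> (\<integral>x. \<bar>h \<bullet> v' x\<bar> \<partial>lborel)"
    by (intro LIMSEQ_le_const[OF C1_fun_quotient_tendsto[OF v K, of abs]]) (auto intro: continuous_intros)
  also have "\<dots> \<le> (\<integral>x. norm h * norm (v' x) \<partial>lborel)"
    using iv' by (intro integral_mono) (auto intro: Cauchy_Schwarz_ineq2)
  finally show ?thesis by (simp add: D_def)
qed

section \<open>Mollification\<close>

definition mollifier :: "real \<Rightarrow> ('a::euclidean_space \<Rightarrow> real) \<Rightarrow> ('a \<Rightarrow> 'a) \<Rightarrow> bool" where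
  "mollifier e \<rho> \<rho>' \<longleftrightarrow> C1_fun \<rho> \<rho>' \<and> (\<forall>x. 0 \<le> \<rho> x) \<and> (\<forall>x. e \<le> norm x \<longrightarrow> \<rho> x = 0) \<and>
     (\<integral>x. \<rho> x \<partial>lborel) = 1"

definition mollify :: "('a::euclidean_space \<Rightarrow> real) \<Rightarrow> ('a \<Rightarrow> 'b::euclidean_space) \<Rightarrow> 'a \<Rightarrow> 'b" where
  "mollify \<rho> F x = (\<integral>y. \<rho> (x - y) *\<^sub>R F y \<partial>lborel)"

text \<open>Squaring makes the positive part continuously differentiable. Both the mollifying kernel
  and the smooth truncations in \<open>C1_approx_pos_part\<close> are built from it.\<close>

lemma DERIV_max0_square: "((\<lambda>s::real. (max 0 s)\<^sup>2) has_real_derivative 2 * max 0 s) (at s)"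
proof (cases "s = 0")
  case True
  have "((\<lambda>h::real. (max 0 h)\<^sup>2 / h) \<longlongrightarrow> 0) (at 0)"
  proof (rule Lim_null_comparison)
    show "\<forall>\<^sub>F h::real in at 0. norm ((max 0 h)\<^sup>2 / h) \<le> \<bar>h\<bar>"
      by (rule always_eventually) (auto simp: max_def power2_eq_square)
    show "((\<lambda>h::real. \<bar>h\<bar>) \<longlongrightarrow> 0) (at 0)" by (auto intro!: tendsto_eq_intros)
  qed
  then show ?thesis using True by (simp add: DERIV_def)
next
  case False
  show ?thesis
  proof (cases "s > 0")
    case True
    have "((\<lambda>s::real. s\<^sup>2) has_real_derivative 2 * max 0 s) (at s)"
      using True by (auto intro!: derivative_eq_intros)
    then show ?thesis
      by (rule has_field_derivative_transform_within_open[where S = "{0<..}"]) (use True in auto)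
  next
    case neg: False
    have "((\<lambda>s::real. 0) has_real_derivative 2 * max 0 s) (at s)"
      using neg by (auto intro!: derivative_eq_intros)
    then show ?thesis
      by (rule has_field_derivative_transform_within_open[where S = "{..<0}"]) (use neg False in auto)
  qed
qed

text \<open>The squared positive part of \<open>e\<^sup>2 - x \<bullet> x\<close>, divided by its
  integral. Once continuously differentiable is all that \<open>C1c\<close> asks of a test
  function.\<close>

lemma mollifier_exists:
  assumes "0 < e"
  obtains \<rho> \<rho>' where "mollifier e (\<rho> :: 'a::euclidean_space \<Rightarrow> real) \<rho>'"
proof -
  define v where "v x = (max 0 (e\<^sup>2 - x \<bullet> x))\<^sup>2" for x :: 'a
  have "C1_fun (\<lambda>x::'a. e\<^sup>2 - x \<bullet> x) (\<lambda>x. - 2 *\<^sub>R x)"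
    unfolding C1_fun_def gderiv_def
    by (auto intro!: derivative_eq_intros continuous_intros simp: inner_commute)
  then have v: "C1_fun v (\<lambda>x. (2 * max 0 (e\<^sup>2 - x \<bullet> x)) *\<^sub>R (- 2 *\<^sub>R x))"
    unfolding v_def by (rule C1_fun_compose) (auto intro!: DERIV_max0_square continuous_intros)
  have v0: "0 \<le> v x" for x by (simp add: v_def)
  have vz: "v x = 0" if "e \<le> norm x" for x
  proof -
    have "e\<^sup>2 \<le> x \<bullet> x" using that assms by (simp add: dot_square_norm power_mono)
    then show ?thesis by (simp add: v_def)
  qed
  have iv: "integrable lborel v"
    by (rule continuous_compact_support_integrable[OF C1_fun_continuous[OF v], of "cball 0 e"])
      (use vz in auto)
  \<comment> \<open>A lower bound of \<open>v\<close> on the ball of half the radius; it makes the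
    normalising integral positive.\<close>
  define c where "c = (e\<^sup>2 - (e / 2)\<^sup>2)\<^sup>2"
  have c: "c > 0" using assms by (simp add: c_def power_divide)
  have cv: "c \<le> v x" if "x \<in> ball 0 (e / 2)" for x
  proof -
    have "x \<bullet> x \<le> (e / 2)\<^sup>2" using that by (simp add: dot_square_norm power_mono)
    moreover have "0 \<le> e\<^sup>2 - (e / 2)\<^sup>2" using assms by (simp add: power_divide)
    ultimately show ?thesis unfolding c_def v_def by (intro power_mono) auto
  qed
  have fin: "emeasure lborel (ball (0::'a) (e/2)) < \<infinity>" by (rule emeasure_lborel_ball_finite)
  have "0 < c * measure lborel (ball (0::'a) (e / 2))"
    using c assms by (simp add: content_ball_pos)
  also have "\<dots> = (\<integral>x. c * indicator (ball (0::'a) (e/2)) x \<partial>lborel)"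
    using fin by simp
  also have "\<dots> \<le> (\<integral>x. v x \<partial>lborel)"
  proof (rule integral_mono[OF _ iv])
    show "integrable lborel (\<lambda>x. c * indicator (ball (0::'a) (e/2)) x)"
      using fin by (intro integrable_mult_right) auto
    show "c * indicator (ball 0 (e/2)) x \<le> v x" for x
      using cv v0 by (cases "x \<in> ball 0 (e/2)") auto
  qed
  finally have Z: "0 < (\<integral>x. v x \<partial>lborel)" .
  define Z where "Z = (\<integral>x. v x \<partial>lborel)"
  have Z0: "0 < Z" using Z by (simp add: Z_def)
  have "C1_fun (\<lambda>x. v x * (1 / Z)) (\<lambda>x. (1 / Z) *\<^sub>R ((2 * max 0 (e\<^sup>2 - x \<bullet> x)) *\<^sub>R (- 2 *\<^sub>R x)))"
    by (rule C1_fun_compose[OF v]) (use Z0 in \<open>auto intro!: derivative_eq_intros continuous_intros\<close>)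
  moreover note Z0
  moreover have "(\<integral>x. v x * (1 / Z) \<partial>lborel) = Z * (1 / Z)"
    unfolding Z_def by (rule integral_mult_left_zero)
  ultimately have "mollifier e (\<lambda>x. v x * (1 / Z)) (\<lambda>x. (1 / Z) *\<^sub>R ((2 * max 0 (e\<^sup>2 - x \<bullet> x)) *\<^sub>R (- 2 *\<^sub>R x)))"
    using v0 vz unfolding mollifier_def by auto
  then show thesis by (rule that)
qed

text \<open>Uniform continuity on the compact ball of radius \<open>R + 1\<close> handles two points
  inside it. The margin 1 handles the rest: if one of two points at distance at most 1 lies outside
  that ball, both have norm at least \<open>R\<close> and both values vanish.\<close>

lemma uniformly_continuous_compact_support:
  fixes f :: "'a::euclidean_space \<Rightarrow> 'b::euclidean_space"
  assumes f: "continuous_on UNIV f" "\<And>x. R \<le> norm x \<Longrightarrow> f x = 0" and "0 < \<eta>"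
  obtains d where "0 < d" "\<And>x y. norm (x - y) \<le> d \<Longrightarrow> norm (f x - f y) \<le> \<eta>"
proof -
  have "uniformly_continuous_on (cball 0 (R + 1)) f"
    using f(1) by (intro compact_uniformly_continuous) (auto intro: continuous_on_subset)
  then obtain d where d: "d > 0"
     "\<And>x y. x \<in> cball 0 (R+1) \<Longrightarrow> y \<in> cball 0 (R+1) \<Longrightarrow> dist x y < d \<Longrightarrow> dist (f x) (f y) < \<eta>"
    using \<open>0 < \<eta>\<close> unfolding uniformly_continuous_on_def by metis
  define d' where "d' = min (d / 2) 1"
  have "norm (f x - f y) \<le> \<eta>" if xy: "norm (x - y) \<le> d'" for x y
  proof (cases "x \<in> cball 0 (R+1) \<and> y \<in> cball 0 (R+1)")
    case True
    then show ?thesis using d(2)[of x y] xy d(1) by (auto simp: dist_norm d'_def)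
  next
    case False
    have "norm x \<le> norm y + 1" "norm y \<le> norm x + 1"
      using xy norm_triangle_ineq3[of x y] by (auto simp: d'_def)
    with False have "R \<le> norm x" "R \<le> norm y" by auto
    then show ?thesis using f(2) \<open>0 < \<eta>\<close> by simp
  qed
  moreover have "d' > 0" using d(1) by (simp add: d'_def)
  ultimately show thesis using that by blast
qed

lemma mollifier_C1: "mollifier e \<rho> \<rho>' \<Longrightarrow> C1_fun \<rho> \<rho>'"
  by (simp add: mollifier_def)

lemma mollifier_borel: "mollifier e \<rho> \<rho>' \<Longrightarrow> \<rho> \<in> borel_measurable borel"
  using C1_fun_borel mollifier_C1 by blast

lemma mollifier_borel': "mollifier e \<rho> \<rho>' \<Longrightarrow> \<rho>' \<in> borel_measurable borel"
  using C1_fun_borel mollifier_C1 by blast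

lemma mollifier_zero: "mollifier e \<rho> \<rho>' \<Longrightarrow> e \<le> norm x \<Longrightarrow> \<rho> x = 0"
  by (simp add: mollifier_def)

lemma mollifier_nonneg: "mollifier e \<rho> \<rho>' \<Longrightarrow> 0 \<le> \<rho> x"
  by (simp add: mollifier_def)

lemma mollifier_zero': 
  assumes "mollifier e \<rho> \<rho>'" "e < norm x" shows "\<rho>' x = 0"
  by (rule C1_fun_support_deriv[OF mollifier_C1[OF assms(1)], of "cball 0 e"])
    (use assms mollifier_zero[OF assms(1)] in auto)

lemma mollifier_integrable: "mollifier e \<rho> \<rho>' \<Longrightarrow> integrable lborel \<rho>"
  by (rule continuous_compact_support_integrable[OF C1_fun_continuous[OF mollifier_C1], of e _ _ "cball 0 e"])
    (auto intro: mollifier_zero)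

lemma integral_translation_minus:
  fixes f :: "'a::euclidean_space \<Rightarrow> 'b::euclidean_space"
  assumes f: "f \<in> borel_measurable borel"
  shows "(\<integral>x. f (x - h) \<partial>lborel) = (\<integral>x. f x \<partial>lborel)"
  using integral_translation[OF f, of "- h"] by simp

lemma lborel_distr_uminus_euclidean:
  "distr lborel borel uminus = (lborel :: 'a::euclidean_space measure)"
  by (subst (2) lborel_affine[of "-1" 0]) (auto simp: density_1)

lemma integral_reflect:
  fixes f :: "'a::euclidean_space \<Rightarrow> 'b::euclidean_space"
  assumes f: "f \<in> borel_measurable borel"
  shows "(\<integral>y. f (x - y) \<partial>lborel) = (\<integral>y. f y \<partial>lborel)"
proof -
  have "(\<integral>y. f y \<partial>distr lborel borel uminus) = (\<integral>y. f (- y) \<partial>lborel)"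
    using f by (intro integral_distr) auto
  then have "(\<integral>y. f y \<partial>lborel) = (\<integral>y. f (- y) \<partial>lborel)"
    by (simp add: lborel_distr_uminus_euclidean)
  also have "\<dots> = (\<integral>y. f (- (y - x)) \<partial>lborel)"
    using f by (intro integral_translation_minus[symmetric]) auto
  finally show ?thesis by simp
qed

lemma integrable_reflect:
  fixes f :: "'a::euclidean_space \<Rightarrow> 'b::euclidean_space"
  assumes f: "f \<in> borel_measurable borel"
  shows "integrable lborel (\<lambda>y. f (x - y)) \<longleftrightarrow> integrable lborel f"
proof -
  have "integrable (distr lborel borel uminus) f \<longleftrightarrow> integrable lborel (\<lambda>y. f (- y))"
    using f by (intro integrable_distr_eq) auto
  then have "integrable lborel f \<longleftrightarrow> integrable lborel (\<lambda>y. f (- y))"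
    by (simp add: lborel_distr_uminus_euclidean)
  also have "\<dots> \<longleftrightarrow> integrable lborel (\<lambda>y. f (- (y + (- x))))"
    using f integrable_translation[of "\<lambda>y. f (- y)" "- x"] by simp
  finally show ?thesis by simp
qed

text \<open>Expanding \<open>\<rho> (x + h - y)\<close> to first order, with an error that is uniform in \<open>y\<close>.\<close>

lemma mollify_C1:
  fixes F :: "'a::euclidean_space \<Rightarrow> real"
  assumes \<rho>: "mollifier e \<rho> \<rho>'" and F[measurable]: "F \<in> borel_measurable borel" and C: "\<And>x. \<bar>F x\<bar> \<le> C"
    and e: "0 < e"
  shows "C1_fun (mollify \<rho> F) (\<lambda>x. \<integral>y. F y *\<^sub>R \<rho>' (x - y) \<partial>lborel)"
proof -
  note [measurable] = mollifier_borel[OF \<rho>] mollifier_borel'[OF \<rho>]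
  define m' where "m' x = (\<integral>y. F y *\<^sub>R \<rho>' (x - y) \<partial>lborel)" for x
  have C0: "0 \<le> C" using C[of 0] by linarith
  have c\<rho>: "continuous_on UNIV \<rho>" "continuous_on UNIV \<rho>'"
    using mollifier_C1[OF \<rho>] C1_fun_continuous C1_fun_continuous' by blast+
  have i\<rho>: "integrable lborel \<rho>" by (rule mollifier_integrable[OF \<rho>])
  have i\<rho>': "integrable lborel \<rho>'"
    by (rule continuous_compact_support_integrable[OF c\<rho>(2), of "cball 0 e"]) (use mollifier_zero'[OF \<rho>] in auto)
  have i1: "integrable lborel (\<lambda>y. \<rho> (x - y) *\<^sub>R F y)" for x
    by (rule Bochner_Integration.integrable_bound[where f = "\<lambda>y. C *\<^sub>R \<rho> (x - y)"])
      (use i\<rho> C C0 in \<open>auto simp: integrable_reflect abs_mult mult.commute[of C] intro!: mult_left_mono\<close>)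
  have i2: "integrable lborel (\<lambda>y. F y *\<^sub>R \<rho>' (x - y))" for x
    by (rule Bochner_Integration.integrable_bound[where f = "\<lambda>y. C *\<^sub>R \<rho>' (x - y)"])
      (use i\<rho>' C C0 in \<open>auto simp: integrable_reflect intro!: mult_right_mono\<close>)
  have key: "\<exists>d>0. \<forall>h. norm h < d \<longrightarrow> norm (mollify \<rho> F (x + h) - mollify \<rho> F x - h \<bullet> m' x) \<le> \<eta> * norm h
      \<and> norm (m' (x + h) - m' x) \<le> \<eta>" if "\<eta> > 0" for x \<eta>
  proof -
    define V where "V = measure lborel (cball x (e + 1))"
    have V: "0 \<le> V" by (simp add: V_def)
    \<comment> \<open>Chosen so that \<open>C * \<epsilon> * V \<le> \<eta>\<close>, where
      \<open>C\<close> bounds \<open>F\<close> and \<open>V\<close> is the volume over which the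
      error is integrated. The added ones keep the denominator positive.\<close>
    define \<epsilon> where "\<epsilon> = \<eta> / ((C + 1) * (V + 1))"
    have \<epsilon>: "\<epsilon> > 0" using that C0 V by (simp add: \<epsilon>_def)
    have CV: "C * \<epsilon> * V \<le> \<eta>"
    proof -
      have "C * V \<le> (C + 1) * (V + 1)" using C0 V by (simp add: algebra_simps)
      then have "C * V * \<epsilon> \<le> (C + 1) * (V + 1) * \<epsilon>" using \<epsilon> by simp
      also have "\<dots> = \<eta>" using C0 V by (simp add: \<epsilon>_def)
      finally show ?thesis by (simp add: mult_ac)
    qed
    obtain d where d: "0 < d" "\<And>x y. norm (x - y) \<le> d \<Longrightarrow> norm (\<rho>' x - \<rho>' y) \<le> \<epsilon>"
      by (rule uniformly_continuous_compact_support[OF c\<rho>(2) _ \<epsilon>, of "e+1"]) (use mollifier_zero'[OF \<rho>] in auto)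
    have lin: "norm (\<rho> (z + h) - \<rho> z - h \<bullet> \<rho>' z) \<le> \<epsilon> * norm h" if h: "norm h < d" for z h
    proof -
      \<comment> \<open>The mean value inequality for \<open>\<rho>\<close> minus its linear part at
        \<open>z\<close>. The derivative \<open>\<rho>' w - \<rho>' z\<close> is at most
        \<open>\<epsilon>\<close> in size by uniform continuity, with a radius \<open>d\<close>
        independent of \<open>z\<close>.\<close>
      have "norm ((\<rho> (z + h) - (z + h) \<bullet> \<rho>' z) - (\<rho> z - z \<bullet> \<rho>' z)) \<le> \<epsilon> * norm (z + h - z)"
      proof (rule differentiable_bound[of "ball z d" "\<lambda>w. \<rho> w - w \<bullet> \<rho>' z" "\<lambda>w k. k \<bullet> \<rho>' w - k \<bullet> \<rho>' z"])
        fix w assume w: "w \<in> ball z d"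
        show "((\<lambda>w. \<rho> w - w \<bullet> \<rho>' z) has_derivative (\<lambda>k. k \<bullet> \<rho>' w - k \<bullet> \<rho>' z)) (at w within ball z d)"
        proof (rule has_derivative_diff)
          show "(\<rho> has_derivative (\<lambda>k. k \<bullet> \<rho>' w)) (at w within ball z d)"
            using C1_fun_gderiv[OF mollifier_C1[OF \<rho>], of w] has_derivative_at_withinI
            unfolding gderiv_def by blast
        qed (auto intro!: derivative_eq_intros)
        show "onorm (\<lambda>k. k \<bullet> \<rho>' w - k \<bullet> \<rho>' z) \<le> \<epsilon>"
        proof (rule onorm_bound)
          fix k
          have "norm (k \<bullet> \<rho>' w - k \<bullet> \<rho>' z) \<le> norm k * norm (\<rho>' w - \<rho>' z)"
            using Cauchy_Schwarz_ineq2[of k "\<rho>' w - \<rho>' z"] by (simp add: inner_diff_right)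
          also have "\<dots> \<le> norm k * \<epsilon>"
            using d(2)[of w z] w by (intro mult_left_mono) (auto simp: dist_norm norm_minus_commute)
          finally show "norm (k \<bullet> \<rho>' w - k \<bullet> \<rho>' z) \<le> \<epsilon> * norm k" by (simp add: mult.commute)
        qed (use \<epsilon> in auto)
      qed (use h d(1) in \<open>auto simp: dist_norm\<close>)
      then show ?thesis by (simp add: inner_add_left algebra_simps)
    qed
    \<comment> \<open>Enlarging the radius by 1 makes a single ball around \<open>x\<close> contain
      the supports of the kernels centred at \<open>x\<close> and at \<open>x + h\<close>, for all
      \<open>h\<close> shorter than 1.\<close>
    have far: "\<rho> (x + h - y) = 0 \<and> \<rho> (x - y) = 0 \<and> \<rho>' (x - y) = 0 \<and> \<rho>' (x + h - y) = 0"
      if "norm h < 1" "y \<notin> cball x (e + 1)" for h y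
    proof -
      have 1: "norm (x - y) > e + 1" using that by (simp add: dist_norm)
      have "norm (x - y) \<le> norm (x + h - y) + norm h"
        using norm_triangle_ineq[of "x + h - y" "-h"] by simp
      then have "norm (x + h - y) > e" using 1 that by linarith
      with 1 show ?thesis using mollifier_zero[OF \<rho>] mollifier_zero'[OF \<rho>] by simp
    qed
    have iV: "integrable lborel (\<lambda>y. indicator (cball x (e + 1)) y * c)" for c :: real
      using emeasure_lborel_cball_finite[of x "e+1"] by auto
    have intV: "(\<integral>y. indicator (cball x (e + 1)) y * c \<partial>lborel) = V * c" for c :: real
      by (simp add: V_def)
    show ?thesis
    proof (intro exI conjI allI impI)
      show "0 < min d 1" using d by simp
      fix h :: 'a assume h: "norm h < min d 1"
      have "mollify \<rho> F (x + h) - mollify \<rho> F x - h \<bullet> m' x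
         = (\<integral>y. \<rho> (x + h - y) *\<^sub>R F y - \<rho> (x - y) *\<^sub>R F y - h \<bullet> (F y *\<^sub>R \<rho>' (x - y)) \<partial>lborel)"
      proof -
        have i3: "integrable lborel (\<lambda>y. h \<bullet> (F y *\<^sub>R \<rho>' (x - y)))"
          by (rule integrable_inner_right[OF i2])
        have "h \<bullet> m' x = (\<integral>y. h \<bullet> (F y *\<^sub>R \<rho>' (x - y)) \<partial>lborel)"
          unfolding m'_def by (rule integral_inner_right[symmetric]) (rule i2)
        then show ?thesis
          using i1[of "x + h"] i1[of x] i3 by (simp add: mollify_def del: inner_scaleR_right)
      qed
      also have "norm \<dots> \<le> (\<integral>y. indicator (cball x (e + 1)) y * (C * \<epsilon> * norm h) \<partial>lborel)"
      proof (rule norm_integral_le)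
        show "integrable lborel (\<lambda>y. \<rho> (x + h - y) *\<^sub>R F y - \<rho> (x - y) *\<^sub>R F y - h \<bullet> (F y *\<^sub>R \<rho>' (x - y)))"
          using i1[of "x + h"] i1[of x] integrable_inner_right[OF i2[of x], of h]
          by (simp del: inner_scaleR_right)
        show "norm (\<rho> (x + h - y) *\<^sub>R F y - \<rho> (x - y) *\<^sub>R F y - h \<bullet> (F y *\<^sub>R \<rho>' (x - y)))
           \<le> indicator (cball x (e + 1)) y * (C * \<epsilon> * norm h)" for y
        proof (cases "y \<in> cball x (e + 1)")
          case True
          have "\<rho> (x + h - y) *\<^sub>R F y - \<rho> (x - y) *\<^sub>R F y - h \<bullet> (F y *\<^sub>R \<rho>' (x - y))
             = F y * (\<rho> ((x - y) + h) - \<rho> (x - y) - h \<bullet> \<rho>' (x - y))"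
            by (simp add: algebra_simps)
          also have "norm \<dots> \<le> C * (\<epsilon> * norm h)"
            unfolding norm_mult using lin[of h "x - y"] h C C0 by (intro mult_mono) auto
          finally show ?thesis using True by simp
        next
          case False
          then show ?thesis using far[of h y] h by simp
        qed
      qed (use iV[of "C * \<epsilon> * norm h"] in \<open>simp_all\<close>)
      also have "\<dots> \<le> \<eta> * norm h"
        unfolding intV using mult_right_mono[OF CV, of "norm h"] by (simp add: mult_ac)
      finally show "norm (mollify \<rho> F (x + h) - mollify \<rho> F x - h \<bullet> m' x) \<le> \<eta> * norm h" by simp
      have "m' (x + h) - m' x = (\<integral>y. F y *\<^sub>R \<rho>' (x + h - y) - F y *\<^sub>R \<rho>' (x - y) \<partial>lborel)"
        unfolding m'_def using i2 by simp
      also have "norm \<dots> \<le> (\<integral>y. indicator (cball x (e + 1)) y * (C * \<epsilon>) \<partial>lborel)"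
      proof (rule norm_integral_le)
        show "norm (F y *\<^sub>R \<rho>' (x + h - y) - F y *\<^sub>R \<rho>' (x - y))
           \<le> indicator (cball x (e + 1)) y * (C * \<epsilon>)" for y
        proof (cases "y \<in> cball x (e + 1)")
          case True
          have "norm (F y *\<^sub>R \<rho>' (x + h - y) - F y *\<^sub>R \<rho>' (x - y)) = \<bar>F y\<bar> * norm (\<rho>' (x + h - y) - \<rho>' (x - y))"
            by (simp add: scaleR_diff_right[symmetric])
          also have "\<dots> \<le> C * \<epsilon>"
            using d(2)[of "x + h - y" "x - y"] h C C0 by (intro mult_mono) auto
          finally show ?thesis using True by simp
        next
          case False
          then show ?thesis using far[of h y] h by simp
        qed
      qed (use i2 iV in auto)
      also have "\<dots> \<le> \<eta>" unfolding intV using CV by (simp add: mult_ac)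
      finally show "norm (m' (x + h) - m' x) \<le> \<eta>" .
    qed
  qed
  have "GDERIV (mollify \<rho> F) x :> m' x" for x
    unfolding gderiv_def has_derivative_at_alt
  proof (intro conjI allI impI bounded_linear_inner_left)
    fix \<eta> :: real assume "0 < \<eta>"
    then obtain d where "d > 0" "\<And>h. norm h < d \<Longrightarrow> norm (mollify \<rho> F (x + h) - mollify \<rho> F x - h \<bullet> m' x) \<le> \<eta> * norm h"
      using key by blast
    then show "\<exists>d>0. \<forall>y. norm (y - x) < d \<longrightarrow> norm (mollify \<rho> F y - mollify \<rho> F x - (y - x) \<bullet> m' x) \<le> \<eta> * norm (y - x)"
      by (metis add_diff_cancel_left' diff_add_cancel add.commute)
  qed
  moreover have "continuous_on UNIV m'"
    unfolding continuous_on_iff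
  proof (intro ballI allI impI)
    fix x :: 'a and \<eta> :: real assume "0 < \<eta>"
    then have "0 < \<eta> / 2" by simp
    from key[OF this, of x] obtain d where d: "d > 0" "\<And>h. norm h < d \<Longrightarrow> norm (m' (x + h) - m' x) \<le> \<eta> / 2"
      by blast
    have "dist (m' x') (m' x) < \<eta>" if "dist x' x < d" for x'
      using d(2)[of "x' - x"] that \<open>0 < \<eta>\<close> by (auto simp: dist_norm)
    with d(1) show "\<exists>d>0. \<forall>x'\<in>UNIV. dist x' x < d \<longrightarrow> dist (m' x') (m' x) < \<eta>" by blast
  qed
  ultimately show ?thesis unfolding C1_fun_def m'_def by blast
qed

lemma mollifier_bounded:
  assumes "mollifier e \<rho> \<rho>'"
  obtains B where "B > 0" "\<And>x. \<rho> x \<le> B"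
proof -
  obtain B where B: "B > 0" "\<And>x. norm (\<rho> x) \<le> B"
    by (rule continuous_compact_support_bounded[OF C1_fun_continuous[OF mollifier_C1[OF assms]], of "cball 0 e"])
      (use mollifier_zero[OF assms] in auto)
  then have "\<And>x. \<rho> x \<le> B" by (metis abs_le_D1 real_norm_def)
  with B(1) that show thesis by blast
qed

section \<open>Mollification as an operator on p-integrable functions\<close>

lemma mollify_integrable:
  fixes F :: "'a::euclidean_space \<Rightarrow> 'b::euclidean_space"
  assumes \<rho>: "mollifier e \<rho> \<rho>'" and F: "mem_Lp lborel p F" and p: "1 \<le> p"
  shows "integrable lborel (\<lambda>y. \<rho> (x - y) * norm (F y) powr p)"
    and "integrable lborel (\<lambda>y. \<rho> (x - y) *\<^sub>R F y)"
    and "integrable lborel (\<lambda>y. \<rho> (x - y))"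
    and "(\<integral>y. \<rho> (x - y) \<partial>lborel) = 1"
proof -
  note [measurable] = mollifier_borel[OF \<rho>]
  have [measurable]: "F \<in> borel_measurable borel" using F by (simp add: mem_Lp_def)
  have iF: "integrable lborel (\<lambda>y. norm (F y) powr p)" using F by (simp add: mem_Lp_def)
  obtain B where B: "B > 0" "\<And>x. \<rho> x \<le> B" using mollifier_bounded[OF \<rho>] by blast
  note \<rho>0 = mollifier_nonneg[OF \<rho>]
  have "integrable lborel (\<lambda>y. B * norm (F y) powr p)" using iF by simp
  then show 1: "integrable lborel (\<lambda>y. \<rho> (x - y) * norm (F y) powr p)"
    by (rule Bochner_Integration.integrable_bound)
      (use \<rho>0 B in \<open>auto simp: abs_mult intro!: mult_right_mono order_trans[OF B(2)]\<close>)
  show 3: "integrable lborel (\<lambda>y. \<rho> (x - y))"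
    using integrable_reflect[OF mollifier_borel[OF \<rho>]] mollifier_integrable[OF \<rho>] by blast
  show "(\<integral>y. \<rho> (x - y) \<partial>lborel) = 1"
    using integral_reflect[OF mollifier_borel[OF \<rho>]] \<rho> by (simp add: mollifier_def)
  have 4: "integrable lborel (\<lambda>y. \<rho> (x - y) * (1 + norm (F y) powr p))"
    using 1 3 by (simp add: algebra_simps)
  show "integrable lborel (\<lambda>y. \<rho> (x - y) *\<^sub>R F y)"
  proof (rule Bochner_Integration.integrable_bound[OF 4])
    have "norm (F y) \<le> 1 + norm (F y) powr p" for y
      using le_powr_threshold[of "norm (F y)" 1 p] p by simp
    then have "norm (\<rho> (x - y) *\<^sub>R F y) \<le> norm (\<rho> (x - y) * (1 + norm (F y) powr p))" for y
      using \<rho>0[of "x - y"] by (simp add: abs_mult mult_left_mono)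
    then show "AE y in lborel. norm (\<rho> (x - y) *\<^sub>R F y) \<le> norm (\<rho> (x - y) * (1 + norm (F y) powr p))"
      by simp
  qed simp
qed

text \<open>The constant \<open>2 powr p\<close>, which Jensen's inequality would avoid, is harmless for convergence.\<close>

lemma mollify_powr_le:
  fixes F :: "'a::euclidean_space \<Rightarrow> 'b::euclidean_space"
  assumes \<rho>: "mollifier e \<rho> \<rho>'" and F: "mem_Lp lborel p F" and p: "1 \<le> p"
  shows "norm (mollify \<rho> F x) powr p \<le> 2 powr p * (\<integral>y. \<rho> (x - y) * norm (F y) powr p \<partial>lborel)"
proof -
  note i = mollify_integrable[OF \<rho> F p, of x]
  note \<rho>0 = mollifier_nonneg[OF \<rho>]
  define I where "I = (\<integral>y. \<rho> (x - y) * norm (F y) powr p \<partial>lborel)"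
  \<comment> \<open>With half the norm as threshold the integrated bound reads
    \<open>2 * s \<le> s + s powr (1 - p) * I\<close>, so that \<open>s\<close> is absorbed on the
    left. The halving is the origin of the factor \<open>2 powr p\<close>.\<close>
  define s where "s = norm (mollify \<rho> F x) / 2"
  have I0: "0 \<le> I" unfolding I_def using \<rho>0 by (intro Bochner_Integration.integral_nonneg) auto
  show ?thesis
  proof (cases "s = 0")
    case True
    then show ?thesis using I0 p by (simp add: s_def I_def)
  next
    case False
    then have s: "s > 0" by (simp add: s_def less_le)
    have "2 * s \<le> (\<integral>y. s * \<rho> (x - y) + s powr (1 - p) * (\<rho> (x - y) * norm (F y) powr p) \<partial>lborel)"
    proof -
      have "norm (mollify \<rho> F x) \<le> (\<integral>y. s * \<rho> (x - y) + s powr (1 - p) * (\<rho> (x - y) * norm (F y) powr p) \<partial>lborel)"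
        unfolding mollify_def
      proof (rule norm_integral_le[OF i(2)])
        show "integrable lborel (\<lambda>y. s * \<rho> (x - y) + s powr (1 - p) * (\<rho> (x - y) * norm (F y) powr p))"
          using i by simp
        fix y
        have "norm (\<rho> (x - y) *\<^sub>R F y) \<le> \<rho> (x - y) * (s + s powr (1 - p) * norm (F y) powr p)"
          using le_powr_threshold[OF _ s p, of "norm (F y)"] \<rho>0[of "x - y"] by (simp add: mult_left_mono)
        then show "norm (\<rho> (x - y) *\<^sub>R F y) \<le> s * \<rho> (x - y) + s powr (1 - p) * (\<rho> (x - y) * norm (F y) powr p)"
          by (simp add: algebra_simps)
      qed
      then show ?thesis by (simp add: s_def)
    qed
    also have "\<dots> = s + s powr (1 - p) * I"
      using i by (simp add: I_def)
    finally have "s \<le> s powr (1 - p) * I" by simp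
    then have "s powr (p - 1) * s \<le> s powr (p - 1) * (s powr (1 - p) * I)"
      by (intro mult_left_mono) auto
    also have "s powr (p - 1) * (s powr (1 - p) * I) = I"
      using s by (simp add: powr_add[symmetric] mult.assoc[symmetric])
    also have "s powr (p - 1) * s = s powr p"
      using s by (simp add: powr_diff)
    finally have "s powr p \<le> I" .
    moreover have "norm (mollify \<rho> F x) powr p = 2 powr p * s powr p"
      using s by (simp add: s_def powr_divide)
    ultimately show ?thesis by (simp add: I_def)
  qed
qed

lemma mollify_borel:
  fixes F :: "'a::euclidean_space \<Rightarrow> 'b::euclidean_space"
  assumes \<rho>: "mollifier e \<rho> \<rho>'" and F[measurable]: "F \<in> borel_measurable borel"
  shows "mollify \<rho> F \<in> borel_measurable borel"
proof -
  note [measurable] = mollifier_borel[OF \<rho>]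
  have "(\<lambda>x. \<integral>y. \<rho> (x - y) *\<^sub>R F y \<partial>lborel) \<in> borel_measurable lborel"
    by measurable
  then show ?thesis by (simp add: mollify_def[abs_def])
qed

text \<open>The pointwise bound is integrated over \<open>x\<close> and Tonelli's theorem lets the
  kernel be integrated first, with total mass 1. The resulting bound is the same for all
  kernels.\<close>

lemma mollify_Lp:
  fixes F :: "'a::euclidean_space \<Rightarrow> 'b::euclidean_space"
  assumes \<rho>: "mollifier e \<rho> \<rho>'" and F: "mem_Lp lborel p F" and p: "1 \<le> p"
  shows "mem_Lp lborel p (mollify \<rho> F)"
    and "Lp_pow lborel p (mollify \<rho> F) \<le> 2 powr p * Lp_pow lborel p F"
proof -
  note [measurable] = mollifier_borel[OF \<rho>]
  have [measurable]: "F \<in> borel_measurable borel" using F by (simp add: mem_Lp_def)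
  note [measurable] = mollify_borel[OF \<rho>, of F]
  note i = mollify_integrable[OF \<rho> F p]
  note \<rho>0 = mollifier_nonneg[OF \<rho>]
  have iF: "integrable lborel (\<lambda>y. norm (F y) powr p)" using F by (simp add: mem_Lp_def)
  have "(\<integral>\<^sup>+x. ennreal (norm (mollify \<rho> F x) powr p) \<partial>lborel)
      \<le> (\<integral>\<^sup>+x. 2 powr p * (\<integral>\<^sup>+y. ennreal (\<rho> (x - y)) * ennreal (norm (F y) powr p) \<partial>lborel) \<partial>lborel)"
  proof (rule nn_integral_mono)
    fix x
    have "ennreal (norm (mollify \<rho> F x) powr p) \<le> ennreal (2 powr p * (\<integral>y. \<rho> (x - y) * norm (F y) powr p \<partial>lborel))"
      by (rule ennreal_leI) (rule mollify_powr_le[OF \<rho> F p])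
    also have "\<dots> = 2 powr p * ennreal (\<integral>y. \<rho> (x - y) * norm (F y) powr p \<partial>lborel)"
      by (rule ennreal_mult') simp
    also have "ennreal (\<integral>y. \<rho> (x - y) * norm (F y) powr p \<partial>lborel)
        = (\<integral>\<^sup>+y. ennreal (\<rho> (x - y) * norm (F y) powr p) \<partial>lborel)"
      by (rule nn_integral_eq_integral[symmetric]) (use i \<rho>0 in auto)
    also have "\<dots> = (\<integral>\<^sup>+y. ennreal (\<rho> (x - y)) * ennreal (norm (F y) powr p) \<partial>lborel)"
      using \<rho>0 by (simp add: ennreal_mult')
    finally show "ennreal (norm (mollify \<rho> F x) powr p)
      \<le> 2 powr p * (\<integral>\<^sup>+y. ennreal (\<rho> (x - y)) * ennreal (norm (F y) powr p) \<partial>lborel)" .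
  qed
  also have "\<dots> = 2 powr p * (\<integral>\<^sup>+x. (\<integral>\<^sup>+y. ennreal (\<rho> (x - y)) * ennreal (norm (F y) powr p) \<partial>lborel) \<partial>lborel)"
    by (rule nn_integral_cmult) measurable
  also have "(\<integral>\<^sup>+x. (\<integral>\<^sup>+y. ennreal (\<rho> (x - y)) * ennreal (norm (F y) powr p) \<partial>lborel) \<partial>lborel)
      = (\<integral>\<^sup>+y. (\<integral>\<^sup>+x. ennreal (\<rho> (x - y)) * ennreal (norm (F y) powr p) \<partial>lborel) \<partial>lborel)"
    by (rule lborel_pair.Fubini'[symmetric]) measurable
  also have "\<dots> = (\<integral>\<^sup>+y. ennreal (norm (F y) powr p) \<partial>lborel)"
  proof (rule nn_integral_cong)
    fix y
    have "(\<integral>\<^sup>+x. ennreal (\<rho> (x - y)) * ennreal (norm (F y) powr p) \<partial>lborel)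
        = (\<integral>\<^sup>+x. ennreal (\<rho> (x + (- y))) \<partial>lborel) * ennreal (norm (F y) powr p)"
      by (subst nn_integral_multc) auto
    also have "(\<integral>\<^sup>+x. ennreal (\<rho> (x + (- y))) \<partial>lborel) = (\<integral>\<^sup>+x. ennreal (\<rho> x) \<partial>lborel)"
      by (rule nn_integral_translation) measurable
    also have "\<dots> = ennreal (\<integral>x. \<rho> x \<partial>lborel)"
      by (rule nn_integral_eq_integral) (use mollifier_integrable[OF \<rho>] \<rho>0 in auto)
    also have "\<dots> = 1" using \<rho> by (simp add: mollifier_def)
    finally show "(\<integral>\<^sup>+x. ennreal (\<rho> (x - y)) * ennreal (norm (F y) powr p) \<partial>lborel) = ennreal (norm (F y) powr p)"
      by simp
  qed
  also have "\<dots> = ennreal (Lp_pow lborel p F)"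
    unfolding Lp_pow_def by (rule nn_integral_eq_integral) (use iF in auto)
  also have "2 powr p * \<dots> = ennreal (2 powr p * Lp_pow lborel p F)"
    by (simp add: ennreal_mult')
  finally have fin: "(\<integral>\<^sup>+x. ennreal (norm (mollify \<rho> F x) powr p) \<partial>lborel) \<le> ennreal (2 powr p * Lp_pow lborel p F)" .
  have im: "integrable lborel (\<lambda>x. norm (mollify \<rho> F x) powr p)"
    by (rule integrableI_bounded) (use fin in \<open>auto simp: less_top[symmetric] top_unique\<close>)
  then show "mem_Lp lborel p (mollify \<rho> F)" by (simp add: mem_Lp_def)
  have "ennreal (Lp_pow lborel p (mollify \<rho> F)) = (\<integral>\<^sup>+x. ennreal (norm (mollify \<rho> F x) powr p) \<partial>lborel)"
    unfolding Lp_pow_def by (rule nn_integral_eq_integral[symmetric]) (use im in auto)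
  also note fin
  finally show "Lp_pow lborel p (mollify \<rho> F) \<le> 2 powr p * Lp_pow lborel p F"
    by (subst (asm) ennreal_le_iff) (simp_all add: Lp_pow_nonneg)
qed

text \<open>Two approximations in turn. Cutting \<open>F\<close> off in range and in space makes it
  bounded with bounded support. The continuous functions that converge to it almost everywhere,
  supplied by measurability, are then modified so as to have a common integrable majorant.\<close>

lemma continuous_dense_Lp:
  fixes F :: "'a::euclidean_space \<Rightarrow> 'b::euclidean_space"
  assumes F: "mem_Lp lborel p F" and p: "1 \<le> p" and "0 < \<eta>"
  obtains \<psi> R where "continuous_on UNIV \<psi>" "\<And>x. R \<le> norm x \<Longrightarrow> \<psi> x = 0" "0 < R"
    "mem_Lp lborel p \<psi>" "Lp_pow lborel p (\<lambda>x. F x - \<psi> x) < \<eta>"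
proof -
  have Fb[measurable]: "F \<in> borel_measurable borel" using F by (simp add: mem_Lp_def)
  define Fn where "Fn n x = (if norm x \<le> real (Suc n) \<and> norm (F x) \<le> real (Suc n) then F x else 0)" for n x
  have [measurable]: "Fn n \<in> borel_measurable borel" for n unfolding Fn_def by measurable
  have memFn: "mem_Lp lborel p (Fn n)" for n
    by (rule mem_Lp_bound[OF F, where B = 1]) (use p in \<open>auto simp: Fn_def\<close>)
  have lim1: "(\<lambda>n. Lp_pow lborel p (\<lambda>x. Fn n x - F x)) \<longlonglongrightarrow> 0"
  proof (rule Lp_dominated_convergence[OF _ _ F, where B = 1])
    show "AE x in lborel. (\<lambda>n. Fn n x) \<longlonglongrightarrow> F x"
    proof (rule AE_I2)
      fix x
      obtain N where N: "norm x + norm (F x) \<le> real N" using real_arch_simple by blast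
      have "\<forall>\<^sub>F n in sequentially. Fn n x = F x"
        using eventually_ge_at_top[of N]
      proof eventually_elim
        case (elim n)
        then have "norm x + norm (F x) \<le> real (Suc n)" using N by linarith
        then have "norm x \<le> real (Suc n)" "norm (F x) \<le> real (Suc n)"
          using norm_ge_zero[of x] norm_ge_zero[of "F x"] by linarith+
        then show ?case by (simp add: Fn_def)
      qed
      then show "(\<lambda>n. Fn n x) \<longlonglongrightarrow> F x" by (rule tendsto_eventually)
    qed
  qed (use p in \<open>auto simp: Fn_def\<close>)
  define \<eta>' where "\<eta>' = \<eta> / (2 * 2 powr p)"
  have "\<eta>' > 0" using \<open>0 < \<eta>\<close> by (simp add: \<eta>'_def)
  obtain n where n: "Lp_pow lborel p (\<lambda>x. Fn n x - F x) < \<eta>'"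
    using eventually_happens'[OF sequentially_bot order_tendstoD(2)[OF lim1 \<open>\<eta>' > 0\<close>]] by blast
  define m where "m = real (Suc n)"
  have m: "m > 0" by (simp add: m_def)
  have "Fn n measurable_on UNIV"
    by (rule lebesgue_measurable_imp_measurable_on) (auto intro: measurable_completion)
  then obtain N g where N: "negligible N" and g: "\<And>k. continuous_on UNIV (g k)"
      and lim: "\<And>x. x \<notin> N \<Longrightarrow> (\<lambda>k. g k x) \<longlonglongrightarrow> Fn n x"
    unfolding measurable_on_def by auto
  \<comment> \<open>The radial retraction onto the ball of radius \<open>m\<close>, and a cut-off
    that is 1 up to norm \<open>m\<close> and 0 from \<open>m + 1\<close> on. Both fix the values of
    \<open>Fn n\<close>, so the limit almost everywhere is unchanged.\<close>
  define clip :: "'b \<Rightarrow> 'b" where "clip z = (m / max m (norm z)) *\<^sub>R z" for z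
  define cut :: "'a \<Rightarrow> real" where "cut x = max 0 (min 1 (m + 1 - norm x))" for x
  have clip_c: "continuous_on UNIV clip"
    unfolding clip_def using m by (intro continuous_intros) (auto simp: max_def)
  have clip_b: "norm (clip z) \<le> m" for z
    using m by (simp add: clip_def max_def divide_simps)
  have clip_id: "clip z = z" if "norm z \<le> m" for z
    using m that by (simp add: clip_def max_def)
  have cut_c: "continuous_on UNIV cut" unfolding cut_def by (intro continuous_intros)
  have cutb: "0 \<le> cut x" "cut x \<le> 1" for x by (auto simp: cut_def)
  define \<psi> where "\<psi> k x = cut x *\<^sub>R clip (g k x)" for k x
  have \<psi>c: "continuous_on UNIV (\<psi> k)" for k
    unfolding \<psi>_def by (intro continuous_intros cut_c continuous_on_compose2[OF clip_c g]) auto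
  have [measurable]: "\<psi> k \<in> borel_measurable borel" for k
    using \<psi>c by (rule borel_measurable_continuous_onI)
  have \<psi>0: "\<psi> k x = 0" if "m + 1 \<le> norm x" for k x
    using that by (simp add: \<psi>_def cut_def)
  have \<psi>b: "norm (\<psi> k x) \<le> m" for k x
    using cutb[of x] clip_b[of "g k x"] m mult_mono[of "cut x" 1 "norm (clip (g k x))" m]
    by (simp add: \<psi>_def)
  have Fnb: "norm (Fn n x) \<le> m" "m + 1 \<le> norm x \<Longrightarrow> Fn n x = 0" for x
    by (auto simp: Fn_def m_def)
  define h where "h x = indicator (cball (0::'a) (m + 1)) x * (1::real)" for x
  have memh: "mem_Lp lborel p h"
  proof -
    have "integrable lborel (\<lambda>x. indicator (cball (0::'a) (m + 1)) x * (1::real))"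
      using borel_integrable_compact[of "cball (0::'a) (m + 1)" "\<lambda>_. 1::real"] by simp
    moreover have "norm (h x) powr p = indicator (cball (0::'a) (m + 1)) x * 1" for x
      using p by (simp add: h_def indicator_def)
    ultimately show ?thesis by (simp add: mem_Lp_def h_def[abs_def])
  qed
  have mem\<psi>: "mem_Lp lborel p (\<psi> k)" for k
    by (rule mem_Lp_bound[OF memh, where B = m])
      (use \<psi>b \<psi>0 m p in \<open>auto simp: h_def indicator_def not_le intro!: AE_I2\<close>)
  have lim2: "(\<lambda>k. Lp_pow lborel p (\<lambda>x. \<psi> k x - Fn n x)) \<longlonglongrightarrow> 0"
  proof (rule Lp_dominated_convergence[OF _ _ memh, where B = "2 * m"])
    have "AE x in lebesgue. x \<notin> N"
      using N AE_not_in negligible_iff_null_sets by blast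
    then have "AE x in lborel. x \<notin> N" by (simp add: AE_completion_iff)
    then show "AE x in lborel. (\<lambda>k. \<psi> k x) \<longlonglongrightarrow> Fn n x"
    proof eventually_elim
      case (elim x)
      have "(\<lambda>k. cut x *\<^sub>R clip (g k x)) \<longlonglongrightarrow> cut x *\<^sub>R clip (Fn n x)"
        using lim[OF elim] clip_c
        by (intro tendsto_intros isCont_tendsto_compose[of "Fn n x" clip]) (auto simp: continuous_on_eq_continuous_at)
      also have "cut x *\<^sub>R clip (Fn n x) = Fn n x"
        using Fnb[of x] clip_id by (auto simp: Fn_def cut_def m_def)
      finally show ?case by (simp add: \<psi>_def)
    qed
    show "AE x in lborel. norm (\<psi> k x - Fn n x) \<le> 2 * m * norm (h x)" for k
    proof (rule AE_I2)
      fix x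
      show "norm (\<psi> k x - Fn n x) \<le> 2 * m * norm (h x)"
      proof (cases "m + 1 \<le> norm x")
        case True
        then show ?thesis using \<psi>0 Fnb m by (simp add: h_def)
      next
        case False
        then have "h x = 1" by (simp add: h_def)
        then show ?thesis
          using norm_triangle_ineq4[of "\<psi> k x" "Fn n x"] \<psi>b[of k x] Fnb(1)[of x] by simp
      qed
    qed
  qed (use p m in auto)
  obtain k where k: "Lp_pow lborel p (\<lambda>x. \<psi> k x - Fn n x) < \<eta>'"
    using eventually_happens'[OF sequentially_bot order_tendstoD(2)[OF lim2 \<open>\<eta>' > 0\<close>]] by blast
  have "Lp_pow lborel p (\<lambda>x. (Fn n x - F x) + (\<psi> k x - Fn n x))
      \<le> 2 powr p * (Lp_pow lborel p (\<lambda>x. Fn n x - F x) + Lp_pow lborel p (\<lambda>x. \<psi> k x - Fn n x))"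
    using p by (intro mem_Lp_add mem_Lp_diff F memFn mem\<psi>) auto
  also have "\<dots> < 2 powr p * (\<eta>' + \<eta>')" using n k by (intro mult_strict_left_mono) auto
  also have "\<dots> = \<eta>" by (simp add: \<eta>'_def field_simps)
  finally have "Lp_pow lborel p (\<lambda>x. \<psi> k x - F x) < \<eta>" by simp
  then have "Lp_pow lborel p (\<lambda>x. F x - \<psi> k x) < \<eta>"
    by (simp add: Lp_pow_minus_commute)
  then show thesis
    using that[of "\<psi> k" "m + 1"] \<psi>c \<psi>0 mem\<psi> m by simp
qed

lemma mollify_uniform:
  fixes \<psi> :: "'a::euclidean_space \<Rightarrow> 'b::euclidean_space"
  assumes \<rho>: "mollifier e \<rho> \<rho>'" and \<psi>: "mem_Lp lborel p \<psi>" and p: "1 \<le> p"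
    and close: "\<And>x y. norm (x - y) \<le> e \<Longrightarrow> norm (\<psi> x - \<psi> y) \<le> \<eta>"
  shows "norm (mollify \<rho> \<psi> x - \<psi> x) \<le> \<eta>"
proof -
  note i = mollify_integrable[OF \<rho> \<psi> p, of x]
  have "mollify \<rho> \<psi> x - \<psi> x = (\<integral>y. \<rho> (x - y) *\<^sub>R \<psi> y - \<rho> (x - y) *\<^sub>R \<psi> x \<partial>lborel)"
    unfolding mollify_def using i by simp
  also have "norm \<dots> \<le> (\<integral>y. \<rho> (x - y) * \<eta> \<partial>lborel)"
  proof (rule norm_integral_le)
    fix y
    show "norm (\<rho> (x - y) *\<^sub>R \<psi> y - \<rho> (x - y) *\<^sub>R \<psi> x) \<le> \<rho> (x - y) * \<eta>"
    proof (cases "norm (x - y) \<le> e")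
      case True
      then have "norm (\<psi> y - \<psi> x) \<le> \<eta>" by (metis close norm_minus_commute)
      then show ?thesis
        using mollifier_nonneg[OF \<rho>, of "x - y"]
        by (simp add: scaleR_diff_right[symmetric] mult_left_mono)
    next
      case False
      then show ?thesis using mollifier_zero[OF \<rho>] by simp
    qed
  qed (use i in auto)
  also have "\<dots> = \<eta>" using i by simp
  finally show ?thesis .
qed

text \<open>\<open>F\<close> is split into a continuous \<open>\<psi>\<close>, whose mollification
  converges uniformly, and a remainder that stays small because mollification is bounded. The
  threshold \<open>e0\<close> serves every kernel of smaller radius: one kernel can then approximate
  a function and its gradient simultaneously.\<close>

lemma mollify_converges:
  fixes F :: "'a::euclidean_space \<Rightarrow> 'b::euclidean_space"
  assumes F: "mem_Lp lborel p F" and p: "1 \<le> p" and "0 < \<eta>"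
  obtains e0 where "0 < e0"
    "\<And>e \<rho> \<rho>'. mollifier e \<rho> \<rho>' \<Longrightarrow> e \<le> e0 \<Longrightarrow> Lp_pow lborel p (\<lambda>x. mollify \<rho> F x - F x) < \<eta>"
proof -
  define T where "T = (2::real) powr p"
  have T: "T > 0" by (simp add: T_def)
  \<comment> \<open>Two triangle inequalities and one mollification bound, each costing a factor
    \<open>T\<close>, lead to at most \<open>T * T * (T + 2) * \<eta>'\<close>, which is below
    \<open>\<eta>\<close>.\<close>
  define \<eta>' where "\<eta>' = \<eta> / (3 * T * T * (T + 1))"
  have \<eta>': "\<eta>' > 0" using \<open>0 < \<eta>\<close> T by (simp add: \<eta>'_def)
  obtain \<psi> R where \<psi>: "continuous_on UNIV \<psi>" "\<And>x. R \<le> norm x \<Longrightarrow> \<psi> x = 0" "0 < R"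
    "mem_Lp lborel p \<psi>" "Lp_pow lborel p (\<lambda>x. F x - \<psi> x) < \<eta>'"
    using continuous_dense_Lp[OF F p \<eta>'] by blast
  define V where "V = measure lborel (cball (0::'a) (R + 1))"
  have V: "0 \<le> V" by (simp add: V_def)
  \<comment> \<open>Uniform closeness that yields an integral of p-th powers below
    \<open>\<eta>'\<close>; \<open>mollify \<rho> \<psi> - \<psi>\<close> lives on a ball of volume
    \<open>V\<close>.\<close>
  define \<epsilon> where "\<epsilon> = (\<eta>' / (V + 1)) powr (1 / p)"
  have \<epsilon>: "0 < \<epsilon>" using \<eta>' V by (simp add: \<epsilon>_def)
  have \<epsilon>p: "\<epsilon> powr p * V < \<eta>'"
  proof -
    have "\<epsilon> powr p = \<eta>' / (V + 1)" using p \<eta>' V by (simp add: \<epsilon>_def powr_powr)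
    then have "\<epsilon> powr p * V = \<eta>' * (V / (V + 1))" by simp
    also have "\<dots> < \<eta>' * 1" using \<eta>' V by (intro mult_strict_left_mono) auto
    finally show ?thesis by simp
  qed
  obtain d where d: "0 < d" "\<And>x y. norm (x - y) \<le> d \<Longrightarrow> norm (\<psi> x - \<psi> y) \<le> \<epsilon>"
    using uniformly_continuous_compact_support[OF \<psi>(1,2) \<epsilon>] by blast
  show thesis
  proof (rule that[of "min d 1"])
    show "0 < min d 1" using d by simp
    fix e \<rho> and \<rho>' :: "'a \<Rightarrow> 'a" assume \<rho>: "mollifier e \<rho> \<rho>'" and e: "e \<le> min d 1"
    have close: "norm (mollify \<rho> \<psi> x - \<psi> x) \<le> \<epsilon>" for x
      by (rule mollify_uniform[OF \<rho> \<psi>(4) p]) (use d e in auto)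
    have van: "mollify \<rho> \<psi> x - \<psi> x = 0" if "x \<notin> cball 0 (R + 1)" for x
    proof -
      have z: "\<rho> (x - y) *\<^sub>R \<psi> y = 0" for y
      proof (cases "R \<le> norm y")
        case False
        have "norm x \<le> norm (x - y) + norm y" by (metis diff_add_cancel norm_triangle_ineq)
        then have "e \<le> norm (x - y)" using that False e by simp
        then show ?thesis using mollifier_zero[OF \<rho>] by simp
      qed (use \<psi> in auto)
      show ?thesis unfolding mollify_def z using that \<psi>(2) by simp
    qed
    have m1: "mem_Lp lborel p (\<lambda>x. F x - \<psi> x)" by (rule mem_Lp_diff[OF F \<psi>(4)]) (use p in auto)
    have m2: "mem_Lp lborel p (\<lambda>x. mollify \<rho> \<psi> x - \<psi> x)"
      by (rule mem_Lp_diff[OF mollify_Lp(1)[OF \<rho> \<psi>(4) p] \<psi>(4)]) (use p in auto)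
    note m3 = mollify_Lp[OF \<rho> m1 p]
    have split: "mollify \<rho> F x = mollify \<rho> (\<lambda>x. F x - \<psi> x) x + mollify \<rho> \<psi> x" for x
      unfolding mollify_def
      using mollify_integrable(2)[OF \<rho> F p, of x] mollify_integrable(2)[OF \<rho> \<psi>(4) p, of x]
      by (simp add: scaleR_diff_right)
    have 2: "Lp_pow lborel p (\<lambda>x. mollify \<rho> \<psi> x - \<psi> x) \<le> \<epsilon> powr p * V"
    proof -
      have "Lp_pow lborel p (\<lambda>x. mollify \<rho> \<psi> x - \<psi> x) \<le> (\<integral>x. indicator (cball (0::'a) (R + 1)) x * \<epsilon> powr p \<partial>lborel)"
        unfolding Lp_pow_def
      proof (rule integral_mono)
        show "integrable lborel (\<lambda>x. indicator (cball (0::'a) (R + 1)) x * \<epsilon> powr p)"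
          using borel_integrable_compact[of "cball (0::'a) (R + 1)" "\<lambda>_. \<epsilon> powr p"] by simp
        show "norm (mollify \<rho> \<psi> x - \<psi> x) powr p \<le> indicator (cball 0 (R + 1)) x * \<epsilon> powr p" for x
          using van[of x] close[of x] p by (cases "x \<in> cball 0 (R + 1)") (auto intro: powr_mono2)
      qed (use m2 in \<open>auto simp: mem_Lp_def\<close>)
      also have "\<dots> = \<epsilon> powr p * V" by (simp add: V_def)
      finally show ?thesis .
    qed
    have "Lp_pow lborel p (\<lambda>x. (mollify \<rho> (\<lambda>x. F x - \<psi> x) x + (mollify \<rho> \<psi> x - \<psi> x)) - (F x - \<psi> x))
       \<le> T * (T * (Lp_pow lborel p (mollify \<rho> (\<lambda>x. F x - \<psi> x)) + Lp_pow lborel p (\<lambda>x. mollify \<rho> \<psi> x - \<psi> x))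
            + Lp_pow lborel p (\<lambda>x. F x - \<psi> x))"
    proof -
      have p0: "0 \<le> p" using p by simp
      note mem_Lp_diff(2)[OF mem_Lp_add(1)[OF m3(1) m2 p0] m1 p0]
      also have "2 powr p * (Lp_pow lborel p (\<lambda>x. mollify \<rho> (\<lambda>x. F x - \<psi> x) x + (mollify \<rho> \<psi> x - \<psi> x))
            + Lp_pow lborel p (\<lambda>x. F x - \<psi> x))
         \<le> T * (T * (Lp_pow lborel p (mollify \<rho> (\<lambda>x. F x - \<psi> x)) + Lp_pow lborel p (\<lambda>x. mollify \<rho> \<psi> x - \<psi> x))
            + Lp_pow lborel p (\<lambda>x. F x - \<psi> x))"
        unfolding T_def by (intro mult_left_mono add_mono order_refl mem_Lp_add(2)[OF m3(1) m2 p0]) simp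
      finally show ?thesis .
    qed
    also have "\<dots> \<le> T * (T * (T * Lp_pow lborel p (\<lambda>x. F x - \<psi> x) + \<epsilon> powr p * V) + Lp_pow lborel p (\<lambda>x. F x - \<psi> x))"
      using m3(2) 2 T by (intro mult_left_mono add_mono) (auto simp: T_def)
    also have "\<dots> \<le> T * (T * (T * \<eta>' + \<eta>') + \<eta>')"
      using \<psi>(5) \<epsilon>p T by (intro mult_left_mono add_mono) auto
    also have "\<dots> \<le> T * (T * (T * \<eta>' + \<eta>') + T * \<eta>')"
      using T \<eta>' p by (intro mult_left_mono add_mono order_refl) (auto simp: T_def ge_one_powr_ge_zero)
    also have "\<dots> < 3 * T * T * (T + 1) * \<eta>'"
    proof -
      have "T * T * \<eta>' > 0" "T * T * T * \<eta>' > 0" using T \<eta>' by simp_all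
      then show ?thesis by (simp add: algebra_simps)
    qed
    also have "\<dots> = \<eta>" using T by (simp add: \<eta>'_def)
    finally show "Lp_pow lborel p (\<lambda>x. mollify \<rho> F x - F x) < \<eta>"
      by (simp add: split)
  qed
qed

text \<open>Translation and Tonelli arguments are carried out on \<open>lborel\<close> for Borel
  functions, whereas the function spaces contain Lebesgue measurable ones. The real-valued case is
  applied to each coordinate.\<close>

lemma borel_representative:
  fixes f :: "'a::euclidean_space \<Rightarrow> 'b::euclidean_space"
  assumes "f \<in> borel_measurable lebesgue"
  obtains f' where "f' \<in> borel_measurable borel" "AE x in lebesgue. f x = f' x"
proof -
  have "\<exists>g. g \<in> borel_measurable borel \<and> (AE x in lborel. f x \<bullet> b = g x)" for b
  proof -
    have "(\<lambda>x. f x \<bullet> b) \<in> borel_measurable lebesgue" using assms by simp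
    from completion_ex_borel_measurable_real[OF this] show ?thesis by auto
  qed
  then obtain g where g: "\<And>b. g b \<in> borel_measurable borel" "\<And>b. AE x in lborel. f x \<bullet> b = g b x"
    by metis
  define f' where "f' x = (\<Sum>b\<in>Basis. g b x *\<^sub>R b)" for x
  have "f' \<in> borel_measurable borel" unfolding f'_def using g(1) by measurable
  moreover have "AE x in lborel. \<forall>b\<in>Basis. f x \<bullet> b = g b x"
    by (rule AE_finite_allI) (use g(2) in auto)
  then have "AE x in lborel. f x = f' x"
  proof eventually_elim
    case (elim x)
    have "f x = (\<Sum>b\<in>Basis. (f x \<bullet> b) *\<^sub>R b)" by (simp add: euclidean_representation)
    also have "\<dots> = f' x" unfolding f'_def using elim by (intro sum.cong) auto
    finally show ?case .
  qed
  then have "AE x in lebesgue. f x = f' x" by (rule AE_completion)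
  ultimately show thesis by (rule that)
qed

lemma C1c_translated_mollifier:
  assumes \<rho>: "mollifier e \<rho> \<rho>'" and "cball x e \<subseteq> \<Omega>"
  shows "C1_fun (\<lambda>y. \<rho> (x - y)) (\<lambda>y. - \<rho>' (x - y))" "(\<lambda>y. \<rho> (x - y)) \<in> C1c \<Omega>"
proof -
  show C1: "C1_fun (\<lambda>y. \<rho> (x - y)) (\<lambda>y. - \<rho>' (x - y))"
    unfolding C1_fun_def
  proof safe
    fix y
    have "((\<lambda>y. \<rho> (x - y)) has_derivative (\<lambda>h. (- h) \<bullet> \<rho>' (x - y))) (at y)"
      using C1_fun_gderiv[OF mollifier_C1[OF \<rho>], of "x - y"] unfolding gderiv_def
      by (intro has_derivative_compose[of "\<lambda>y. x - y" "\<lambda>h. - h" y UNIV \<rho>])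
         (auto intro!: derivative_eq_intros)
    then show "GDERIV (\<lambda>y. \<rho> (x - y)) y :> - \<rho>' (x - y)"
      unfolding gderiv_def by simp
    show "continuous_on UNIV (\<lambda>y. - \<rho>' (x - y))"
      using C1_fun_continuous'[OF mollifier_C1[OF \<rho>]]
      by (intro continuous_on_minus continuous_on_compose2[of UNIV \<rho>' UNIV "\<lambda>y. x - y"]) (auto intro: continuous_intros)
  qed
  have z: "\<forall>y. y \<notin> cball x e \<longrightarrow> \<rho> (x - y) = 0"
    using mollifier_zero[OF \<rho>] by (simp add: dist_norm)
  show "(\<lambda>y. \<rho> (x - y)) \<in> C1c \<Omega>"
    unfolding C1c_iff
    by (intro exI[of _ "\<lambda>y. - \<rho>' (x - y)"] exI[of _ "cball x e"] conjI C1 z assms(2) compact_cball)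
qed

text \<open>The kernel \<open>y \<mapsto> \<rho> (x - y)\<close> is itself an admissible test
  function. The sign from differentiating in \<open>y\<close> cancels the sign in the weak equation,
  which turns the gradient found in \<open>mollify_C1\<close> into the mollification of
  \<open>g\<close>.\<close>

lemma mollify_gradient:
  fixes u :: "'a::euclidean_space \<Rightarrow> real"
  assumes \<rho>: "mollifier e \<rho> \<rho>'" and e: "0 < e"
    and u: "u \<in> borel_measurable borel" "\<And>x. \<bar>u x\<bar> \<le> C"
    and g: "g \<in> borel_measurable borel"
    and weak: "\<And>v v'. C1_fun v v' \<Longrightarrow> v \<in> C1c UNIV \<Longrightarrow>
      (\<integral>x. u x *\<^sub>R v' x \<partial>lborel) = - (\<integral>x. v x *\<^sub>R g x \<partial>lborel)"
  shows "C1_fun (mollify \<rho> u) (mollify \<rho> g)"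
proof -
  have "(\<integral>y. u y *\<^sub>R \<rho>' (x - y) \<partial>lborel) = mollify \<rho> g x" for x
  proof -
    note C1 = C1c_translated_mollifier[OF \<rho>, of x UNIV]
    from weak[OF C1] show ?thesis by (simp add: mollify_def)
  qed
  then show ?thesis using mollify_C1[OF \<rho> u e] by (simp add: mollify_def[abs_def])
qed

section \<open>Uniqueness of weak gradients\<close>

lemma integral_lebesgue_on_support:
  fixes h :: "'a::euclidean_space \<Rightarrow> 'b::euclidean_space"
  assumes "\<Omega> \<in> sets lebesgue" "\<And>x. x \<notin> \<Omega> \<Longrightarrow> h x = 0"
  shows "integrable (lebesgue_on \<Omega>) h \<longleftrightarrow> integrable lebesgue h"
    and "(\<integral>x. h x \<partial>lebesgue_on \<Omega>) = (\<integral>x. h x \<partial>lebesgue)"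
proof -
  have *: "(\<lambda>x. indicator \<Omega> x *\<^sub>R h x) = h" using assms(2) by (auto simp: indicator_def)
  show "integrable (lebesgue_on \<Omega>) h \<longleftrightarrow> integrable lebesgue h"
    using assms(1) by (subst integrable_restrict_space) (simp_all add: *)
  show "(\<integral>x. h x \<partial>lebesgue_on \<Omega>) = (\<integral>x. h x \<partial>lebesgue)"
    using assms(1) by (subst Bochner_Integration.integral_restrict_space) (simp_all add: *)
qed

lemma locally_integrable_test:
  fixes f :: "'a::euclidean_space \<Rightarrow> 'b::euclidean_space" and \<psi> :: "'a \<Rightarrow> real"
  assumes f: "f locally_integrable_on \<Omega>" and \<Omega>: "\<Omega> \<in> sets lebesgue"
    and \<psi>: "continuous_on UNIV \<psi>" "compact K" "K \<subseteq> \<Omega>" "\<And>x. x \<notin> K \<Longrightarrow> \<psi> x = 0"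
  shows "integrable (lebesgue_on \<Omega>) (\<lambda>x. \<psi> x *\<^sub>R f x)"
proof -
  obtain B where B: "B > 0" "\<And>x. norm (\<psi> x) \<le> B"
    using continuous_compact_support_bounded[OF \<psi>(1,2,4)] by blast
  have [measurable]: "\<psi> \<in> borel_measurable lebesgue"
    using \<psi>(1) by (intro measurable_completion) (auto intro: borel_measurable_continuous_onI)
  have i: "integrable lebesgue (\<lambda>x. indicator K x *\<^sub>R f x)"
    using f \<psi>(2,3) by (simp add: locally_integrable_on_def set_integrable_def)
  have "integrable lebesgue (\<lambda>x. \<psi> x *\<^sub>R (indicator K x *\<^sub>R f x))"
  proof (rule Bochner_Integration.integrable_bound)
    show "integrable lebesgue (\<lambda>x. B *\<^sub>R (indicator K x *\<^sub>R f x))" by (intro integrable_scaleR_right i)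
    show "(\<lambda>x. \<psi> x *\<^sub>R (indicator K x *\<^sub>R f x)) \<in> borel_measurable lebesgue"
      using borel_measurable_integrable[OF i] by measurable
    show "AE x in lebesgue. norm (\<psi> x *\<^sub>R (indicator K x *\<^sub>R f x)) \<le> norm (B *\<^sub>R (indicator K x *\<^sub>R f x))"
    proof (rule AE_I2)
      fix x
      have "\<bar>\<psi> x\<bar> \<le> \<bar>B\<bar>" using B(2)[of x] by auto
      then show "norm (\<psi> x *\<^sub>R (indicator K x *\<^sub>R f x)) \<le> norm (B *\<^sub>R (indicator K x *\<^sub>R f x))"
        unfolding norm_scaleR[of "\<psi> x"] norm_scaleR[of B] by (rule mult_right_mono) simp
    qed
  qed
  moreover have "(\<lambda>x. \<psi> x *\<^sub>R (indicator K x *\<^sub>R f x)) = (\<lambda>x. \<psi> x *\<^sub>R f x)"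
    using \<psi>(4) by (force simp: indicator_def)
  ultimately have "integrable lebesgue (\<lambda>x. \<psi> x *\<^sub>R f x)" by simp
  then show ?thesis
    using \<psi>(3,4) by (subst integral_lebesgue_on_support[OF \<Omega>]) auto
qed

lemma locally_integrable_test':
  fixes f :: "'a::euclidean_space \<Rightarrow> real" and \<psi> :: "'a \<Rightarrow> 'b::euclidean_space"
  assumes f: "f locally_integrable_on \<Omega>" and \<Omega>: "\<Omega> \<in> sets lebesgue"
    and \<psi>: "continuous_on UNIV \<psi>" "compact K" "K \<subseteq> \<Omega>" "\<And>x. x \<notin> K \<Longrightarrow> \<psi> x = 0"
  shows "integrable (lebesgue_on \<Omega>) (\<lambda>x. f x *\<^sub>R \<psi> x)"
proof -
  have "integrable (lebesgue_on \<Omega>) (\<lambda>x. (\<psi> x \<bullet> b) *\<^sub>R f x)" for b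
    by (rule locally_integrable_test[OF f \<Omega> _ \<psi>(2,3)]) (use \<psi> in \<open>auto intro: continuous_intros\<close>)
  then have "integrable (lebesgue_on \<Omega>) (\<lambda>x. \<Sum>b\<in>Basis. ((\<psi> x \<bullet> b) *\<^sub>R f x) *\<^sub>R b)"
    by (intro Bochner_Integration.integrable_sum integrable_scaleR_left)
  moreover have "(\<Sum>b\<in>Basis. ((\<psi> x \<bullet> b) *\<^sub>R f x) *\<^sub>R b) = f x *\<^sub>R \<psi> x" for x
  proof -
    have "f x *\<^sub>R \<psi> x = f x *\<^sub>R (\<Sum>b\<in>Basis. (\<psi> x \<bullet> b) *\<^sub>R b)" by (simp add: euclidean_representation)
    then show ?thesis by (simp add: scaleR_sum_right mult.commute)
  qed
  ultimately show ?thesis by simp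
qed

lemma locally_integrable_diff:
  fixes f g :: "'a::euclidean_space \<Rightarrow> 'b::euclidean_space"
  assumes "f locally_integrable_on \<Omega>" "g locally_integrable_on \<Omega>"
  shows "(\<lambda>x. f x - g x) locally_integrable_on \<Omega>"
  using assms unfolding locally_integrable_on_def by (auto intro: set_integral_diff)

lemma open_sets_lebesgue: "open \<Omega> \<Longrightarrow> \<Omega> \<in> sets lebesgue"
  by (simp add: borel_open)

text \<open>For \<open>x\<close> in the ball of radius \<open>r\<close> and kernels of radius at
  most \<open>r\<close>, mollifying \<open>f\<close> cut off to the ball of radius
  \<open>2 * r\<close> only tests \<open>f\<close> against a function in
  \<open>C1c \<Omega>\<close>. All these mollifications vanish on the smaller ball, yet they
  converge to \<open>f\<close> in L1.\<close>

lemma weak_zero_on_ball: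
  fixes f :: "'a::euclidean_space \<Rightarrow> 'b::euclidean_space"
  assumes \<Omega>: "open \<Omega>" and f: "f locally_integrable_on \<Omega>"
    and zero: "\<And>v. v \<in> C1c \<Omega> \<Longrightarrow> (\<integral>x. v x *\<^sub>R f x \<partial>lebesgue_on \<Omega>) = 0"
    and r: "0 < r" "cball c (2 * r) \<subseteq> \<Omega>"
  shows "AE x in lebesgue. x \<in> ball c r \<longrightarrow> f x = 0"
proof -
  define F where "F x = indicator (cball c (2 * r)) x *\<^sub>R f x" for x
  have iF: "integrable lebesgue F"
    using f r by (simp add: locally_integrable_on_def set_integrable_def F_def[abs_def])
  obtain F' where F'[measurable]: "F' \<in> borel_measurable borel" and eq: "AE x in lebesgue. F x = F' x"
    using borel_representative borel_measurable_integrable[OF iF] by blast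
  have F'l[measurable]: "F' \<in> borel_measurable lebesgue" by (rule measurable_completion) simp
  have "integrable lebesgue F'"
    by (rule integrable_cong_AE_imp[OF iF F'l]) (use eq in auto)
  then have iF': "integrable lborel F'" by (simp add: integrable_completion)
  then have mem: "mem_Lp lborel 1 F'" by (simp add: mem_Lp_def)
  have van: "mollify \<rho> F' x = 0" if \<rho>: "mollifier e \<rho> \<rho>'" and e: "0 < e" "e \<le> r" and x: "x \<in> ball c r" for e \<rho> \<rho>' x
  proof -
    note [measurable] = mollifier_borel[OF \<rho>]
    have sub: "cball x e \<subseteq> cball c (2 * r)"
    proof
      fix y assume "y \<in> cball x e"
      then show "y \<in> cball c (2 * r)" using x e dist_triangle[of c y x] by simp
    qed
    have "mollify \<rho> F' x = (\<integral>y. \<rho> (x - y) *\<^sub>R F' y \<partial>lebesgue)"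
      unfolding mollify_def by (rule integral_completion[symmetric]) measurable
    also have "\<dots> = (\<integral>y. \<rho> (x - y) *\<^sub>R F y \<partial>lebesgue)"
    proof (rule integral_cong_AE)
      have m: "(\<lambda>y. \<rho> (x - y)) \<in> borel_measurable lebesgue"
        by (rule measurable_completion) measurable
      show "(\<lambda>y. \<rho> (x - y) *\<^sub>R F y) \<in> borel_measurable lebesgue"
        by (intro borel_measurable_scaleR m borel_measurable_integrable[OF iF])
      show "(\<lambda>y. \<rho> (x - y) *\<^sub>R F' y) \<in> borel_measurable lebesgue"
        by (intro borel_measurable_scaleR m F'l)
    qed (use eq in auto)
    also have "\<dots> = (\<integral>y. \<rho> (x - y) *\<^sub>R f y \<partial>lebesgue)"
    proof (rule Bochner_Integration.integral_cong)
      fix y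
      show "\<rho> (x - y) *\<^sub>R F y = \<rho> (x - y) *\<^sub>R f y"
      proof (cases "y \<in> cball x e")
        case True
        then have "y \<in> cball c (2 * r)" using sub by blast
        then show ?thesis by (simp add: F_def)
      next
        case False
        then have "\<rho> (x - y) = 0" by (intro mollifier_zero[OF \<rho>]) (simp add: dist_norm)
        then show ?thesis by simp
      qed
    qed simp
    also have "\<dots> = (\<integral>y. \<rho> (x - y) *\<^sub>R f y \<partial>lebesgue_on \<Omega>)"
    proof (rule integral_lebesgue_on_support(2)[symmetric])
      show "\<rho> (x - y) *\<^sub>R f y = 0" if "y \<notin> \<Omega>" for y
      proof -
        have "y \<notin> cball x e" using that sub r(2) by blast
        then have "\<rho> (x - y) = 0" by (intro mollifier_zero[OF \<rho>]) (simp add: dist_norm)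
        then show ?thesis by simp
      qed
    qed (rule open_sets_lebesgue[OF \<Omega>])
    also have "\<dots> = 0"
      by (rule zero, rule C1c_translated_mollifier[OF \<rho>]) (use sub r(2) in auto)
    finally show ?thesis .
  qed
  have "(\<integral>x. indicator (ball c r) x * norm (F' x) \<partial>lborel) \<le> \<eta>" if \<eta>: "\<eta> > 0" for \<eta>
  proof -
    obtain e0 where e0: "0 < e0" "\<And>e \<rho> \<rho>'. mollifier e \<rho> \<rho>' \<Longrightarrow> e \<le> e0 \<Longrightarrow> Lp_pow lborel 1 (\<lambda>x. mollify \<rho> F' x - F' x) < \<eta>"
      using mollify_converges[OF mem order_refl \<eta>] by blast
    define e where "e = min e0 r"
    have e: "0 < e" "e \<le> e0" "e \<le> r" using e0 r by (auto simp: e_def)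
    obtain \<rho> \<rho>' where \<rho>: "mollifier e (\<rho>::'a \<Rightarrow> real) \<rho>'" using mollifier_exists[OF e(1)] by blast
    have m: "mem_Lp lborel 1 (\<lambda>x. mollify \<rho> F' x - F' x)"
      by (rule mem_Lp_diff[OF mollify_Lp(1)[OF \<rho> mem] mem]) auto
    have "(\<integral>x. indicator (ball c r) x * norm (F' x) \<partial>lborel) \<le> Lp_pow lborel 1 (\<lambda>x. mollify \<rho> F' x - F' x)"
      unfolding Lp_pow_def
    proof (rule integral_mono_AE')
      show "AE x in lborel. indicator (ball c r) x * norm (F' x) \<le> norm (mollify \<rho> F' x - F' x) powr 1"
        using van[OF \<rho> e(1,3)] by (auto intro!: AE_I2 simp: indicator_def)
    qed (use m in \<open>auto simp: mem_Lp_def\<close>)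
    also have "\<dots> < \<eta>" by (rule e0(2)[OF \<rho> e(2)])
    finally show ?thesis by simp
  qed
  then have "(\<integral>x. indicator (ball c r) x * norm (F' x) \<partial>lborel) \<le> 0"
    by (metis field_le_epsilon add_0)
  moreover have i: "integrable lborel (\<lambda>x. indicator (ball c r) x * norm (F' x))"
    using integrable_real_mult_indicator[of "ball c r" lborel "\<lambda>x. norm (F' x)"] iF' by (simp add: mult.commute)
  ultimately have "AE x in lborel. indicator (ball c r) x * norm (F' x) = 0"
    using integral_nonneg_eq_0_iff_AE[OF i] Bochner_Integration.integral_nonneg[of lborel "\<lambda>x. indicator (ball c r) x * norm (F' x)"]
    by (auto intro!: antisym)
  then have "AE x in lebesgue. indicator (ball c r) x * norm (F' x) = 0" by (rule AE_completion)
  with eq show ?thesis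
  proof eventually_elim
    case (elim x)
    then show ?case using r(1) by (auto simp: F_def indicator_def split: if_splits)
  qed
qed

text \<open>The fundamental lemma of the calculus of variations. By Lindelof's theorem countably
  many of the local balls cover \<Omega>, so the exceptional null sets can be united.\<close>

lemma weak_zero_AE:
  fixes f :: "'a::euclidean_space \<Rightarrow> 'b::euclidean_space"
  assumes \<Omega>: "open \<Omega>" and f: "f locally_integrable_on \<Omega>"
    and zero: "\<And>v. v \<in> C1c \<Omega> \<Longrightarrow> (\<integral>x. v x *\<^sub>R f x \<partial>lebesgue_on \<Omega>) = 0"
  shows "AE x in lebesgue_on \<Omega>. f x = 0"
proof -
  have "\<exists>r>0. cball x (2 * r) \<subseteq> \<Omega>" if x: "x \<in> \<Omega>" for x
  proof -
    obtain s where "s > 0" "cball x s \<subseteq> \<Omega>" using \<Omega> x open_contains_cball by blast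
    then show ?thesis by (intro exI[of _ "s / 2"]) auto
  qed
  then obtain r where r: "\<And>x. x \<in> \<Omega> \<Longrightarrow> 0 < r x" "\<And>x. x \<in> \<Omega> \<Longrightarrow> cball x (2 * r x) \<subseteq> \<Omega>"
    by metis
  define \<F> where "\<F> = (\<lambda>x. ball x (r x)) ` \<Omega>"
  have "\<And>S. S \<in> \<F> \<Longrightarrow> open S" by (auto simp: \<F>_def)
  from Lindelof[OF this] obtain \<G> where G: "\<G> \<subseteq> \<F>" "countable \<G>" "\<Union> \<G> = \<Union> \<F>" by blast
  have cov: "\<Omega> \<subseteq> \<Union> \<G>" unfolding G(3) \<F>_def using r(1) by force
  have "AE x in lebesgue. x \<in> S \<longrightarrow> f x = 0" if "S \<in> \<G>" for S
  proof -
    obtain c where "c \<in> \<Omega>" "S = ball c (r c)" using \<open>S \<in> \<G>\<close> G(1) by (auto simp: \<F>_def)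
    then show ?thesis using weak_zero_on_ball[OF \<Omega> f zero r(1) r(2)] by simp
  qed
  then have "AE x in lebesgue. \<forall>S\<in>\<G>. x \<in> S \<longrightarrow> f x = 0"
    unfolding AE_ball_countable[OF G(2)] by blast
  then have "AE x in lebesgue. x \<in> \<Omega> \<longrightarrow> f x = 0"
    by eventually_elim (use cov in blast)
  then show ?thesis using open_sets_lebesgue[OF \<Omega>] by (simp add: AE_restrict_space_iff)
qed

lemma C1c_test_integrable:
  assumes "v \<in> C1c \<Omega>" "open \<Omega>" "g locally_integrable_on \<Omega>"
  shows "integrable (lebesgue_on \<Omega>) (\<lambda>x. v x *\<^sub>R g x)"
proof -
  obtain v' K where "C1_fun v v'" "compact K" "K \<subseteq> \<Omega>" "\<forall>x. x \<notin> K \<longrightarrow> v x = 0"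
    using assms(1) unfolding C1c_iff by blast
  then show ?thesis
    using assms by (intro locally_integrable_test[of _ _ _ K] open_sets_lebesgue C1_fun_continuous[of v v']) auto
qed

lemma C1c_test_integrable':
  fixes f :: "'a::euclidean_space \<Rightarrow> real"
  assumes v: "v \<in> C1c \<Omega>" "\<And>x. GDERIV v x :> v' x" and \<Omega>: "open \<Omega>" and f: "f locally_integrable_on \<Omega>"
  shows "integrable (lebesgue_on \<Omega>) (\<lambda>x. f x *\<^sub>R v' x)"
proof -
  obtain w K where *: "C1_fun v w" "compact K" "K \<subseteq> \<Omega>" "\<forall>x. x \<notin> K \<longrightarrow> v x = 0"
    using v(1) unfolding C1c_iff by blast
  have "w x = v' x" for x using C1_fun_gderiv[OF *(1)] v(2) by (rule GDERIV_unique)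
  then have "w = v'" by auto
  with * have "C1_fun v v'" by simp
  then show ?thesis
    using * \<Omega> by (intro locally_integrable_test'[OF f _ _ *(2,3)] open_sets_lebesgue C1_fun_continuous'[of v v']
        C1_fun_support_deriv[of v v' K]) (auto simp: compact_imp_closed)
qed

lemma weak_gradient_unique:
  assumes \<Omega>: "open \<Omega>" and g: "has_weak_gradient \<Omega> u g" and h: "has_weak_gradient \<Omega> u h"
  shows "AE x in lebesgue_on \<Omega>. g x = h x"
proof -
  have lg: "g locally_integrable_on \<Omega>" "h locally_integrable_on \<Omega>"
    using g h by (auto simp: has_weak_gradient_def)
  have "AE x in lebesgue_on \<Omega>. g x - h x = 0"
  proof (rule weak_zero_AE[OF \<Omega> locally_integrable_diff[OF lg]])
    fix v assume v: "v \<in> C1c \<Omega>"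
    then obtain v' where v': "\<forall>x. GDERIV v x :> v' x" by (auto simp: C1c_def)
    have "(\<integral>x. v x *\<^sub>R g x \<partial>lebesgue_on \<Omega>) = (\<integral>x. v x *\<^sub>R h x \<partial>lebesgue_on \<Omega>)"
    proof -
      have "(\<integral>x. u x *\<^sub>R v' x \<partial>lebesgue_on \<Omega>) = - (\<integral>x. v x *\<^sub>R g x \<partial>lebesgue_on \<Omega>)"
        "(\<integral>x. u x *\<^sub>R v' x \<partial>lebesgue_on \<Omega>) = - (\<integral>x. v x *\<^sub>R h x \<partial>lebesgue_on \<Omega>)"
        using g h v v' unfolding has_weak_gradient_def by blast+
      then show ?thesis by simp
    qed
    then show "(\<integral>x. v x *\<^sub>R (g x - h x) \<partial>lebesgue_on \<Omega>) = 0"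
      using C1c_test_integrable[OF v \<Omega> lg(1)] C1c_test_integrable[OF v \<Omega> lg(2)]
      by (simp add: scaleR_diff_right)
  qed
  then show ?thesis by eventually_elim simp
qed

lemma has_weak_gradient_diff:
  assumes \<Omega>: "open \<Omega>" and g: "has_weak_gradient \<Omega> u g" and h: "has_weak_gradient \<Omega> w h"
  shows "has_weak_gradient \<Omega> (\<lambda>x. u x - w x) (\<lambda>x. g x - h x)"
  unfolding has_weak_gradient_def
proof (intro conjI ballI allI impI)
  show "(\<lambda>x. u x - w x) locally_integrable_on \<Omega>" "(\<lambda>x. g x - h x) locally_integrable_on \<Omega>"
    using g h by (auto simp: has_weak_gradient_def intro: locally_integrable_diff)
  fix v v' assume v: "v \<in> C1c \<Omega>" "\<forall>x. GDERIV v x :> v' x"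
  note i = C1c_test_integrable'[OF v(1) v(2)[rule_format] \<Omega>] C1c_test_integrable[OF v(1) \<Omega>]
  show "(\<integral>x. (u x - w x) *\<^sub>R v' x \<partial>lebesgue_on \<Omega>) = - (\<integral>x. v x *\<^sub>R (g x - h x) \<partial>lebesgue_on \<Omega>)"
  proof -
    have l: "u locally_integrable_on \<Omega>" "g locally_integrable_on \<Omega>" "w locally_integrable_on \<Omega>" "h locally_integrable_on \<Omega>"
      using g h by (auto simp: has_weak_gradient_def)
    have "(\<integral>x. u x *\<^sub>R v' x \<partial>lebesgue_on \<Omega>) = - (\<integral>x. v x *\<^sub>R g x \<partial>lebesgue_on \<Omega>)"
      "(\<integral>x. w x *\<^sub>R v' x \<partial>lebesgue_on \<Omega>) = - (\<integral>x. v x *\<^sub>R h x \<partial>lebesgue_on \<Omega>)"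
      using g h v unfolding has_weak_gradient_def by blast+
    then show ?thesis
      unfolding scaleR_diff_left scaleR_diff_right
      using i(1)[OF l(1)] i(1)[OF l(3)] i(2)[OF l(2)] i(2)[OF l(4)]
      by (simp del: real_scaleR_def)
  qed
qed

text \<open>Completeness of Lebesgue measure. It transfers measurability from an explicit gradient
  to the chosen \<open>weak_gradient\<close> and to the Lagrangian along it.\<close>

lemma borel_measurable_AE_on:
  fixes f g :: "'a::euclidean_space \<Rightarrow> 'b::euclidean_space"
  assumes \<Omega>: "\<Omega> \<in> sets lebesgue" and f: "f \<in> borel_measurable (lebesgue_on \<Omega>)" and eq: "AE x in lebesgue_on \<Omega>. f x = g x"
  shows "g \<in> borel_measurable (lebesgue_on \<Omega>)"
proof -
  have "(\<lambda>x. if x \<in> \<Omega> then f x else 0) \<in> borel_measurable lebesgue"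
    using f \<Omega> by (rule borel_measurable_if_I)
  moreover have "AE x in lebesgue. (if x \<in> \<Omega> then f x else 0) = (if x \<in> \<Omega> then g x else 0)"
    using eq \<Omega> by (simp add: AE_restrict_space_iff)
  ultimately have "(\<lambda>x. if x \<in> \<Omega> then g x else 0) \<in> borel_measurable lebesgue"
    by (rule borel_measurable_AE)
  then show ?thesis by (rule borel_measurable_if_D)
qed

lemma mem_Lp_subset:
  assumes f: "mem_Lp (lebesgue_on T) p f" and S: "S \<in> sets lebesgue" "T \<in> sets lebesgue" "S \<subseteq> T"
  shows "mem_Lp (lebesgue_on S) p f"
    and "Lp_pow (lebesgue_on S) p f \<le> Lp_pow (lebesgue_on T) p f"
proof -
  have "f \<in> borel_measurable (lebesgue_on S)"
    using f S by (auto simp: mem_Lp_def intro: measurable_restrict_mono)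
  moreover have i: "integrable (lebesgue_on S) (\<lambda>x. norm (f x) powr p)"
  proof -
    have "integrable lebesgue (\<lambda>x. indicator T x *\<^sub>R (norm (f x) powr p))"
      using f S by (subst (asm) mem_Lp_def) (simp add: integrable_restrict_space)
    from integrable_mult_indicator[OF S(1) this]
    have "integrable lebesgue (\<lambda>x. indicator S x *\<^sub>R (norm (f x) powr p))"
      by (rule Bochner_Integration.integrable_cong[THEN iffD1, rotated 2]) (use S in \<open>auto simp: indicator_def\<close>)
    then show ?thesis using S by (simp add: integrable_restrict_space)
  qed
  ultimately show "mem_Lp (lebesgue_on S) p f" by (simp add: mem_Lp_def)
  show "Lp_pow (lebesgue_on S) p f \<le> Lp_pow (lebesgue_on T) p f"
    unfolding Lp_pow_def
    by (rule integral_mono_lebesgue_on_AE) (use f S in \<open>auto simp: mem_Lp_def\<close>)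
qed

lemma Lp_locally_integrable:
  fixes f :: "'a::euclidean_space \<Rightarrow> 'b::euclidean_space"
  assumes "f \<in> Lp \<Omega> p" "1 \<le> p" "\<Omega> \<in> sets lebesgue"
  shows "f locally_integrable_on \<Omega>"
  unfolding locally_integrable_on_def
proof (intro allI impI)
  fix K assume K: "compact K \<and> K \<subseteq> \<Omega>"
  then have Kl: "K \<in> sets lebesgue" "K \<in> lmeasurable"
    by (auto simp: compact_imp_closed lmeasurable_compact)
  interpret finite_measure "lebesgue_on K" by (rule finite_measure_lebesgue_on[OF Kl(2)])
  have "integrable (lebesgue_on K) f"
    using mem_Lp_imp_integrable(1)[OF mem_Lp_subset(1)[OF _ Kl(1) assms(3)] assms(2)] assms(1) K
    by (auto simp: Lp_iff)
  then show "set_integrable lebesgue K f"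
    using Kl by (simp add: set_integrable_def integrable_restrict_space)
qed

section \<open>Approximation in Sobolev spaces and truncation\<close>

text \<open>Functions \<open>u\<close> with gradient \<open>g\<close> that are limits in \<open>W\<^sup>1\<^sup>,\<^sup>p(\<Omega>)\<close> of \<open>C\<^sup>1\<close> functions bounded by \<open>C\<close>
  near the boundary of \<open>\<Omega>\<close>. For \<open>C = 0\<close> this is \<open>W\<^sub>0\<^sup>1\<^sup>,\<^sup>p(\<Omega>)\<close>, and \<open>\<phi> + W\<^sub>0\<^sup>1\<^sup>,\<^sup>p(\<Omega>)\<close> consists of such
  functions if \<open>\<bar>\<phi>\<bar> \<le> C\<close>; a function that vanishes on \<open>[- C, C]\<close> maps them into \<open>W\<^sub>0\<^sup>1\<^sup>,\<^sup>p(\<Omega>)\<close>.\<close>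

definition C1_approx ::
  "'a::euclidean_space set \<Rightarrow> real \<Rightarrow> real \<Rightarrow> ('a \<Rightarrow> real) \<Rightarrow> ('a \<Rightarrow> 'a) \<Rightarrow> bool" where
  "C1_approx \<Omega> p C u g \<longleftrightarrow> mem_Lp (lebesgue_on \<Omega>) p u \<and> mem_Lp (lebesgue_on \<Omega>) p g \<and>
     (\<forall>\<eta>>0. \<exists>v v' K. C1_fun v v' \<and> compact K \<and> K \<subseteq> \<Omega> \<and> (\<forall>x. x \<notin> K \<longrightarrow> \<bar>v x\<bar> \<le> C) \<and>
        Lp_pow (lebesgue_on \<Omega>) p (\<lambda>x. v x - u x) < \<eta> \<and>
        Lp_pow (lebesgue_on \<Omega>) p (\<lambda>x. v' x - g x) < \<eta>)"

section \<open>Closure properties of \<open>C1_approx\<close>\<close>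

lemma mem_Lp_const:
  fixes c :: "'b::euclidean_space"
  assumes "\<Omega> \<in> lmeasurable"
  shows "mem_Lp (lebesgue_on \<Omega>) p (\<lambda>x. c)"
proof -
  interpret finite_measure "lebesgue_on \<Omega>" by (rule finite_measure_lebesgue_on[OF assms])
  show ?thesis by (simp add: mem_Lp_def)
qed

lemma open_bounded_lmeasurable: "open \<Omega> \<Longrightarrow> bounded \<Omega> \<Longrightarrow> \<Omega> \<in> lmeasurable"
  by (rule lmeasurable_open)

lemma continuous_mem_Lp:
  fixes f :: "'a::euclidean_space \<Rightarrow> 'b::euclidean_space"
  assumes "open \<Omega>" "bounded \<Omega>" "0 \<le> p" and f: "continuous_on UNIV f"
  shows "mem_Lp (lebesgue_on \<Omega>) p f"
proof -
  have "bounded (f ` closure \<Omega>)"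
    using assms(2) f by (intro compact_imp_bounded compact_continuous_image) (auto intro: continuous_on_subset)
  then obtain B where B: "B > 0" "\<And>x. x \<in> closure \<Omega> \<Longrightarrow> norm (f x) \<le> B" by (auto simp: bounded_pos)
  have "f \<in> borel_measurable (lebesgue_on \<Omega>)"
    using f by (intro measurable_restrict_space1 measurable_completion) (auto intro: borel_measurable_continuous_onI)
  moreover have "AE x in lebesgue_on \<Omega>. norm (f x) \<le> B * norm (1::real)"
    using B closure_subset[of \<Omega>] by (auto intro!: AE_I2)
  ultimately show ?thesis
    using mem_Lp_const[OF open_bounded_lmeasurable[OF assms(1,2)], of p "1::real"] B(1) assms(3)
    by (intro mem_Lp_bound[of "lebesgue_on \<Omega>" p "\<lambda>x. 1::real" f B]) auto
qed

lemma C1_fun_mem_Lp: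
  assumes "open \<Omega>" "bounded \<Omega>" "0 \<le> p" "C1_fun v v'"
  shows "mem_Lp (lebesgue_on \<Omega>) p v" "mem_Lp (lebesgue_on \<Omega>) p v'"
  by (auto intro!: continuous_mem_Lp assms C1_fun_continuous[OF assms(4)] C1_fun_continuous'[OF assms(4)])

lemma C1_approx_mem:
  assumes "C1_approx \<Omega> p C u g"
  shows "mem_Lp (lebesgue_on \<Omega>) p u" "mem_Lp (lebesgue_on \<Omega>) p g"
  using assms by (auto simp: C1_approx_def)

lemma C1_approx_seq:
  assumes "C1_approx \<Omega> p C u g"
  obtains v v' K where "\<And>n::nat. C1_fun (v n) (v' n)" "\<And>n. compact (K n)" "\<And>n. K n \<subseteq> \<Omega>"
    "\<And>n x. x \<notin> K n \<Longrightarrow> \<bar>v n x\<bar> \<le> C"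
    "(\<lambda>n. Lp_pow (lebesgue_on \<Omega>) p (\<lambda>x. v n x - u x)) \<longlonglongrightarrow> 0"
    "(\<lambda>n. Lp_pow (lebesgue_on \<Omega>) p (\<lambda>x. v' n x - g x)) \<longlonglongrightarrow> 0"
proof -
  define Q where "Q n v v' K \<longleftrightarrow> C1_fun v v' \<and> compact K \<and> K \<subseteq> \<Omega> \<and> (\<forall>x. x \<notin> K \<longrightarrow> \<bar>v x\<bar> \<le> C) \<and>
        Lp_pow (lebesgue_on \<Omega>) p (\<lambda>x. v x - u x) < inverse (real (Suc n)) \<and>
        Lp_pow (lebesgue_on \<Omega>) p (\<lambda>x. v' x - g x) < inverse (real (Suc n))" for n :: nat and v v' K
  have "\<exists>v v' K. Q n v v' K" for n
    using assms unfolding C1_approx_def Q_def by simp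
  then obtain v v' K where "\<And>n. Q n (v n) (v' n) (K n)"
    by metis
  note * = this[unfolded Q_def]
  show thesis
  proof (rule that[of v v' K])
    show "(\<lambda>n. Lp_pow (lebesgue_on \<Omega>) p (\<lambda>x. v n x - u x)) \<longlonglongrightarrow> 0"
      by (rule tendsto_sandwich[OF _ _ tendsto_const LIMSEQ_inverse_real_of_nat])
        (use * in \<open>auto simp: Lp_pow_nonneg intro!: always_eventually less_imp_le\<close>)
    show "(\<lambda>n. Lp_pow (lebesgue_on \<Omega>) p (\<lambda>x. v' n x - g x)) \<longlonglongrightarrow> 0"
      by (rule tendsto_sandwich[OF _ _ tendsto_const LIMSEQ_inverse_real_of_nat])
        (use * in \<open>auto simp: Lp_pow_nonneg intro!: always_eventually less_imp_le\<close>)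
  qed (use * in blast)+
qed

text \<open>Approximants of a nearby \<open>w n\<close> also serve for \<open>u\<close>. The bound
  \<open>C\<close> survives since it constrains only the approximants, never the limit. Sums,
  compositions and truncations are all obtained through this closedness.\<close>

lemma C1_approx_limit:
  assumes \<Omega>: "open \<Omega>" "bounded \<Omega>" and p: "0 \<le> p"
    and w: "\<And>n::nat. C1_approx \<Omega> p C (w n) (h n)"
    and u: "mem_Lp (lebesgue_on \<Omega>) p u" "mem_Lp (lebesgue_on \<Omega>) p g"
    and lim: "(\<lambda>n. Lp_pow (lebesgue_on \<Omega>) p (\<lambda>x. w n x - u x)) \<longlonglongrightarrow> 0"
      "(\<lambda>n. Lp_pow (lebesgue_on \<Omega>) p (\<lambda>x. h n x - g x)) \<longlonglongrightarrow> 0"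
  shows "C1_approx \<Omega> p C u g"
  unfolding C1_approx_def
proof (intro conjI u allI impI)
  fix \<eta> :: real assume "0 < \<eta>"
  define \<epsilon> where "\<epsilon> = \<eta> / (2 * 2 powr p)"
  have \<epsilon>: "\<epsilon> > 0" using \<open>0 < \<eta>\<close> by (simp add: \<epsilon>_def)
  obtain n where n: "Lp_pow (lebesgue_on \<Omega>) p (\<lambda>x. w n x - u x) < \<epsilon>" "Lp_pow (lebesgue_on \<Omega>) p (\<lambda>x. h n x - g x) < \<epsilon>"
    using eventually_happens'[OF sequentially_bot eventually_conj[OF order_tendstoD(2)[OF lim(1) \<epsilon>] order_tendstoD(2)[OF lim(2) \<epsilon>]]]
    by blast
  obtain v v' K where v: "C1_fun v v'" "compact K" "K \<subseteq> \<Omega>" "\<forall>x. x \<notin> K \<longrightarrow> \<bar>v x\<bar> \<le> C"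
        "Lp_pow (lebesgue_on \<Omega>) p (\<lambda>x. v x - w n x) < \<epsilon>"
        "Lp_pow (lebesgue_on \<Omega>) p (\<lambda>x. v' x - h n x) < \<epsilon>"
    using w[of n] \<epsilon> unfolding C1_approx_def by blast
  note vm = C1_fun_mem_Lp[OF \<Omega> p v(1)]
  note wm = C1_approx_mem[OF w[of n]]
  have e: "2 powr p * (\<epsilon> + \<epsilon>) = \<eta>" by (simp add: \<epsilon>_def field_simps)
  have "Lp_pow (lebesgue_on \<Omega>) p (\<lambda>x. (v x - w n x) + (w n x - u x))
     \<le> 2 powr p * (Lp_pow (lebesgue_on \<Omega>) p (\<lambda>x. v x - w n x) + Lp_pow (lebesgue_on \<Omega>) p (\<lambda>x. w n x - u x))"
    by (intro mem_Lp_add(2) mem_Lp_diff(1) vm wm u p)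
  also have "\<dots> < 2 powr p * (\<epsilon> + \<epsilon>)" using n v by (intro mult_strict_left_mono add_strict_mono) auto
  finally have 1: "Lp_pow (lebesgue_on \<Omega>) p (\<lambda>x. v x - u x) < \<eta>" unfolding e by simp
  have "Lp_pow (lebesgue_on \<Omega>) p (\<lambda>x. (v' x - h n x) + (h n x - g x))
     \<le> 2 powr p * (Lp_pow (lebesgue_on \<Omega>) p (\<lambda>x. v' x - h n x) + Lp_pow (lebesgue_on \<Omega>) p (\<lambda>x. h n x - g x))"
    by (intro mem_Lp_add(2) mem_Lp_diff(1) vm wm u p)
  also have "\<dots> < 2 powr p * (\<epsilon> + \<epsilon>)" using n v by (intro mult_strict_left_mono add_strict_mono) auto
  finally have 2: "Lp_pow (lebesgue_on \<Omega>) p (\<lambda>x. v' x - g x) < \<eta>" unfolding e by simp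
  show "\<exists>v v' K. C1_fun v v' \<and> compact K \<and> K \<subseteq> \<Omega> \<and> (\<forall>x. x \<notin> K \<longrightarrow> \<bar>v x\<bar> \<le> C) \<and>
        Lp_pow (lebesgue_on \<Omega>) p (\<lambda>x. v x - u x) < \<eta> \<and> Lp_pow (lebesgue_on \<Omega>) p (\<lambda>x. v' x - g x) < \<eta>"
    using v 1 2 by blast
qed

lemma C1_approx_C1:
  assumes "open \<Omega>" "bounded \<Omega>" "0 \<le> p" "C1_fun v v'" "compact K" "K \<subseteq> \<Omega>" "\<And>x. x \<notin> K \<Longrightarrow> \<bar>v x\<bar> \<le> C"
  shows "C1_approx \<Omega> p C v v'"
  unfolding C1_approx_def
proof (intro conjI C1_fun_mem_Lp[OF assms(1-4)] allI impI)
  fix \<eta> :: real assume "0 < \<eta>"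
  then show "\<exists>w w' K. C1_fun w w' \<and> compact K \<and> K \<subseteq> \<Omega> \<and> (\<forall>x. x \<notin> K \<longrightarrow> \<bar>w x\<bar> \<le> C) \<and>
        Lp_pow (lebesgue_on \<Omega>) p (\<lambda>x. w x - v x) < \<eta> \<and> Lp_pow (lebesgue_on \<Omega>) p (\<lambda>x. w' x - v' x) < \<eta>"
    using assms by (intro exI[of _ v] exI[of _ v'] exI[of _ K]) (simp add: Lp_pow_def)
qed

lemma C1_approx_uminus:
  assumes "C1_approx \<Omega> p C u g" shows "C1_approx \<Omega> p C (\<lambda>x. - u x) (\<lambda>x. - g x)"
  unfolding C1_approx_def
proof (intro conjI mem_Lp_uminus C1_approx_mem[OF assms] allI impI)
  fix \<eta> :: real assume "0 < \<eta>"
  then obtain v v' K where v: "C1_fun v v'" "compact K" "K \<subseteq> \<Omega>" "\<forall>x. x \<notin> K \<longrightarrow> \<bar>v x\<bar> \<le> C"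
        "Lp_pow (lebesgue_on \<Omega>) p (\<lambda>x. v x - u x) < \<eta>"
        "Lp_pow (lebesgue_on \<Omega>) p (\<lambda>x. v' x - g x) < \<eta>"
    using assms unfolding C1_approx_def by blast
  have "Lp_pow (lebesgue_on \<Omega>) p (\<lambda>x. - v x - - u x) < \<eta>" "Lp_pow (lebesgue_on \<Omega>) p (\<lambda>x. - v' x - - g x) < \<eta>"
    using v(5,6) Lp_pow_minus_commute[where f = v and g = u] Lp_pow_minus_commute[where f = v' and g = g] by simp_all
  with v show "\<exists>v v' K. C1_fun v v' \<and> compact K \<and> K \<subseteq> \<Omega> \<and> (\<forall>x. x \<notin> K \<longrightarrow> \<bar>v x\<bar> \<le> C) \<and>
        Lp_pow (lebesgue_on \<Omega>) p (\<lambda>x. v x - - u x) < \<eta> \<and> Lp_pow (lebesgue_on \<Omega>) p (\<lambda>x. v' x - - g x) < \<eta>"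
    by (intro exI[of _ "\<lambda>x. - v x"] exI[of _ "\<lambda>x. - v' x"] exI[of _ K]) (auto intro: C1_fun_uminus)
qed

lemma C1_approx_add:
  assumes \<Omega>: "open \<Omega>" "bounded \<Omega>" and p: "0 \<le> p"
    and u: "C1_approx \<Omega> p C u g" and w: "C1_approx \<Omega> p D w h"
  shows "C1_approx \<Omega> p (C + D) (\<lambda>x. u x + w x) (\<lambda>x. g x + h x)"
proof -
  obtain v1 v1' K1 where v1: "\<And>n::nat. C1_fun (v1 n) (v1' n)" "\<And>n. compact (K1 n)" "\<And>n. K1 n \<subseteq> \<Omega>"
    "\<And>n x. x \<notin> K1 n \<Longrightarrow> \<bar>v1 n x\<bar> \<le> C"
    "(\<lambda>n. Lp_pow (lebesgue_on \<Omega>) p (\<lambda>x. v1 n x - u x)) \<longlonglongrightarrow> 0"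
    "(\<lambda>n. Lp_pow (lebesgue_on \<Omega>) p (\<lambda>x. v1' n x - g x)) \<longlonglongrightarrow> 0"
    using C1_approx_seq[OF u] by blast
  obtain v2 v2' K2 where v2: "\<And>n::nat. C1_fun (v2 n) (v2' n)" "\<And>n. compact (K2 n)" "\<And>n. K2 n \<subseteq> \<Omega>"
    "\<And>n x. x \<notin> K2 n \<Longrightarrow> \<bar>v2 n x\<bar> \<le> D"
    "(\<lambda>n. Lp_pow (lebesgue_on \<Omega>) p (\<lambda>x. v2 n x - w x)) \<longlonglongrightarrow> 0"
    "(\<lambda>n. Lp_pow (lebesgue_on \<Omega>) p (\<lambda>x. v2' n x - h x)) \<longlonglongrightarrow> 0"
    using C1_approx_seq[OF w] by blast
  note m = C1_fun_mem_Lp[OF \<Omega> p v1(1)] C1_fun_mem_Lp[OF \<Omega> p v2(1)] C1_approx_mem[OF u] C1_approx_mem[OF w]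
  show ?thesis
  proof (rule C1_approx_limit[OF \<Omega> p, where w = "\<lambda>n x. v1 n x + v2 n x" and h = "\<lambda>n x. v1' n x + v2' n x"])
    show "C1_approx \<Omega> p (C + D) (\<lambda>x. v1 n x + v2 n x) (\<lambda>x. v1' n x + v2' n x)" for n
    proof (rule C1_approx_C1[OF \<Omega> p, of _ _ "K1 n \<union> K2 n"])
      show "\<bar>v1 n x + v2 n x\<bar> \<le> C + D" if "x \<notin> K1 n \<union> K2 n" for x
        using v1(4)[of x n] v2(4)[of x n] that by auto
    qed (use v1 v2 in \<open>auto intro: C1_fun_add\<close>)
    show "(\<lambda>n. Lp_pow (lebesgue_on \<Omega>) p (\<lambda>x. (v1 n x + v2 n x) - (u x + w x))) \<longlonglongrightarrow> 0"
      by (intro Lp_tendsto_add mem_Lp_diff(1) m p v1(5) v2(5))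
    show "(\<lambda>n. Lp_pow (lebesgue_on \<Omega>) p (\<lambda>x. (v1' n x + v2' n x) - (g x + h x))) \<longlonglongrightarrow> 0"
      by (intro Lp_tendsto_add mem_Lp_diff(1) m p v1(6) v2(6))
  qed (intro mem_Lp_add(1) m p)+
qed

lemma C1_approx_diff:
  assumes \<Omega>: "open \<Omega>" "bounded \<Omega>" and p: "0 \<le> p"
    and u: "C1_approx \<Omega> p C u g" and w: "C1_approx \<Omega> p D w h"
  shows "C1_approx \<Omega> p (C + D) (\<lambda>x. u x - w x) (\<lambda>x. g x - h x)"
  using C1_approx_add[OF \<Omega> p u C1_approx_uminus[OF w]] by simp

lemma (in finite_measure) integral_tendsto_of_Lp:
  fixes F :: "nat \<Rightarrow> 'a \<Rightarrow> 'b::euclidean_space" and f :: "nat \<Rightarrow> 'a \<Rightarrow> 'c::euclidean_space"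
  assumes "\<And>n. mem_Lp M p (f n)" "1 \<le> p" "(\<lambda>n. Lp_pow M p (f n)) \<longlonglongrightarrow> 0"
    and F: "\<And>n. integrable M (F n)" "integrable M F'"
    and le: "\<And>n x. norm (F n x - F' x) \<le> B * norm (f n x)"
  shows "(\<lambda>n. \<integral>x. F n x \<partial>M) \<longlonglongrightarrow> (\<integral>x. F' x \<partial>M)"
proof (rule Lim_null[THEN iffD2], rule Lim_null_comparison)
  show "(\<lambda>n. B * (\<integral>x. norm (f n x) \<partial>M)) \<longlonglongrightarrow> 0"
    using tendsto_mult_left[OF L1_tendsto_of_Lp[OF assms(1-3)], of B] by simp
  have "norm ((\<integral>x. F n x \<partial>M) - (\<integral>x. F' x \<partial>M)) \<le> B * (\<integral>x. norm (f n x) \<partial>M)" for n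
  proof -
    have i: "integrable M (\<lambda>x. B * norm (f n x))"
      using mem_Lp_imp_integrable(1)[OF assms(1,2)] by (intro integrable_mult_right) auto
    have "(\<integral>x. F n x \<partial>M) - (\<integral>x. F' x \<partial>M) = (\<integral>x. F n x - F' x \<partial>M)" using F by simp
    also have "norm \<dots> \<le> (\<integral>x. B * norm (f n x) \<partial>M)"
      by (rule norm_integral_le) (use F le i in auto)
    finally show ?thesis by simp
  qed
  then show "\<forall>\<^sub>F n in sequentially. norm ((\<integral>x. F n x \<partial>M) - (\<integral>x. F' x \<partial>M)) \<le> B * (\<integral>x. norm (f n x) \<partial>M)"
    by simp
qed

lemma C1_integral_gradient_eq_0_on:
  assumes "open \<Omega>" "C1_fun v v'" "compact K" "K \<subseteq> \<Omega>" "\<And>x. x \<notin> K \<Longrightarrow> v x = 0"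
  shows "(\<integral>x. v' x \<partial>lebesgue_on \<Omega>) = 0"
proof -
  have "v' x = 0" if "x \<notin> \<Omega>" for x
    using C1_fun_support_deriv[OF assms(2) compact_imp_closed[OF assms(3)] assms(5)] that assms(4) by blast
  then have "(\<integral>x. v' x \<partial>lebesgue_on \<Omega>) = (\<integral>x. v' x \<partial>lebesgue)"
    by (intro integral_lebesgue_on_support open_sets_lebesgue assms(1))
  also have "\<dots> = (\<integral>x. v' x \<partial>lborel)"
    using C1_fun_borel(2)[OF assms(2)] by (intro integral_completion) simp
  also have "\<dots> = 0" by (rule C1_integral_gradient_eq_0[OF assms(2,3,5)])
  finally show ?thesis .
qed

text \<open>For a C1 approximant \<open>v\<close>, the product of \<open>v\<close> with a test
  function has compact support, so its gradient integrates to zero. This is integration by parts,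
  and both sides are continuous under the approximation. The behaviour of \<open>v\<close> near the
  boundary is immaterial because the test function vanishes there.\<close>

lemma C1_approx_weak_gradient:
  assumes \<Omega>: "open \<Omega>" "bounded \<Omega>" and p: "1 \<le> p" and u: "C1_approx \<Omega> p C u g"
  shows "has_weak_gradient \<Omega> u g"
  unfolding has_weak_gradient_def
proof (intro conjI ballI allI impI)
  have \<Omega>l: "\<Omega> \<in> sets lebesgue" by (rule open_sets_lebesgue[OF \<Omega>(1)])
  note um = C1_approx_mem[OF u]
  show lu: "u locally_integrable_on \<Omega>" by (rule Lp_locally_integrable[OF _ p \<Omega>l]) (use um in \<open>simp add: Lp_iff\<close>)
  show lg: "g locally_integrable_on \<Omega>" by (rule Lp_locally_integrable[OF _ p \<Omega>l]) (use um in \<open>simp add: Lp_iff\<close>)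
  fix \<psi> \<psi>' assume \<psi>: "\<psi> \<in> C1c \<Omega>" "\<forall>x. GDERIV \<psi> x :> \<psi>' x"
  obtain w K where K: "C1_fun \<psi> w" "compact K" "K \<subseteq> \<Omega>" "\<forall>x. x \<notin> K \<longrightarrow> \<psi> x = 0"
    using \<psi>(1) unfolding C1c_iff by blast
  have "w x = \<psi>' x" for x using C1_fun_gderiv[OF K(1)] \<psi>(2) GDERIV_unique by blast
  then have "w = \<psi>'" by auto
  with K have C1: "C1_fun \<psi> \<psi>'" by simp
  have K': "x \<notin> K \<Longrightarrow> \<psi>' x = 0" for x
    using C1_fun_support_deriv[OF C1 compact_imp_closed[OF K(2)]] K(4) by blast
  obtain B where B: "B > 0" "\<And>x. norm (\<psi> x) \<le> B"
    using continuous_compact_support_bounded[OF C1_fun_continuous[OF C1] K(2)] K(4) by blast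
  obtain B' where B': "B' > 0" "\<And>x. norm (\<psi>' x) \<le> B'"
    using continuous_compact_support_bounded[OF C1_fun_continuous'[OF C1] K(2)] K' by blast
  obtain v v' K1 where v: "\<And>n::nat. C1_fun (v n) (v' n)" "\<And>n. compact (K1 n)" "\<And>n. K1 n \<subseteq> \<Omega>"
    "\<And>n x. x \<notin> K1 n \<Longrightarrow> \<bar>v n x\<bar> \<le> C"
    "(\<lambda>n. Lp_pow (lebesgue_on \<Omega>) p (\<lambda>x. v n x - u x)) \<longlonglongrightarrow> 0"
    "(\<lambda>n. Lp_pow (lebesgue_on \<Omega>) p (\<lambda>x. v' n x - g x)) \<longlonglongrightarrow> 0"
    using C1_approx_seq[OF u] by blast
  have p0: "0 \<le> p" using p by simp
  note vm = C1_fun_mem_Lp[OF \<Omega> p0 v(1)]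
  have vl: "v n locally_integrable_on \<Omega>" "v' n locally_integrable_on \<Omega>" for n
    using vm by (auto intro!: Lp_locally_integrable[OF _ p \<Omega>l] simp: Lp_iff)
  note i1 = C1c_test_integrable'[OF \<psi>(1) \<psi>(2)[rule_format] \<Omega>(1)]
  note i2 = C1c_test_integrable[OF \<psi>(1) \<Omega>(1)]
  interpret finite_measure "lebesgue_on \<Omega>"
    by (rule finite_measure_lebesgue_on[OF open_bounded_lmeasurable[OF \<Omega>]])
  have 1: "(\<lambda>n. \<integral>x. v n x *\<^sub>R \<psi>' x \<partial>lebesgue_on \<Omega>) \<longlonglongrightarrow> (\<integral>x. u x *\<^sub>R \<psi>' x \<partial>lebesgue_on \<Omega>)"
  proof (rule integral_tendsto_of_Lp[OF _ p v(5)])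
    show "norm (v n x *\<^sub>R \<psi>' x - u x *\<^sub>R \<psi>' x) \<le> B' * norm (v n x - u x)" for n x
      using B'(2)[of x] by (simp add: scaleR_diff_left[symmetric] mult.commute mult_right_mono)
  qed (intro mem_Lp_diff(1) vm um p0 i1 vl lu)+
  have 2: "(\<lambda>n. \<integral>x. \<psi> x *\<^sub>R v' n x \<partial>lebesgue_on \<Omega>) \<longlonglongrightarrow> (\<integral>x. \<psi> x *\<^sub>R g x \<partial>lebesgue_on \<Omega>)"
  proof (rule integral_tendsto_of_Lp[OF _ p v(6)])
    show "norm (\<psi> x *\<^sub>R v' n x - \<psi> x *\<^sub>R g x) \<le> B * norm (v' n x - g x)" for n x
      using B(2)[of x] by (simp add: scaleR_diff_right[symmetric] mult_right_mono)
  qed (intro mem_Lp_diff(1) vm um p0 i2 vl lg)+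
  have "(\<integral>x. v n x *\<^sub>R \<psi>' x \<partial>lebesgue_on \<Omega>) = - (\<integral>x. \<psi> x *\<^sub>R v' n x \<partial>lebesgue_on \<Omega>)" for n
  proof -
    have "(\<integral>x. v n x *\<^sub>R \<psi>' x + \<psi> x *\<^sub>R v' n x \<partial>lebesgue_on \<Omega>) = 0"
      by (rule C1_integral_gradient_eq_0_on[OF \<Omega>(1) C1_fun_mult[OF v(1) C1] K(2,3)]) (use K in auto)
    also have "(\<integral>x. v n x *\<^sub>R \<psi>' x + \<psi> x *\<^sub>R v' n x \<partial>lebesgue_on \<Omega>)
        = (\<integral>x. v n x *\<^sub>R \<psi>' x \<partial>lebesgue_on \<Omega>) + (\<integral>x. \<psi> x *\<^sub>R v' n x \<partial>lebesgue_on \<Omega>)"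
      by (intro Bochner_Integration.integral_add i1 i2 vl)
    finally show ?thesis by (simp add: add_eq_0_iff2)
  qed
  then have "(\<lambda>n. \<integral>x. v n x *\<^sub>R \<psi>' x \<partial>lebesgue_on \<Omega>) \<longlonglongrightarrow> - (\<integral>x. \<psi> x *\<^sub>R g x \<partial>lebesgue_on \<Omega>)"
    using tendsto_minus[OF 2] by simp
  with 1 show "(\<integral>x. u x *\<^sub>R \<psi>' x \<partial>lebesgue_on \<Omega>) = - (\<integral>x. \<psi> x *\<^sub>R g x \<partial>lebesgue_on \<Omega>)"
    by (rule LIMSEQ_unique)
qed

section \<open>Passage between the Sobolev norm and \<open>C1_approx\<close>\<close>

lemma weak_gradient_eq:
  assumes \<Omega>: "open \<Omega>" and g: "has_weak_gradient \<Omega> u g"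
  shows "AE x in lebesgue_on \<Omega>. weak_gradient \<Omega> u x = g x"
proof -
  have "has_weak_gradient \<Omega> u (weak_gradient \<Omega> u)"
    unfolding weak_gradient_def by (rule someI[of _ g]) (rule g)
  then show ?thesis by (rule weak_gradient_unique[OF \<Omega> _ g])
qed

lemma W1p_norm_eq:
  assumes \<Omega>: "open \<Omega>" and g: "has_weak_gradient \<Omega> u g" "g \<in> borel_measurable (lebesgue_on \<Omega>)"
  shows "W1p_norm \<Omega> p u = Lp_pow (lebesgue_on \<Omega>) p u powr (1 / p) + Lp_pow (lebesgue_on \<Omega>) p g powr (1 / p)"
proof -
  note ae = weak_gradient_eq[OF \<Omega> g(1)]
  then have ae': "AE x in lebesgue_on \<Omega>. g x = weak_gradient \<Omega> u x" by eventually_elim simp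
  have "Lp_pow (lebesgue_on \<Omega>) p (weak_gradient \<Omega> u) = Lp_pow (lebesgue_on \<Omega>) p g"
    by (rule Lp_pow_cong_AE[OF ae borel_measurable_AE_on[OF open_sets_lebesgue[OF \<Omega>] g(2) ae'] g(2)])
  then show ?thesis by (simp add: W1p_norm_def Lp_norm_eq)
qed

lemma tendsto_powr_zero_iff:
  assumes "\<And>n::nat. 0 \<le> f n" "0 < (a::real)"
  shows "(\<lambda>n. f n powr a) \<longlonglongrightarrow> 0 \<longleftrightarrow> f \<longlonglongrightarrow> 0"
proof
  assume "(\<lambda>n. f n powr a) \<longlonglongrightarrow> 0"
  then have "(\<lambda>n. (f n powr a) powr (1 / a)) \<longlonglongrightarrow> 0 powr (1/a)"
    using assms by (intro tendsto_powr') auto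
  moreover have "(f n powr a) powr (1 / a) = f n" for n
    using assms by (simp add: powr_powr)
  ultimately show "f \<longlonglongrightarrow> 0" by simp
next
  assume "f \<longlonglongrightarrow> 0"
  then have "(\<lambda>n. f n powr a) \<longlonglongrightarrow> 0 powr a"
    using assms by (intro tendsto_powr') auto
  then show "(\<lambda>n. f n powr a) \<longlonglongrightarrow> 0" by simp
qed

text \<open>Removes both the roots and the arbitrary choice inside \<open>weak_gradient\<close>;
  uniqueness of weak gradients allows any known gradient \<open>g n\<close> instead.\<close>

lemma W1p_norm_tendsto_iff:
  fixes f :: "nat \<Rightarrow> 'a::euclidean_space \<Rightarrow> real"
  assumes \<Omega>: "open \<Omega>" and p: "0 < p"
    and g: "\<And>n. has_weak_gradient \<Omega> (f n) (g n)" "\<And>n. g n \<in> borel_measurable (lebesgue_on \<Omega>)"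
  shows "(\<lambda>n. W1p_norm \<Omega> p (f n)) \<longlonglongrightarrow> 0 \<longleftrightarrow>
     (\<lambda>n. Lp_pow (lebesgue_on \<Omega>) p (f n)) \<longlonglongrightarrow> 0 \<and> (\<lambda>n. Lp_pow (lebesgue_on \<Omega>) p (g n)) \<longlonglongrightarrow> 0"
proof -
  let ?a = "\<lambda>n. Lp_pow (lebesgue_on \<Omega>) p (f n) powr (1 / p)"
  let ?b = "\<lambda>n. Lp_pow (lebesgue_on \<Omega>) p (g n) powr (1 / p)"
  have "(\<lambda>n. ?a n + ?b n) \<longlonglongrightarrow> 0 \<longleftrightarrow> ?a \<longlonglongrightarrow> 0 \<and> ?b \<longlonglongrightarrow> 0"
  proof
    assume *: "(\<lambda>n. ?a n + ?b n) \<longlonglongrightarrow> 0"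
    have "?a \<longlonglongrightarrow> 0" by (rule tendsto_sandwich[OF _ _ tendsto_const *]) auto
    moreover have "?b \<longlonglongrightarrow> 0" by (rule tendsto_sandwich[OF _ _ tendsto_const *]) auto
    ultimately show "?a \<longlonglongrightarrow> 0 \<and> ?b \<longlonglongrightarrow> 0" ..
  qed (use tendsto_add[of ?a 0 sequentially ?b 0] in auto)
  then show ?thesis
    using p by (simp add: W1p_norm_eq[OF \<Omega> g] tendsto_powr_zero_iff Lp_pow_nonneg)
qed

text \<open>With \<open>C = 0\<close> the bound off \<open>K\<close> says that the approximants
  vanish there, so they belong to \<open>C1c \<Omega>\<close>.\<close>

lemma C1_approx_imp_W1p0:
  assumes \<Omega>: "open \<Omega>" "bounded \<Omega>" and p: "1 \<le> p" and w: "C1_approx \<Omega> p 0 w g"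
  shows "w \<in> W1p0 \<Omega> p"
proof -
  obtain v v' K where v: "\<And>n::nat. C1_fun (v n) (v' n)" "\<And>n. compact (K n)" "\<And>n. K n \<subseteq> \<Omega>"
    "\<And>n x. x \<notin> K n \<Longrightarrow> \<bar>v n x\<bar> \<le> 0"
    "(\<lambda>n. Lp_pow (lebesgue_on \<Omega>) p (\<lambda>x. v n x - w x)) \<longlonglongrightarrow> 0"
    "(\<lambda>n. Lp_pow (lebesgue_on \<Omega>) p (\<lambda>x. v' n x - g x)) \<longlonglongrightarrow> 0"
    using C1_approx_seq[OF w] by blast
  have p0: "0 \<le> p" using p by simp
  have ap: "C1_approx \<Omega> p (0 + 0) (\<lambda>x. v n x - w x) (\<lambda>x. v' n x - g x)" for n
    by (rule C1_approx_diff[OF \<Omega> p0 C1_approx_C1[OF \<Omega> p0 v(1)[of n] v(2)[of n] v(3)[of n] v(4)[where n = n]] w])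
  note weak = C1_approx_weak_gradient[OF \<Omega> p ap]
  have meas: "(\<lambda>x. v' n x - g x) \<in> borel_measurable (lebesgue_on \<Omega>)" for n
    using C1_approx_mem(2)[OF ap] by (simp add: mem_Lp_def)
  have "(\<lambda>n. W1p_norm \<Omega> p (\<lambda>x. v n x - w x)) \<longlonglongrightarrow> 0"
    by (subst W1p_norm_tendsto_iff[OF \<Omega>(1) _ weak meas]) (use p v(5,6) in auto)
  moreover have "v n \<in> C1c \<Omega>" for n
    unfolding C1c_iff using v(1-3)[of n] v(4)[where n = n] by (meson abs_le_zero_iff)
  moreover have "w \<in> W1p \<Omega> p"
    using C1_approx_mem[OF w] C1_approx_weak_gradient[OF \<Omega> p w] by (auto simp: W1p_def Lp_iff)
  ultimately show ?thesis by (auto simp: W1p0_def)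
qed

text \<open>Membership in \<open>W1p\<close> provides the gradient \<open>g\<close>. The classical
  gradients of the approximants minus \<open>g\<close> are weak gradients of the differences, so the
  norm convergence can be read off from them.\<close>

lemma W1p0_imp_C1_approx:
  assumes \<Omega>: "open \<Omega>" "bounded \<Omega>" and p: "1 \<le> p" and w: "w \<in> W1p0 \<Omega> p"
  obtains g where "C1_approx \<Omega> p 0 w g"
proof -
  have p0: "0 \<le> p" using p by simp
  obtain v where v: "\<And>k::nat. v k \<in> C1c \<Omega>" "(\<lambda>k. W1p_norm \<Omega> p (\<lambda>x. v k x - w x)) \<longlonglongrightarrow> 0"
    using w by (auto simp: W1p0_def)
  obtain g where g: "mem_Lp (lebesgue_on \<Omega>) p w" "mem_Lp (lebesgue_on \<Omega>) p g" "has_weak_gradient \<Omega> w g"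
    using w by (auto simp: W1p0_def W1p_def Lp_iff)
  obtain v' K where K: "\<And>k. C1_fun (v k) (v' k)" "\<And>k. compact (K k)" "\<And>k. K k \<subseteq> \<Omega>" "\<And>k x. x \<notin> K k \<Longrightarrow> v k x = 0"
    using v(1) unfolding C1c_iff by metis
  have ap: "C1_approx \<Omega> p 0 (v k) (v' k)" for k
    by (rule C1_approx_C1[OF \<Omega> p0 K(1)[of k] K(2)[of k] K(3)[of k]]) (simp add: K(4))
  have weak: "has_weak_gradient \<Omega> (\<lambda>x. v k x - w x) (\<lambda>x. v' k x - g x)" for k
    by (rule has_weak_gradient_diff[OF \<Omega>(1) C1_approx_weak_gradient[OF \<Omega> p ap] g(3)])
  have meas: "(\<lambda>x. v' k x - g x) \<in> borel_measurable (lebesgue_on \<Omega>)" for k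
    using mem_Lp_diff(1)[OF C1_approx_mem(2)[OF ap] g(2) p0] by (simp add: mem_Lp_def)
  have "(\<lambda>k. Lp_pow (lebesgue_on \<Omega>) p (\<lambda>x. v k x - w x)) \<longlonglongrightarrow> 0 \<and>
      (\<lambda>k. Lp_pow (lebesgue_on \<Omega>) p (\<lambda>x. v' k x - g x)) \<longlonglongrightarrow> 0"
    by (subst W1p_norm_tendsto_iff[OF \<Omega>(1) _ weak meas, symmetric]) (use p v(2) in auto)
  then have "C1_approx \<Omega> p 0 w g"
    by (intro C1_approx_limit[OF \<Omega> p0 ap g(1,2)]) auto
  then show thesis by (rule that)
qed

lemma Lp_pow_lebesgue:
  assumes "f \<in> borel_measurable borel"
  shows "Lp_pow lebesgue p f = Lp_pow lborel p f"
  unfolding Lp_pow_def by (rule integral_completion) (use assms in simp)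

lemma Lp_tendsto_bound:
  fixes F :: "nat \<Rightarrow> 'a \<Rightarrow> 'b::euclidean_space" and f :: "nat \<Rightarrow> 'a \<Rightarrow> 'c::euclidean_space"
  assumes f: "\<And>n. mem_Lp M p (f n)" "(\<lambda>n. Lp_pow M p (f n)) \<longlonglongrightarrow> 0"
    and F: "\<And>n. F n \<in> borel_measurable M" "\<And>n x. norm (F n x) \<le> B * norm (f n x)" and B: "0 \<le> B" "0 \<le> p"
  shows "\<And>n. mem_Lp M p (F n)" "(\<lambda>n. Lp_pow M p (F n)) \<longlonglongrightarrow> 0"
proof -
  show mF: "mem_Lp M p (F n)" for n
    by (rule mem_Lp_bound[OF f(1)[of n] F(1) AE_I2 B]) (rule F(2))
  have "Lp_pow M p (F n) \<le> B powr p * Lp_pow M p (f n)" for n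
  proof -
    have m: "mem_Lp M p (\<lambda>x. B *\<^sub>R f n x)"
      by (rule mem_Lp_bound[OF f(1)[of n], where B = B]) (use f(1)[of n] B in \<open>auto simp: mem_Lp_def\<close>)
    have "Lp_pow M p (F n) \<le> Lp_pow M p (\<lambda>x. B *\<^sub>R f n x)"
      by (rule Lp_pow_mono[OF m mF]) (use F(2) B in auto)
    then show ?thesis by (simp add: Lp_pow_scale B)
  qed
  then show "(\<lambda>n. Lp_pow M p (F n)) \<longlonglongrightarrow> 0"
    by (intro tendsto_sandwich[OF _ _ tendsto_const tendsto_mult_right_zero[OF f(2), of "B powr p"]])
      (auto simp: Lp_pow_nonneg)
qed

text \<open>Mollifying on the whole space keeps the bound: an average of values in
  \<open>[- C, C]\<close> stays there. This is how boundedness of \<phi> becomes a bound on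
  approximants near the boundary, without any regularity of that boundary.\<close>

lemma W1p_Linf_C1_approx:
  fixes \<phi> :: "'a::euclidean_space \<Rightarrow> real"
  assumes \<Omega>: "open \<Omega>" "bounded \<Omega>" and p: "1 \<le> p" and \<phi>: "\<phi> \<in> W1p UNIV p \<inter> Linf UNIV"
  obtains C g where "0 \<le> C" "C1_approx \<Omega> p C \<phi> g"
proof -
  have p0: "0 \<le> p" using p by simp
  obtain g where g: "mem_Lp lebesgue p \<phi>" "mem_Lp lebesgue p g" "has_weak_gradient UNIV \<phi> g"
    using \<phi> by (auto simp: W1p_def Lp_iff lebesgue_on_UNIV_eq)
  obtain C0 where "AE x in lebesgue_on UNIV. \<bar>\<phi> x\<bar> \<le> C0"
    using \<phi> by (auto simp: Linf_def)
  then have C0: "AE x in lebesgue. \<bar>\<phi> x\<bar> \<le> C0" unfolding lebesgue_on_UNIV_eq .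
  define C where "C = max 0 C0"
  have C: "0 \<le> C" by (simp add: C_def)
  have gm: "\<phi> \<in> borel_measurable lebesgue" "g \<in> borel_measurable lebesgue" using g by (auto simp: mem_Lp_def)
  obtain \<phi>1 where \<phi>1: "\<phi>1 \<in> borel_measurable borel" "AE x in lebesgue. \<phi> x = \<phi>1 x"
    using borel_representative[OF gm(1)] by blast
  obtain g' where g': "g' \<in> borel_measurable borel" "AE x in lebesgue. g x = g' x"
    using borel_representative[OF gm(2)] by blast
  \<comment> \<open>Clipping makes the bound hold at every point instead of almost everywhere, as
    \<open>mollify_gradient\<close> demands.\<close>
  define \<phi>' where "\<phi>' x = max (- C) (min C (\<phi>1 x))" for x
  have \<phi>'b: "\<phi>' \<in> borel_measurable borel" unfolding \<phi>'_def using \<phi>1(1) by measurable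
  have \<phi>'C: "\<bar>\<phi>' x\<bar> \<le> C" for x using C by (auto simp: \<phi>'_def)
  have eq: "AE x in lebesgue. \<phi> x = \<phi>' x"
    using \<phi>1(2) C0 by eventually_elim (auto simp: \<phi>'_def C_def)
  have lm: "\<phi>' \<in> borel_measurable lebesgue" "g' \<in> borel_measurable lebesgue"
    using \<phi>'b g'(1) by (auto intro: measurable_completion)
  have "mem_Lp lebesgue p \<phi>'" "mem_Lp lebesgue p g'"
    by (rule mem_Lp_cong_AE[OF g(1) lm(1) _ p0], use eq in \<open>eventually_elim, simp\<close>)
       (rule mem_Lp_cong_AE[OF g(2) lm(2) _ p0], use g'(2) in \<open>eventually_elim, simp\<close>)
  then have mem: "mem_Lp lborel p \<phi>'" "mem_Lp lborel p g'"
    using \<phi>'b g'(1) by (auto simp: mem_Lp_def integrable_completion)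
  have weak: "(\<integral>x. \<phi>' x *\<^sub>R v' x \<partial>lborel) = - (\<integral>x. v x *\<^sub>R g' x \<partial>lborel)"
    if v: "C1_fun v v'" "v \<in> C1c UNIV" for v v'
  proof -
    note vb = C1_fun_borel[OF v(1)]
    have vl: "v \<in> borel_measurable lebesgue" "v' \<in> borel_measurable lebesgue"
      using vb by (auto intro: measurable_completion)
    have "(\<integral>x. \<phi> x *\<^sub>R v' x \<partial>lebesgue) = - (\<integral>x. v x *\<^sub>R g x \<partial>lebesgue)"
      using g(3) v C1_fun_gderiv[OF v(1)] unfolding has_weak_gradient_def lebesgue_on_UNIV_eq by blast
    also have "(\<integral>x. \<phi> x *\<^sub>R v' x \<partial>lebesgue) = (\<integral>x. \<phi>' x *\<^sub>R v' x \<partial>lebesgue)"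
      by (rule integral_cong_AE) (use eq gm lm vl in auto)
    also have "(\<integral>x. v x *\<^sub>R g x \<partial>lebesgue) = (\<integral>x. v x *\<^sub>R g' x \<partial>lebesgue)"
      by (rule integral_cong_AE) (use g'(2) gm lm vl in auto)
    also have "(\<integral>x. \<phi>' x *\<^sub>R v' x \<partial>lebesgue) = (\<integral>x. \<phi>' x *\<^sub>R v' x \<partial>lborel)"
      by (rule integral_completion) (use \<phi>'b vb in simp)
    also have "(\<integral>x. v x *\<^sub>R g' x \<partial>lebesgue) = (\<integral>x. v x *\<^sub>R g' x \<partial>lborel)"
      by (rule integral_completion) (use g'(1) vb in simp)
    finally show ?thesis .
  qed
  have close: "Lp_pow (lebesgue_on \<Omega>) p (\<lambda>x. m x - f x) \<le> Lp_pow lborel p (\<lambda>x. m x - f' x)"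
    if m: "mem_Lp lborel p m" and f: "mem_Lp lebesgue p f" "mem_Lp lborel p f'" "AE x in lebesgue. f x = f' x"
    for m f f' :: "'a \<Rightarrow> 'b::euclidean_space"
  proof -
    have mb: "m \<in> borel_measurable borel" "f' \<in> borel_measurable borel" using m f by (auto simp: mem_Lp_def)
    have ml: "mem_Lp lebesgue p m"
      using m by (auto simp: mem_Lp_def integrable_completion intro: measurable_completion)
    have fl: "f \<in> borel_measurable lebesgue" using f by (simp add: mem_Lp_def)
    have mbl: "m \<in> borel_measurable lebesgue" "f' \<in> borel_measurable lebesgue"
      using mb by (auto intro: measurable_completion)
    have "Lp_pow (lebesgue_on \<Omega>) p (\<lambda>x. m x - f x) \<le> Lp_pow (lebesgue_on UNIV) p (\<lambda>x. m x - f x)"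
      by (rule mem_Lp_subset(2))
        (use mem_Lp_diff(1)[OF ml f(1) p0] open_sets_lebesgue[OF \<Omega>(1)] in \<open>auto simp: lebesgue_on_UNIV_eq\<close>)
    also have "\<dots> = Lp_pow lebesgue p (\<lambda>x. m x - f' x)"
      unfolding lebesgue_on_UNIV_eq by (rule Lp_pow_cong_AE) (use f(3) mbl fl in auto)
    also have "\<dots> = Lp_pow lborel p (\<lambda>x. m x - f' x)"
      by (rule Lp_pow_lebesgue) (use mb in simp)
    finally show ?thesis .
  qed
  have "C1_approx \<Omega> p C \<phi> g"
    unfolding C1_approx_def
  proof (intro conjI allI impI)
    show "mem_Lp (lebesgue_on \<Omega>) p \<phi>" "mem_Lp (lebesgue_on \<Omega>) p g"
      using mem_Lp_subset(1)[of UNIV p \<phi> \<Omega>] mem_Lp_subset(1)[of UNIV p g \<Omega>] g open_sets_lebesgue[OF \<Omega>(1)]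
      by (auto simp: lebesgue_on_UNIV_eq)
    fix \<eta> :: real assume \<eta>: "0 < \<eta>"
    obtain e1 where e1: "0 < e1"
      "\<And>e \<rho> \<rho>'. mollifier e \<rho> \<rho>' \<Longrightarrow> e \<le> e1 \<Longrightarrow> Lp_pow lborel p (\<lambda>x. mollify \<rho> \<phi>' x - \<phi>' x) < \<eta>"
      using mollify_converges[OF mem(1) p \<eta>] by blast
    obtain e2 where e2: "0 < e2"
      "\<And>e \<rho> \<rho>'. mollifier e \<rho> \<rho>' \<Longrightarrow> e \<le> e2 \<Longrightarrow> Lp_pow lborel p (\<lambda>x. mollify \<rho> g' x - g' x) < \<eta>"
      using mollify_converges[OF mem(2) p \<eta>] by blast
    define e where "e = min e1 e2"
    have e: "0 < e" "e \<le> e1" "e \<le> e2" using e1(1) e2(1) by (auto simp: e_def)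
    obtain \<rho> \<rho>' where \<rho>: "mollifier e (\<rho>::'a \<Rightarrow> real) \<rho>'" using mollifier_exists[OF e(1)] by blast
    have C1: "C1_fun (mollify \<rho> \<phi>') (mollify \<rho> g')"
      by (rule mollify_gradient[OF \<rho> e(1) \<phi>'b \<phi>'C g'(1)]) (rule weak)
    have b: "\<bar>mollify \<rho> \<phi>' x\<bar> \<le> C" for x
    proof -
      note i = mollify_integrable[OF \<rho> mem(1) p, of x]
      have "norm (mollify \<rho> \<phi>' x) \<le> (\<integral>y. \<rho> (x - y) * C \<partial>lborel)"
        unfolding mollify_def
        by (rule norm_integral_le)
          (use i mollifier_nonneg[OF \<rho>] \<phi>'C in \<open>auto simp: abs_mult intro!: mult_left_mono\<close>)
      also have "\<dots> = C" using i by simp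
      finally show ?thesis by simp
    qed
    have 1: "Lp_pow (lebesgue_on \<Omega>) p (\<lambda>x. mollify \<rho> \<phi>' x - \<phi> x) < \<eta>"
      using close[OF mollify_Lp(1)[OF \<rho> mem(1) p] g(1) mem(1) eq] e1(2)[OF \<rho> e(2)] by simp
    have 2: "Lp_pow (lebesgue_on \<Omega>) p (\<lambda>x. mollify \<rho> g' x - g x) < \<eta>"
      using close[OF mollify_Lp(1)[OF \<rho> mem(2) p] g(2) mem(2) g'(2)] e2(2)[OF \<rho> e(3)] by simp
    \<comment> \<open>The empty compact set is a valid \<open>K\<close>, since the mollified
      function is bounded by \<open>C\<close> everywhere.\<close>
    show "\<exists>v v' K. C1_fun v v' \<and> compact K \<and> K \<subseteq> \<Omega> \<and> (\<forall>x. x \<notin> K \<longrightarrow> \<bar>v x\<bar> \<le> C) \<and>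
        Lp_pow (lebesgue_on \<Omega>) p (\<lambda>x. v x - \<phi> x) < \<eta> \<and> Lp_pow (lebesgue_on \<Omega>) p (\<lambda>x. v' x - g x) < \<eta>"
      using C1 b 1 2 by (intro exI[of _ "mollify \<rho> \<phi>'"] exI[of _ "mollify \<rho> g'"] exI[of _ "{}"]) auto
  qed
  with C that show thesis by blast
qed

text \<open>A function \<open>S\<close> vanishing on \<open>[- C, C]\<close> turns approximants
  bounded by \<open>C\<close> off \<open>K\<close> into approximants vanishing off \<open>K\<close>.
  As \<open>S'\<close> is merely continuous and bounded, convergence of the gradients needs a
  subsequence converging almost everywhere and dominated convergence.\<close>

lemma C1_approx_compose:
  assumes \<Omega>: "open \<Omega>" "bounded \<Omega>" and p: "1 \<le> p" and u: "C1_approx \<Omega> p C u g"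
    and S: "\<And>r::real. (S has_real_derivative S' r) (at r)" "continuous_on UNIV S'" "\<And>r. \<bar>S' r\<bar> \<le> B"
      "\<And>r. \<bar>r\<bar> \<le> C \<Longrightarrow> S r = 0"
  shows "C1_approx \<Omega> p 0 (\<lambda>x. S (u x)) (\<lambda>x. S' (u x) *\<^sub>R g x)"
proof -
  have p0: "0 \<le> p" "0 < p" using p by auto
  have B: "0 \<le> B" using S(3)[of 0] by linarith
  have Sc: "continuous_on UNIV S"
    using S(1) by (meson DERIV_isCont continuous_at_imp_continuous_on)
  have [measurable]: "S \<in> borel_measurable borel" "S' \<in> borel_measurable borel"
    using Sc S(2) by (auto intro: borel_measurable_continuous_onI)
  have lip: "\<bar>S a - S b\<bar> \<le> B * \<bar>a - b\<bar>" for a b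
  proof -
    have "norm (S a - S b) \<le> B * norm (a - b)"
      by (rule field_differentiable_bound[of UNIV S S']) (use S in \<open>auto simp: has_field_derivative_at_within\<close>)
    then show ?thesis by simp
  qed
  have fin: "\<Omega> \<in> lmeasurable" by (rule open_bounded_lmeasurable[OF \<Omega>])
  note um = C1_approx_mem[OF u]
  have [measurable]: "u \<in> borel_measurable (lebesgue_on \<Omega>)" "g \<in> borel_measurable (lebesgue_on \<Omega>)"
    using um by (auto simp: mem_Lp_def)
  obtain v1 v1' K1 where v1: "\<And>n::nat. C1_fun (v1 n) (v1' n)" "\<And>n. compact (K1 n)" "\<And>n. K1 n \<subseteq> \<Omega>"
    "\<And>n x. x \<notin> K1 n \<Longrightarrow> \<bar>v1 n x\<bar> \<le> C"
    "(\<lambda>n. Lp_pow (lebesgue_on \<Omega>) p (\<lambda>x. v1 n x - u x)) \<longlonglongrightarrow> 0"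
    "(\<lambda>n. Lp_pow (lebesgue_on \<Omega>) p (\<lambda>x. v1' n x - g x)) \<longlonglongrightarrow> 0"
    using C1_approx_seq[OF u] by blast
  note v1m = C1_fun_mem_Lp[OF \<Omega> p0(1) v1(1)]
  obtain r :: "nat \<Rightarrow> nat" where r: "strict_mono r" "AE x in lebesgue_on \<Omega>. (\<lambda>n. v1 (r n) x) \<longlonglongrightarrow> u x"
    by (rule Lp_AE_subseq[OF mem_Lp_diff(1)[OF v1m(1) um(1) p0(1)] v1(5) p0(2)])
  define v v' where "v n = v1 (r n)" and "v' n = v1' (r n)" for n
  have v: "C1_fun (v n) (v' n)" for n unfolding v_def v'_def by (rule v1)
  note vm = C1_fun_mem_Lp[OF \<Omega> p0(1) v]
  have [measurable]: "v n \<in> borel_measurable (lebesgue_on \<Omega>)" "v' n \<in> borel_measurable (lebesgue_on \<Omega>)" for n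
    using vm by (auto simp: mem_Lp_def)
  have lim: "(\<lambda>n. Lp_pow (lebesgue_on \<Omega>) p (\<lambda>x. v n x - u x)) \<longlonglongrightarrow> 0"
    "(\<lambda>n. Lp_pow (lebesgue_on \<Omega>) p (\<lambda>x. v' n x - g x)) \<longlonglongrightarrow> 0"
    using LIMSEQ_subseq_LIMSEQ[OF v1(5) r(1)] LIMSEQ_subseq_LIMSEQ[OF v1(6) r(1)]
    by (simp_all add: v_def v'_def o_def)
  have ae: "AE x in lebesgue_on \<Omega>. (\<lambda>n. v n x) \<longlonglongrightarrow> u x" using r(2) by (simp add: v_def)
  note d1 = mem_Lp_diff(1)[OF vm(1) um(1) p0(1)] and d2 = mem_Lp_diff(1)[OF vm(2) um(2) p0(1)]
  have L1: "(\<lambda>n. Lp_pow (lebesgue_on \<Omega>) p (\<lambda>x. S (v n x) - S (u x))) \<longlonglongrightarrow> 0"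
    by (rule Lp_tendsto_bound[OF d1 lim(1) _ _ B p0(1)]) (use lip in auto)
  have L2b: "norm (S' (v n x) *\<^sub>R (v' n x - g x)) \<le> B * norm (v' n x - g x)" for n x
    using S(3) by (simp add: mult_right_mono)
  have L2m: "mem_Lp (lebesgue_on \<Omega>) p (\<lambda>x. S' (v n x) *\<^sub>R (v' n x - g x))" for n
    by (rule Lp_tendsto_bound(1)[OF d2 lim(2) _ L2b B p0(1)]) measurable
  have L2: "(\<lambda>n. Lp_pow (lebesgue_on \<Omega>) p (\<lambda>x. S' (v n x) *\<^sub>R (v' n x - g x))) \<longlonglongrightarrow> 0"
    by (rule Lp_tendsto_bound(2)[OF d2 lim(2) _ L2b B p0(1)]) measurable
  have b2: "norm (S' a *\<^sub>R z - S' b *\<^sub>R z) \<le> 2 * B * norm z" for a b and z :: 'a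
  proof -
    have "\<bar>S' a - S' b\<bar> \<le> 2 * B" using S(3)[of a] S(3)[of b] by linarith
    then show ?thesis by (simp add: scaleR_diff_left[symmetric] mult_right_mono)
  qed
  have L3: "(\<lambda>n. Lp_pow (lebesgue_on \<Omega>) p (\<lambda>x. S' (v n x) *\<^sub>R g x - S' (u x) *\<^sub>R g x)) \<longlonglongrightarrow> 0"
  proof (rule Lp_dominated_convergence[OF _ _ um(2) p0(2), where B = "2 * B"])
    show "AE x in lebesgue_on \<Omega>. (\<lambda>n. S' (v n x) *\<^sub>R g x) \<longlonglongrightarrow> S' (u x) *\<^sub>R g x"
      using ae
    proof eventually_elim
      case (elim x)
      then show ?case using S(2)
        by (intro tendsto_intros isCont_tendsto_compose[of "u x" S']) (auto simp: continuous_on_eq_continuous_at)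
    qed
  qed (use b2 B in auto)
  have L3m: "mem_Lp (lebesgue_on \<Omega>) p (\<lambda>x. S' (v n x) *\<^sub>R g x - S' (u x) *\<^sub>R g x)" for n
    by (rule mem_Lp_bound[OF um(2) _ AE_I2[OF b2]]) (use B p0 in auto)
  \<comment> \<open>The gradient error splits into \<open>S' (v n x)\<close> times the error of
    \<open>v' n\<close>, with limit 0, and the change of the factor \<open>S'\<close> in front of
    the fixed function \<open>g\<close>.\<close>
  have "(\<lambda>n. Lp_pow (lebesgue_on \<Omega>) p (\<lambda>x. (S' (v n x) *\<^sub>R (v' n x - g x) + S' (v n x) *\<^sub>R g x) - (0 + S' (u x) *\<^sub>R g x))) \<longlonglongrightarrow> 0"
    by (rule Lp_tendsto_add) (use L2 L2m L3 L3m p0 in auto)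
  then have L4: "(\<lambda>n. Lp_pow (lebesgue_on \<Omega>) p (\<lambda>x. S' (v n x) *\<^sub>R v' n x - S' (u x) *\<^sub>R g x)) \<longlonglongrightarrow> 0"
    by (simp add: scaleR_diff_right)
  show ?thesis
  proof (rule C1_approx_limit[OF \<Omega> p0(1) _ _ _ L1 L4])
    show "C1_approx \<Omega> p 0 (\<lambda>x. S (v n x)) (\<lambda>x. S' (v n x) *\<^sub>R v' n x)" for n
    proof (rule C1_approx_C1[OF \<Omega> p0(1) C1_fun_compose[OF v S(1,2)]])
      show "compact (K1 (r n))" "K1 (r n) \<subseteq> \<Omega>" using v1 by auto
      show "\<bar>S (v n x)\<bar> \<le> 0" if "x \<notin> K1 (r n)" for x
        using S(4) v1(4)[OF that] by (simp add: v_def)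
    qed
    show "mem_Lp (lebesgue_on \<Omega>) p (\<lambda>x. S' (u x) *\<^sub>R g x)"
      by (rule mem_Lp_bound[OF um(2), where B = B]) (use B p0 S(3) in \<open>auto intro!: AE_I2 mult_right_mono\<close>)
    have "mem_Lp (lebesgue_on \<Omega>) p (\<lambda>x. S (u x) - S 0)"
      by (rule mem_Lp_bound[OF um(1), where B = B]) (use B p0 lip[of _ 0] in auto)
    from mem_Lp_add(1)[OF this mem_Lp_const[OF fin, of p "S 0"] p0(1)]
    show "mem_Lp (lebesgue_on \<Omega>) p (\<lambda>x. S (u x))" by simp
  qed
qed

text \<open>The chain rule is applied to \<open>sqrt (a\<^sup>2 + d\<^sup>2) - d\<close> with
  \<open>a\<close> the positive part of \<open>r - t\<close>. It differs from \<open>a\<close> by at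
  most \<open>d\<close>, its derivative lies between 0 and 1, and it vanishes on
  \<open>[- C, C]\<close> because \<open>C \<le> t\<close>. The derivative at \<open>r = t\<close>
  is 0 for every \<open>d\<close>, so the limiting gradient lives on the strict superlevel
  set.\<close>

lemma C1_approx_pos_part:
  assumes \<Omega>: "open \<Omega>" "bounded \<Omega>" and p: "1 \<le> p" and u: "C1_approx \<Omega> p C u g" and t: "C \<le> t"
  shows "C1_approx \<Omega> p 0 (\<lambda>x. max 0 (u x - t)) (\<lambda>x. if t < u x then g x else 0)"
proof -
  have p0: "0 \<le> p" "0 < p" using p by auto
  note um = C1_approx_mem[OF u]
  have [measurable]: "u \<in> borel_measurable (lebesgue_on \<Omega>)" "g \<in> borel_measurable (lebesgue_on \<Omega>)"
    using um by (auto simp: mem_Lp_def)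
  define d where "d m = inverse (real (Suc m))" for m
  have d: "0 < d m" "d m \<le> 1" for m by (auto simp: d_def divide_simps)
  have dlim: "d \<longlonglongrightarrow> 0" unfolding d_def by (rule LIMSEQ_inverse_real_of_nat)
  define S where "S m r = sqrt ((max 0 (r - t))\<^sup>2 + (d m)\<^sup>2) - d m" for m r
  define S' where "S' m r = max 0 (r - t) / sqrt ((max 0 (r - t))\<^sup>2 + (d m)\<^sup>2)" for m r
  have pos: "0 < (max 0 (r - t))\<^sup>2 + (d m)\<^sup>2" for m r
    using d(1)[of m] by (intro add_nonneg_pos) auto
  have deriv: "(S m has_real_derivative S' m r) (at r)" for m r
  proof -
    have 1: "((\<lambda>r. (max 0 (r - t))\<^sup>2) has_real_derivative 2 * max 0 (r - t)) (at r)"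
    proof -
      have "((\<lambda>r. r - t) has_real_derivative 1) (at r)" by (auto intro!: derivative_eq_intros)
      from DERIV_chain2[OF DERIV_max0_square this] show ?thesis by simp
    qed
    have "((\<lambda>r. (max 0 (r - t))\<^sup>2 + (d m)\<^sup>2) has_real_derivative 2 * max 0 (r - t)) (at r)"
      using DERIV_add[OF 1 DERIV_const[of "(d m)\<^sup>2"]] by simp
    from DERIV_chain2[OF DERIV_real_sqrt[OF pos] this]
    have "((\<lambda>r. sqrt ((max 0 (r - t))\<^sup>2 + (d m)\<^sup>2)) has_real_derivative
        inverse (sqrt ((max 0 (r - t))\<^sup>2 + (d m)\<^sup>2)) / 2 * (2 * max 0 (r - t))) (at r)" .
    from DERIV_diff[OF this DERIV_const[of "d m"]] show ?thesis
      unfolding S_def[abs_def] S'_def by (simp add: field_simps)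
  qed
  have cont: "continuous_on UNIV (S' m)" for m
    unfolding S'_def using pos[of _ m] by (intro continuous_intros) (metis less_irrefl real_sqrt_eq_zero_cancel_iff)
  have bound: "\<bar>S' m r\<bar> \<le> 1" for m r
  proof -
    have "max 0 (r - t) \<le> sqrt ((max 0 (r - t))\<^sup>2 + (d m)\<^sup>2)"
      by (intro real_le_rsqrt) simp
    then show ?thesis unfolding S'_def using pos[of r m] by (simp add: divide_le_eq)
  qed
  have S0: "S m r = 0" if "\<bar>r\<bar> \<le> C" for m r
  proof -
    have "max 0 (r - t) = 0" using that t by auto
    then show ?thesis using d(1)[of m] by (simp add: S_def)
  qed
  have Sb: "\<bar>S m r - max 0 (r - t)\<bar> \<le> d m" for m r
  proof -
    define a where "a = max 0 (r - t)"
    have a: "0 \<le> a" by (simp add: a_def)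
    have "sqrt (a\<^sup>2 + (d m)\<^sup>2) \<le> a + d m" by (rule sqrt_sum_squares_le_sum) (use a d in \<open>auto simp: less_imp_le\<close>)
    moreover have "a \<le> sqrt (a\<^sup>2 + (d m)\<^sup>2)" by (intro real_le_rsqrt) simp
    ultimately show ?thesis using d(1)[of m] by (simp add: S_def a_def[symmetric])
  qed
  have ap: "C1_approx \<Omega> p 0 (\<lambda>x. S m (u x)) (\<lambda>x. S' m (u x) *\<^sub>R g x)" for m
    by (rule C1_approx_compose[OF \<Omega> p u deriv cont bound S0])
  have Slim: "(\<lambda>m. S m r) \<longlonglongrightarrow> max 0 (r - t)" for r
    by (rule Lim_null[THEN iffD2], rule Lim_null_comparison[OF _ dlim]) (use Sb in auto)
  have S'lim: "(\<lambda>m. S' m r) \<longlonglongrightarrow> (if t < r then 1 else 0)" for r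
  proof (cases "t < r")
    case True
    have "(\<lambda>m. max 0 (r - t) / sqrt ((max 0 (r - t))\<^sup>2 + (d m)\<^sup>2)) \<longlonglongrightarrow> max 0 (r - t) / sqrt ((max 0 (r - t))\<^sup>2 + 0\<^sup>2)"
      using True by (intro tendsto_intros dlim) auto
    then show ?thesis using True by (simp add: S'_def)
  next
    case False
    then show ?thesis by (simp add: S'_def)
  qed
  have fin: "\<Omega> \<in> lmeasurable" by (rule open_bounded_lmeasurable[OF \<Omega>])
  have Sm: "S m \<in> borel_measurable borel" "S' m \<in> borel_measurable borel" for m
    unfolding S_def S'_def by measurable
  note [measurable] = Sm
  show ?thesis
  proof (rule C1_approx_limit[OF \<Omega> p0(1) ap])
    show "mem_Lp (lebesgue_on \<Omega>) p (\<lambda>x. max 0 (u x - t))"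
    proof (rule mem_Lp_bound[where B = 1])
      show "mem_Lp (lebesgue_on \<Omega>) p (\<lambda>x. u x - t)"
        by (rule mem_Lp_diff(1)[OF um(1) mem_Lp_const[OF fin] p0(1)])
    qed (use p0 in auto)
    show "mem_Lp (lebesgue_on \<Omega>) p (\<lambda>x. if t < u x then g x else 0)"
      by (rule mem_Lp_bound[OF um(2), where B = 1]) (use p0 in auto)
    show "(\<lambda>m. Lp_pow (lebesgue_on \<Omega>) p (\<lambda>x. S m (u x) - max 0 (u x - t))) \<longlonglongrightarrow> 0"
    proof (rule Lp_dominated_convergence[OF _ _ mem_Lp_const[OF fin, of p "1::real"] p0(2), where B = 1])
      show "AE x in lebesgue_on \<Omega>. norm (S m (u x) - max 0 (u x - t)) \<le> 1 * norm (1::real)" for m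
        using order_trans[OF Sb d(2)] by simp
    qed (use Slim in auto)
    show "(\<lambda>m. Lp_pow (lebesgue_on \<Omega>) p (\<lambda>x. S' m (u x) *\<^sub>R g x - (if t < u x then g x else 0))) \<longlonglongrightarrow> 0"
    proof (rule Lp_dominated_convergence[OF _ _ um(2) p0(2), where B = 2])
      show "AE x in lebesgue_on \<Omega>. norm (S' m (u x) *\<^sub>R g x - (if t < u x then g x else 0)) \<le> 2 * norm (g x)" for m
      proof (rule AE_I2)
        fix x
        have "norm (S' m (u x) *\<^sub>R g x) \<le> norm (g x)"
          using bound[of m "u x"] by (simp add: mult_left_le_one_le)
        moreover have "norm (if t < u x then g x else 0) \<le> norm (g x)" by simp
        ultimately show "norm (S' m (u x) *\<^sub>R g x - (if t < u x then g x else 0)) \<le> 2 * norm (g x)"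
          using norm_triangle_ineq4[of "S' m (u x) *\<^sub>R g x" "if t < u x then g x else 0"] by linarith
      qed
      show "AE x in lebesgue_on \<Omega>. (\<lambda>m. S' m (u x) *\<^sub>R g x) \<longlonglongrightarrow> (if t < u x then g x else 0)"
      proof (rule AE_I2)
        fix x
        have "(\<lambda>m. S' m (u x) *\<^sub>R g x) \<longlonglongrightarrow> (if t < u x then 1 else 0) *\<^sub>R g x"
          by (intro tendsto_intros S'lim)
        then show "(\<lambda>m. S' m (u x) *\<^sub>R g x) \<longlonglongrightarrow> (if t < u x then g x else 0)" by (auto split: if_splits)
      qed
    qed auto
  qed
qed

text \<open>The difference of the positive parts at the two levels. Strictness in both gradients
  makes the band open below and closed above, so adjacent bands are disjoint without gaps.\<close>

lemma C1_approx_band: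
  assumes \<Omega>: "open \<Omega>" "bounded \<Omega>" and p: "1 \<le> p" and u: "C1_approx \<Omega> p C u g" and s: "C \<le> s" "s \<le> t"
  shows "C1_approx \<Omega> p 0 (\<lambda>x. max 0 (min (u x - s) (t - s))) (\<lambda>x. if s < u x \<and> u x \<le> t then g x else 0)"
proof -
  have p0: "0 \<le> p" using p by simp
  have t: "C \<le> t" using s by simp
  have "(\<lambda>x. max 0 (min (u x - s) (t - s))) = (\<lambda>x. max 0 (u x - s) - max 0 (u x - t))"
    using s by (auto simp: fun_eq_iff max_def min_def)
  moreover have "(\<lambda>x. if s < u x \<and> u x \<le> t then g x else 0)
      = (\<lambda>x. (if s < u x then g x else 0) - (if t < u x then g x else 0))"
    using s by (auto simp: fun_eq_iff)
  ultimately show ?thesis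
    using C1_approx_diff[OF \<Omega> p0 C1_approx_pos_part[OF \<Omega> p u s(1)] C1_approx_pos_part[OF \<Omega> p u t]] by simp
qed

text \<open>The identity passes from compactly supported C1 functions to their limits. Applied to
  bands, it is what eliminates the subgradients.\<close>

lemma C1_approx_integral_gradient_eq_0:
  assumes \<Omega>: "open \<Omega>" "bounded \<Omega>" and p: "1 \<le> p" and w: "C1_approx \<Omega> p 0 w g"
  shows "(\<integral>x. g x \<partial>lebesgue_on \<Omega>) = 0"
proof -
  have p0: "0 \<le> p" using p by simp
  interpret finite_measure "lebesgue_on \<Omega>"
    by (rule finite_measure_lebesgue_on[OF open_bounded_lmeasurable[OF \<Omega>]])
  obtain v v' K where v: "\<And>n::nat. C1_fun (v n) (v' n)" "\<And>n. compact (K n)" "\<And>n. K n \<subseteq> \<Omega>"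
    "\<And>n x. x \<notin> K n \<Longrightarrow> \<bar>v n x\<bar> \<le> 0"
    "(\<lambda>n. Lp_pow (lebesgue_on \<Omega>) p (\<lambda>x. v n x - w x)) \<longlonglongrightarrow> 0"
    "(\<lambda>n. Lp_pow (lebesgue_on \<Omega>) p (\<lambda>x. v' n x - g x)) \<longlonglongrightarrow> 0"
    using C1_approx_seq[OF w] by blast
  note vm = C1_fun_mem_Lp[OF \<Omega> p0 v(1)] and wm = C1_approx_mem[OF w]
  have "(\<lambda>n. \<integral>x. v' n x \<partial>lebesgue_on \<Omega>) \<longlonglongrightarrow> (\<integral>x. g x \<partial>lebesgue_on \<Omega>)"
    by (rule integral_tendsto_of_Lp[OF mem_Lp_diff(1)[OF vm(2) wm(2) p0] p v(6), where B = 1])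
      (auto intro!: mem_Lp_imp_integrable(1)[OF _ p] vm wm)
  moreover have "(\<integral>x. v' n x \<partial>lebesgue_on \<Omega>) = 0" for n
    by (rule C1_integral_gradient_eq_0_on[OF \<Omega>(1) v(1)[of n] v(2)[of n] v(3)[of n]]) (use v(4) in auto)
  ultimately show ?thesis by (simp add: LIMSEQ_const_iff)
qed

section \<open>Translation estimates for functions with zero boundary values\<close>

lemma integral_lebesgue_on_lborel:
  fixes f :: "'a::euclidean_space \<Rightarrow> 'b::euclidean_space"
  assumes \<Omega>: "\<Omega> \<in> sets lebesgue" and f: "f \<in> borel_measurable borel" "\<And>x. x \<notin> \<Omega> \<Longrightarrow> f x = 0"
  shows "integrable (lebesgue_on \<Omega>) f \<longleftrightarrow> integrable lborel f"
    "(\<integral>x. f x \<partial>lebesgue_on \<Omega>) = (\<integral>x. f x \<partial>lborel)"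
  using integral_lebesgue_on_support[OF \<Omega> f(2)] f(1) by (simp_all add: integrable_completion integral_completion)

text \<open>Translates leave \<Omega>, so the estimate is made on the whole space for a Borel
  representative \<open>w0\<close> extended by zero. It follows from
  \<open>C1_translation_L1\<close> for compactly supported approximants.\<close>

lemma C1_approx_translation_L1:
  assumes \<Omega>: "open \<Omega>" "bounded \<Omega>" and p: "1 \<le> p" and w: "C1_approx \<Omega> p 0 w g"
    and w0: "w0 \<in> borel_measurable borel" "\<And>x. x \<notin> \<Omega> \<Longrightarrow> w0 x = 0" "AE x in lebesgue_on \<Omega>. w x = w0 x"
  shows "integrable lborel w0"
    "(\<integral>x. \<bar>w0 (x + h) - w0 x\<bar> \<partial>lborel) \<le> norm h * (\<integral>x. norm (g x) \<partial>lebesgue_on \<Omega>)"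
proof -
  have p0: "0 \<le> p" using p by simp
  have \<Omega>l: "\<Omega> \<in> sets lebesgue" by (rule open_sets_lebesgue[OF \<Omega>(1)])
  interpret finite_measure "lebesgue_on \<Omega>"
    by (rule finite_measure_lebesgue_on[OF open_bounded_lmeasurable[OF \<Omega>]])
  obtain v v' K where v: "\<And>n::nat. C1_fun (v n) (v' n)" "\<And>n. compact (K n)" "\<And>n. K n \<subseteq> \<Omega>"
    "\<And>n x. x \<notin> K n \<Longrightarrow> \<bar>v n x\<bar> \<le> 0"
    "(\<lambda>n. Lp_pow (lebesgue_on \<Omega>) p (\<lambda>x. v n x - w x)) \<longlonglongrightarrow> 0"
    "(\<lambda>n. Lp_pow (lebesgue_on \<Omega>) p (\<lambda>x. v' n x - g x)) \<longlonglongrightarrow> 0"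
    using C1_approx_seq[OF w] by blast
  have v0: "x \<notin> K n \<Longrightarrow> v n x = 0" for n x using v(4)[of x n] by simp
  have v'0: "x \<notin> K n \<Longrightarrow> v' n x = 0" for n x
    using C1_fun_support_deriv[OF v(1) compact_imp_closed[OF v(2)] v0] .
  have off: "v n x = 0" "v' n x = 0" if "x \<notin> \<Omega>" for n x
    using that v0 v'0 v(3) by blast+
  note vm = C1_fun_mem_Lp[OF \<Omega> p0 v(1)] and wm = C1_approx_mem[OF w]
  note d1 = mem_Lp_diff(1)[OF vm(1) wm(1) p0] and d2 = mem_Lp_diff(1)[OF vm(2) wm(2) p0]
  have w0m: "w0 \<in> borel_measurable (lebesgue_on \<Omega>)"
    using w0(1) by (intro measurable_restrict_space1 measurable_completion) simp
  have wmeas: "w \<in> borel_measurable (lebesgue_on \<Omega>)" using wm by (simp add: mem_Lp_def)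
  have "integrable (lebesgue_on \<Omega>) w" by (rule mem_Lp_imp_integrable(1)[OF wm(1) p])
  then have "integrable (lebesgue_on \<Omega>) w0"
    by (rule integrable_cong_AE_imp[OF _ w0m]) (use w0(3) in auto)
  then show iw0: "integrable lborel w0" using integral_lebesgue_on_lborel(1)[OF \<Omega>l w0(1,2)] by blast
  have iv: "integrable lborel (v n)" for n
    by (rule continuous_compact_support_integrable[OF C1_fun_continuous[OF v(1)] v(2) v0])
  define e where "e n = (\<integral>x. \<bar>v n x - w0 x\<bar> \<partial>lborel)" for n
  define e' where "e' n = (\<integral>x. norm (v' n x - g x) \<partial>lebesgue_on \<Omega>)" for n
  have "e n = (\<integral>x. norm (v n x - w x) \<partial>lebesgue_on \<Omega>)" for n
  proof -
    have "e n = (\<integral>x. \<bar>v n x - w0 x\<bar> \<partial>lebesgue_on \<Omega>)"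
      unfolding e_def
      by (rule integral_lebesgue_on_lborel(2)[OF \<Omega>l, symmetric])
        (use w0 C1_fun_borel(1)[OF v(1)] off in auto)
    also have "\<dots> = (\<integral>x. norm (v n x - w x) \<partial>lebesgue_on \<Omega>)"
    proof (rule integral_cong_AE)
      have "v n \<in> borel_measurable (lebesgue_on \<Omega>)" using vm(1)[of n] by (simp add: mem_Lp_def)
      with w0m wmeas show "(\<lambda>x. \<bar>v n x - w0 x\<bar>) \<in> borel_measurable (lebesgue_on \<Omega>)"
        "(\<lambda>x. norm (v n x - w x)) \<in> borel_measurable (lebesgue_on \<Omega>)" by measurable
    qed (use w0(3) in auto)
    finally show ?thesis .
  qed
  then have "e = (\<lambda>n. \<integral>x. norm (v n x - w x) \<partial>lebesgue_on \<Omega>)" by (rule ext)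
  then have elim: "e \<longlonglongrightarrow> 0" using L1_tendsto_of_Lp[OF d1 p v(5)] by (simp only:)
  have e'lim: "e' \<longlonglongrightarrow> 0" unfolding e'_def using L1_tendsto_of_Lp[OF d2 p v(6)] by simp
  define G where "G = (\<integral>x. norm (g x) \<partial>lebesgue_on \<Omega>)"
  \<comment> \<open>The approximation error \<open>e n\<close> enters twice, at \<open>x + h\<close>
    and at \<open>x\<close>; translation invariance makes both contributions equal.\<close>
  have "(\<integral>x. \<bar>w0 (x + h) - w0 x\<bar> \<partial>lborel) \<le> e n + norm h * (G + e' n) + e n" for n
  proof -
    note vb = C1_fun_borel(1)[OF v(1)[of n]]
    have i1: "integrable lborel (\<lambda>x. \<bar>v n x - w0 x\<bar>)" using iv iw0 by auto
    have i2: "integrable lborel (\<lambda>x. \<bar>v n (x + h) - w0 (x + h)\<bar>)"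
      using integrable_translation[of "\<lambda>x. \<bar>v n x - w0 x\<bar>" h] i1 vb w0(1) by simp
    have iv2: "integrable lborel (\<lambda>x. v n (x + h))" "integrable lborel (\<lambda>x. w0 (x + h))"
      using integrable_translation[OF vb, of h] integrable_translation[OF w0(1), of h] iv iw0 by auto
    have i3: "integrable lborel (\<lambda>x. \<bar>v n (x + h) - v n x\<bar>)" using iv2(1) iv by auto
    have "(\<integral>x. \<bar>w0 (x + h) - w0 x\<bar> \<partial>lborel)
       \<le> (\<integral>x. \<bar>v n (x + h) - w0 (x + h)\<bar> + \<bar>v n (x + h) - v n x\<bar> + \<bar>v n x - w0 x\<bar> \<partial>lborel)"
      by (rule integral_mono) (use i1 i2 i3 iv2 iw0 in auto)
    also have "\<dots> = (\<integral>x. \<bar>v n (x + h) - w0 (x + h)\<bar> \<partial>lborel) + (\<integral>x. \<bar>v n (x + h) - v n x\<bar> \<partial>lborel) + e n"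
      unfolding e_def using i1 i2 i3 by simp
    also have "(\<integral>x. \<bar>v n (x + h) - w0 (x + h)\<bar> \<partial>lborel) = e n"
      unfolding e_def using integral_translation[of "\<lambda>x. \<bar>v n x - w0 x\<bar>" h] vb w0(1) by simp
    also have "(\<integral>x. \<bar>v n (x + h) - v n x\<bar> \<partial>lborel) \<le> norm h * (\<integral>x. norm (v' n x) \<partial>lborel)"
      by (rule C1_translation_L1[OF v(1,2) v0])
    also have "(\<integral>x. norm (v' n x) \<partial>lborel) = (\<integral>x. norm (v' n x) \<partial>lebesgue_on \<Omega>)"
      by (rule integral_lebesgue_on_lborel(2)[OF \<Omega>l, symmetric])
        (use C1_fun_borel(2)[OF v(1)] off in auto)
    also have "\<dots> \<le> (\<integral>x. norm (g x) + norm (v' n x - g x) \<partial>lebesgue_on \<Omega>)"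
    proof (rule integral_mono)
      show "integrable (lebesgue_on \<Omega>) (\<lambda>x. norm (v' n x))"
        by (intro integrable_norm mem_Lp_imp_integrable(1)[OF vm(2) p])
      show "integrable (lebesgue_on \<Omega>) (\<lambda>x. norm (g x) + norm (v' n x - g x))"
        by (intro Bochner_Integration.integrable_add integrable_norm mem_Lp_imp_integrable(1)[OF _ p] wm d2)
      show "norm (v' n x) \<le> norm (g x) + norm (v' n x - g x)" for x by norm
    qed
    also have "\<dots> = G + e' n"
      unfolding G_def e'_def
      by (intro Bochner_Integration.integral_add integrable_norm mem_Lp_imp_integrable(1)[OF _ p] wm d2)
    finally show ?thesis by (simp add: mult_left_mono)
  qed
  moreover have "(\<lambda>n. e n + norm h * (G + e' n) + e n) \<longlonglongrightarrow> 0 + norm h * (G + 0) + 0"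
    by (intro tendsto_intros elim e'lim)
  ultimately show "(\<integral>x. \<bar>w0 (x + h) - w0 x\<bar> \<partial>lborel) \<le> norm h * (\<integral>x. norm (g x) \<partial>lebesgue_on \<Omega>)"
    unfolding G_def by (intro LIMSEQ_le_const[of _ _]) auto
qed

section \<open>A Sobolev inequality\<close>

text \<open>Averaging \<open>\<bar>w (x + h) - w x\<bar>\<close> over a ball of \<open>h\<close> whose volume is twice that of the
  support of \<open>w\<close>: the average of \<open>w (x + h)\<close> is then at most \<open>\<tau> / 2\<close>.\<close>

lemma superlevel_averaging:
  fixes w :: "'a::euclidean_space \<Rightarrow> real"
  assumes w[measurable]: "w \<in> borel_measurable borel" and b: "\<And>x. 0 \<le> w x" "\<And>x. w x \<le> \<tau>" and \<tau>: "0 < \<tau>"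
    and i: "integrable lborel w"
    and tr: "\<And>h. (\<integral>x. \<bar>w (x + h) - w x\<bar> \<partial>lborel) \<le> norm h * G" and G: "0 \<le> G"
    and fin: "emeasure lborel {x. 0 < w x} < \<infinity>"
  shows "\<tau> * measure lborel {x. w x = \<tau>} \<le>
    2 * ((2 * measure lborel {x. 0 < w x} / measure lborel (ball (0::'a) 1)) powr (1 / DIM('a)) * G)"
proof -
  define E where "E = {x. w x = \<tau>}"
  define F where "F = {x. 0 < w x}"
  define mE where "mE = measure lborel E"
  define mF where "mF = measure lborel F"
  define \<omega> where "\<omega> = measure lborel (ball (0::'a) 1)"
  have \<omega>: "0 < \<omega>" by (simp add: \<omega>_def content_ball_pos)
  have [measurable]: "E \<in> sets borel" "F \<in> sets borel" unfolding E_def F_def by measurable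
  have EF: "E \<subseteq> F" using \<tau> by (auto simp: E_def F_def)
  have finF: "emeasure lborel F < \<infinity>" using fin by (simp add: F_def)
  have finE: "emeasure lborel E < \<infinity>" using emeasure_mono[OF EF, of lborel] finF by (simp add: less_le_trans)
  have eE: "emeasure lborel E = ennreal mE" unfolding mE_def using finE by (intro emeasure_eq_ennreal_measure) auto
  have mEF: "mE \<le> mF" unfolding mE_def mF_def using EF finF by (intro measure_mono_fmeasurable) (auto simp: fmeasurable_def)
  have mE0: "0 \<le> mE" "0 \<le> mF" by (auto simp: mE_def mF_def)
  have iE: "integrable lborel (indicator E :: 'a \<Rightarrow> real)" and iF: "integrable lborel (indicator F :: 'a \<Rightarrow> real)"
    using finE finF by auto
  have "\<tau> * mE \<le> 2 * ((2 * mF / \<omega>) powr (1 / DIM('a)) * G)"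
  proof (cases "mF = 0")
    case True
    then show ?thesis using mEF mE0 G by simp
  next
    case False
    then have mF: "0 < mF" using mE0 by simp
    define r where "r = (2 * mF / \<omega>) powr (1 / DIM('a))"
    have r: "0 < r" using mF \<omega> by (simp add: r_def)
    have "measure lborel (ball (0::'a) r) = r ^ DIM('a) * \<omega>"
      unfolding \<omega>_def using content_ball_conv_unit_ball[of r "0::'a"] r by simp
    also have "r ^ DIM('a) = 2 * mF / \<omega>"
      using mF \<omega> by (simp add: r_def powr_realpow[symmetric] powr_powr)
    finally have ball: "measure lborel (ball (0::'a) r) = 2 * mF" using \<omega> by simp
    define c where "c = \<tau> * mE - r * G"
    \<comment> \<open>On \<open>E\<close> one has \<open>w x = \<tau>\<close>, hence
      \<open>\<tau> \<le> w (x + h) + \<bar>w (x + h) - w x\<bar>\<close>, and the last term costs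
      at most \<open>r * G\<close> after integration.\<close>
    have A: "c \<le> (\<integral>x. indicator E x * w (x + h) \<partial>lborel)" if h: "norm h < r" for h
    proof -
      have iw: "integrable lborel (\<lambda>x. w (x + h))" using integrable_translation[OF w] i by blast
      have i1: "integrable lborel (\<lambda>x. indicator E x * w (x + h))"
        using integrable_real_mult_indicator[of E lborel "\<lambda>x. w (x + h)"] iw by (simp add: mult.commute)
      have i2: "integrable lborel (\<lambda>x. \<bar>w (x + h) - w x\<bar>)" using iw i by auto
      have "\<tau> * mE = (\<integral>x. \<tau> * indicator E x \<partial>lborel)" using iE by (simp add: mE_def)
      also have "\<dots> \<le> (\<integral>x. indicator E x * w (x + h) + \<bar>w (x + h) - w x\<bar> \<partial>lborel)"
      proof (rule integral_mono)
        show "\<tau> * indicator E x \<le> indicator E x * w (x + h) + \<bar>w (x + h) - w x\<bar>" for x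
          by (cases "x \<in> E") (auto simp: E_def)
      qed (use iE i1 i2 in simp_all)
      also have "\<dots> = (\<integral>x. indicator E x * w (x + h) \<partial>lborel) + (\<integral>x. \<bar>w (x + h) - w x\<bar> \<partial>lborel)"
        using i1 i2 by simp
      also have "(\<integral>x. \<bar>w (x + h) - w x\<bar> \<partial>lborel) \<le> r * G"
        using tr[of h] mult_right_mono[OF less_imp_le[OF h] G] by linarith
      finally show ?thesis by (simp add: c_def)
    qed
    have iw: "(\<integral>x. w x \<partial>lborel) \<le> \<tau> * mF"
    proof -
      have "(\<integral>x. w x \<partial>lborel) \<le> (\<integral>x. \<tau> * indicator F x \<partial>lborel)"
      proof (rule integral_mono[OF i])
        show "w x \<le> \<tau> * indicator F x" for x
          using b[of x] by (auto simp: F_def indicator_def)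
      qed (use iF in simp)
      also have "\<dots> = \<tau> * mF" using iF by (simp add: mF_def)
      finally show ?thesis .
    qed
    \<comment> \<open>The bound \<open>A\<close> is integrated over the ball of \<open>h\<close>,
      and Tonelli's theorem turns the right-hand side into \<open>mE\<close> times the integral of
      \<open>w\<close>. A negative \<open>c\<close> is truncated to 0 in \<open>ennreal\<close>; the
      real inequality drawn from this is then trivial. Dividing by \<open>mF\<close> leaves
      \<open>2 * c \<le> \<tau> * mE\<close>, where half of \<open>2 * \<tau> * mE\<close> is
      absorbed.\<close>
    have "ennreal c * ennreal (2 * mF) \<le> ennreal (\<tau> * mF * mE)"
    proof -
      have "ennreal c * ennreal (2 * mF) = (\<integral>\<^sup>+h. ennreal c * indicator (ball (0::'a) r) h \<partial>lborel)"
      proof -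
        have "emeasure lborel (ball (0::'a) r) = ennreal (2 * mF)"
          unfolding ball[symmetric] using emeasure_lborel_ball_finite[of "0::'a" r]
          by (intro emeasure_eq_ennreal_measure) auto
        then show ?thesis by (subst nn_integral_cmult_indicator) auto
      qed
      also have "\<dots> \<le> (\<integral>\<^sup>+h. (\<integral>\<^sup>+x. indicator E x * ennreal (w (x + h)) \<partial>lborel) \<partial>lborel)"
      proof (rule nn_integral_mono)
        fix h :: 'a
        show "ennreal c * indicator (ball 0 r) h \<le> (\<integral>\<^sup>+x. indicator E x * ennreal (w (x + h)) \<partial>lborel)"
        proof (cases "h \<in> ball 0 r")
          case True
          have iw: "integrable lborel (\<lambda>x. w (x + h))" using integrable_translation[OF w] i by blast
          have "ennreal c \<le> ennreal (\<integral>x. indicator E x * w (x + h) \<partial>lborel)"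
            using A[of h] True by (intro ennreal_leI) simp
          also have "\<dots> = (\<integral>\<^sup>+x. ennreal (indicator E x * w (x + h)) \<partial>lborel)"
            using integrable_real_mult_indicator[of E lborel "\<lambda>x. w (x + h)"] iw b
            by (intro nn_integral_eq_integral[symmetric]) (auto simp: mult.commute)
          also have "\<dots> = (\<integral>\<^sup>+x. indicator E x * ennreal (w (x + h)) \<partial>lborel)"
            by (intro nn_integral_cong) (auto simp: indicator_def)
          finally show ?thesis using True by simp
        qed simp
      qed
      also have "\<dots> = (\<integral>\<^sup>+x. (\<integral>\<^sup>+h. indicator E x * ennreal (w (x + h)) \<partial>lborel) \<partial>lborel)"
        by (rule lborel_pair.Fubini') measurable
      also have "\<dots> = (\<integral>\<^sup>+x. ennreal (\<integral>x. w x \<partial>lborel) * indicator E x \<partial>lborel)"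
      proof (rule nn_integral_cong)
        fix x :: 'a
        have "(\<integral>\<^sup>+h. indicator E x * ennreal (w (x + h)) \<partial>lborel) = indicator E x * (\<integral>\<^sup>+h. ennreal (w (h + x)) \<partial>lborel)"
          by (subst nn_integral_cmult) (auto simp: add.commute)
        also have "(\<integral>\<^sup>+h. ennreal (w (h + x)) \<partial>lborel) = (\<integral>\<^sup>+h. ennreal (w h) \<partial>lborel)"
          by (rule nn_integral_translation) measurable
        also have "\<dots> = ennreal (\<integral>x. w x \<partial>lborel)"
          by (rule nn_integral_eq_integral) (use i b in auto)
        finally show "(\<integral>\<^sup>+h. indicator E x * ennreal (w (x + h)) \<partial>lborel) = ennreal (\<integral>x. w x \<partial>lborel) * indicator E x"
          by (simp add: mult.commute)
      qed
      also have "\<dots> = ennreal (\<integral>x. w x \<partial>lborel) * ennreal mE"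
        by (simp add: nn_integral_cmult eE)
      also have "\<dots> \<le> ennreal (\<tau> * mF) * ennreal mE"
        using iw by (intro mult_right_mono ennreal_leI) auto
      also have "\<dots> = ennreal (\<tau> * mF * mE)" using \<tau> mF mE0 by (simp add: ennreal_mult'')
      finally show ?thesis .
    qed
    then have "c * (2 * mF) \<le> \<tau> * mF * mE"
      using mF \<tau> mE0 by (cases "0 \<le> c") (auto simp: ennreal_mult[symmetric] mult_nonpos_nonneg intro: order_trans[of _ 0])
    then have "2 * c \<le> \<tau> * mE" using mF by (simp add: mult.commute mult.left_commute)
    then show ?thesis by (simp add: c_def r_def)
  qed
  then show ?thesis by (simp add: mE_def mF_def E_def F_def \<omega>_def)
qed

definition level_measure :: "'a::euclidean_space set \<Rightarrow> ('a \<Rightarrow> real) \<Rightarrow> real \<Rightarrow> real" where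
  "level_measure \<Omega> u t = measure (lebesgue_on \<Omega>) {x \<in> \<Omega>. t < u x}"

text \<open>A weak Sobolev inequality between two levels: \<open>superlevel_averaging\<close> for
  \<open>u\<close> truncated to the band, a function that equals \<open>t - s\<close> where
  \<open>u > t\<close> and is positive only where \<open>u > s\<close>.\<close>

lemma level_measure_band:
  fixes u :: "'a::euclidean_space \<Rightarrow> real"
  assumes \<Omega>: "open \<Omega>" "bounded \<Omega>" and p: "1 \<le> p" and u: "C1_approx \<Omega> p C u g" and s: "C \<le> s" "s < t"
  shows "(t - s) * level_measure \<Omega> u t \<le>
    2 * ((2 * level_measure \<Omega> u s / measure lborel (ball (0::'a) 1)) powr (1 / DIM('a))
      * (\<integral>x. indicator {x \<in> \<Omega>. s < u x \<and> u x \<le> t} x * norm (g x) \<partial>lebesgue_on \<Omega>))"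
proof -
  define \<tau> where "\<tau> = t - s"
  have \<tau>: "0 < \<tau>" using s by (simp add: \<tau>_def)
  define w where "w x = max 0 (min (u x - s) \<tau>)" for x
  define gb where "gb x = (if s < u x \<and> u x \<le> t then g x else 0)" for x
  have ap: "C1_approx \<Omega> p 0 w gb"
    unfolding w_def gb_def \<tau>_def by (rule C1_approx_band[OF \<Omega> p u]) (use s in auto)
  have fin: "\<Omega> \<in> lmeasurable" by (rule open_bounded_lmeasurable[OF \<Omega>])
  have \<Omega>l: "\<Omega> \<in> sets lebesgue" by (rule open_sets_lebesgue[OF \<Omega>(1)])
  interpret finite_measure "lebesgue_on \<Omega>" by (rule finite_measure_lebesgue_on[OF fin])
  have um[measurable]: "u \<in> borel_measurable (lebesgue_on \<Omega>)" using C1_approx_mem[OF u] by (simp add: mem_Lp_def)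
  have wm: "w \<in> borel_measurable (lebesgue_on \<Omega>)" using C1_approx_mem[OF ap] by (simp add: mem_Lp_def)
  obtain w1 where w1[measurable]: "w1 \<in> borel_measurable borel" "AE x in lebesgue. (if x \<in> \<Omega> then w x else 0) = w1 x"
    using borel_representative[OF borel_measurable_if_I[OF wm \<Omega>l]] by blast
  \<comment> \<open>The Borel representative is clipped again and set to zero outside \<Omega>, so
    that the required bounds hold at every point.\<close>
  define w0 where "w0 x = (if x \<in> \<Omega> then max 0 (min (w1 x) \<tau>) else 0)" for x
  have [measurable]: "\<Omega> \<in> sets borel" using \<Omega>(1) by simp
  have w0[measurable]: "w0 \<in> borel_measurable borel" unfolding w0_def by measurable
  have eq: "AE x in lebesgue_on \<Omega>. w x = w0 x"
  proof -
    have "AE x in lebesgue. x \<in> \<Omega> \<longrightarrow> w x = w0 x"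
      using w1(2)
    proof eventually_elim
      case (elim x)
      have "0 \<le> w x" "w x \<le> \<tau>" using \<tau> by (auto simp: w_def)
      then show ?case using elim by (auto simp: w0_def)
    qed
    then show ?thesis using \<Omega>l by (simp add: AE_restrict_space_iff)
  qed
  have off: "w0 x = 0" if "x \<notin> \<Omega>" for x using that by (simp add: w0_def)
  note tr = C1_approx_translation_L1[OF \<Omega> p ap w0 off eq]
  define G where "G = (\<integral>x. norm (gb x) \<partial>lebesgue_on \<Omega>)"
  have G: "0 \<le> G" unfolding G_def by (rule Bochner_Integration.integral_nonneg) simp
  have meas: "measure lborel A = measure (lebesgue_on \<Omega>) A" if "A \<in> sets borel" "A \<subseteq> \<Omega>" for A
    using that \<Omega>l by (simp add: measure_restrict_space)
  have F\<Omega>: "{x. 0 < w0 x} \<subseteq> \<Omega>" and E\<Omega>: "{x. w0 x = \<tau>} \<subseteq> \<Omega>" using off \<tau> by force+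
  have lsets: "A \<in> sets (lebesgue_on \<Omega>)" if "A \<in> sets borel" "A \<subseteq> \<Omega>" for A
    using that \<Omega>l by (auto simp: sets_restrict_space_iff)
  have Fb: "{x. 0 < w0 x} \<in> sets borel" and Eb: "{x. w0 x = \<tau>} \<in> sets borel" by measurable
  have uset: "{x \<in> \<Omega>. c < u x} \<in> sets (lebesgue_on \<Omega>)" for c
    using measurable_sets[OF um, of "{c<..}"] by (simp add: vimage_def Int_def conj_commute)
  have finF: "emeasure lborel {x. 0 < w0 x} < \<infinity>"
  proof -
    have "emeasure lborel {x. 0 < w0 x} \<le> emeasure lborel \<Omega>" by (rule emeasure_mono[OF F\<Omega>]) simp
    also have "\<dots> < \<infinity>" using fin by (simp add: fmeasurable_def)
    finally show ?thesis .
  qed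
  have main: "\<tau> * measure lborel {x. w0 x = \<tau>} \<le>
    2 * ((2 * measure lborel {x. 0 < w0 x} / measure lborel (ball (0::'a) 1)) powr (1 / DIM('a)) * G)"
    by (rule superlevel_averaging[OF w0 _ _ \<tau> tr(1) tr(2)[folded G_def] G finF]) (use \<tau> in \<open>auto simp: w0_def\<close>)
  have "level_measure \<Omega> u t \<le> measure (lebesgue_on \<Omega>) {x. w0 x = \<tau>}"
    unfolding level_measure_def
  proof (rule finite_measure_mono_AE)
    show "AE x in lebesgue_on \<Omega>. x \<in> {x \<in> \<Omega>. t < u x} \<longrightarrow> x \<in> {x. w0 x = \<tau>}"
      using eq
    proof eventually_elim
      case (elim x)
      show ?case using elim \<tau> by (auto simp: w_def \<tau>_def)
    qed
  qed (rule lsets[OF Eb E\<Omega>])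
  then have 1: "level_measure \<Omega> u t \<le> measure lborel {x. w0 x = \<tau>}" using meas[OF Eb E\<Omega>] by simp
  have "measure (lebesgue_on \<Omega>) {x. 0 < w0 x} \<le> level_measure \<Omega> u s"
    unfolding level_measure_def
  proof (rule finite_measure_mono_AE)
    show "AE x in lebesgue_on \<Omega>. x \<in> {x. 0 < w0 x} \<longrightarrow> x \<in> {x \<in> \<Omega>. s < u x}"
      using eq
    proof eventually_elim
      case (elim x)
      show ?case using elim F\<Omega> \<tau> by (auto simp: w_def)
    qed
  qed (rule uset)
  then have 2: "measure lborel {x. 0 < w0 x} \<le> level_measure \<Omega> u s" using meas[OF Fb F\<Omega>] by simp
  have G': "G = (\<integral>x. indicator {x \<in> \<Omega>. s < u x \<and> u x \<le> t} x * norm (g x) \<partial>lebesgue_on \<Omega>)"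
    unfolding G_def gb_def by (rule Bochner_Integration.integral_cong) (auto simp: indicator_def)
  have "\<tau> * level_measure \<Omega> u t \<le> \<tau> * measure lborel {x. w0 x = \<tau>}"
    using 1 \<tau> by simp
  also note main
  also have "2 * ((2 * measure lborel {x. 0 < w0 x} / measure lborel (ball (0::'a) 1)) powr (1 / DIM('a)) * G)
     \<le> 2 * ((2 * level_measure \<Omega> u s / measure lborel (ball (0::'a) 1)) powr (1 / DIM('a)) * G)"
    using 2 G by (intro mult_left_mono mult_right_mono powr_mono2 divide_right_mono) auto
  finally show ?thesis by (simp add: \<tau>_def G')
qed

section \<open>From the weak to the strong Sobolev estimate by dyadic levels\<close>

lemma summable_of_contraction:
  fixes a b :: "nat \<Rightarrow> real"
  assumes a: "\<And>k. 0 \<le> a k" and b: "\<And>n. (\<Sum>k<n. b k) \<le> D" and step: "\<And>k. a (Suc k) \<le> a k / 2 + b k"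
  shows "summable a"
proof (rule summableI_nonneg_bounded)
  show "(\<Sum>k<n. a k) \<le> 2 * (a 0 + D)" for n
  proof (induction n)
    case 0
    show ?case using a[of 0] b[of 0] by simp
  next
    case (Suc n)
    have "(\<Sum>k<Suc n. a k) = a 0 + (\<Sum>k<n. a (Suc k))" by (rule sum.lessThan_Suc_shift)
    also have "(\<Sum>k<n. a (Suc k)) \<le> (\<Sum>k<n. a k / 2 + b k)" by (intro sum_mono step)
    also have "\<dots> = (\<Sum>k<n. a k) / 2 + (\<Sum>k<n. b k)" by (simp add: sum.distrib sum_divide_distrib)
    finally show ?case using Suc b[of n] by simp
  qed
qed (rule a)

text \<open>A form of Young's inequality, by cases. If \<open>2 * y\<close> is at most
  \<open>x powr (1 / q)\<close>, the product is at most \<open>x / 2\<close>; otherwise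
  \<open>x\<close> itself is at most \<open>(2 * y) powr q\<close>.\<close>

lemma le_half_add_powr:
  fixes x x' y q :: real
  assumes "0 \<le> x" "0 \<le> y" "1 \<le> q" and le: "x' \<le> y * x powr (1 - 1 / q)"
  shows "x' \<le> x / 2 + (2 * y) powr q"
proof (cases "2 * y \<le> x powr (1 / q)")
  case True
  have "x' \<le> (x powr (1 / q) / 2) * x powr (1 - 1 / q)"
    using True by (intro order_trans[OF le] mult_right_mono) auto
  also have "\<dots> = x / 2" using assms(1) by (simp add: powr_add[symmetric])
  finally show ?thesis using powr_ge_zero[of "2 * y" q] by linarith
next
  case False
  have "x = (x powr (1 / q)) powr q" using assms by (simp add: powr_powr)
  also have "\<dots> \<le> (2 * y) powr q" using False assms by (intro powr_mono2) auto
  finally have x: "x \<le> (2 * y) powr q" .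
  have "x' \<le> (2 * y) * ((2 * y) powr q) powr (1 - 1 / q)"
    using assms x by (intro order_trans[OF le] mult_mono powr_mono2) auto
  also have "\<dots> = (2 * y) powr q"
  proof (cases "y = 0")
    case False
    then have y: "0 < 2 * y" using assms by simp
    have "((2 * y) powr q) powr (1 - 1 / q) = (2 * y) powr (q - 1)"
      using assms(3) by (simp add: powr_powr right_diff_distrib)
    then show ?thesis using y by (simp add: powr_diff)
  qed simp
  finally show ?thesis using assms(1) by linarith
qed

lemma dyadic_cover:
  fixes s r :: real
  assumes "0 < s" "s < r"
  obtains k :: nat where "2 ^ k * s < r" "r \<le> 2 ^ Suc k * s"
proof -
  define P where "P k \<longleftrightarrow> r \<le> 2 ^ k * s" for k :: nat
  have "\<exists>k. P k"
  proof -
    obtain k where "r / s < 2 ^ k" using real_arch_pow[of 2 "r / s"] by auto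
    then show ?thesis using assms by (auto simp: P_def field_simps intro!: exI[of _ k])
  qed
  define k where "k = (LEAST k. P k)"
  have k: "P k" "\<And>j. j < k \<Longrightarrow> \<not> P j"
    unfolding k_def using LeastI_ex[OF \<open>\<exists>k. P k\<close>] not_less_Least by blast+
  have "k \<noteq> 0" using k(1) assms by (intro notI) (simp add: P_def)
  then obtain j where j: "k = Suc j" using not0_implies_Suc by blast
  show thesis
    by (rule that[of j]) (use k(1) k(2)[of j] in \<open>auto simp: j P_def\<close>)
qed

lemma dyadic_indicator_sum:
  fixes s r :: real
  assumes "0 < s"
  shows "(\<Sum>k<n. if 2 ^ k * s < r \<and> r \<le> 2 ^ Suc k * s then 1 else 0 :: real) = (if s < r \<and> r \<le> 2 ^ n * s then 1 else 0)"
proof (induction n)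
  case (Suc n)
  have "s \<le> 2 ^ n * s" "2 ^ n * s \<le> 2 ^ Suc n * s" using assms by (auto simp: mult_right_mono)
  then show ?case unfolding sum.lessThan_Suc Suc.IH by auto
qed simp

text \<open>The band estimate from \<open>s\<close> to \<open>2 * s\<close> combined with
  \<open>Holder_set\<close>; each contributes a factor 2 to the constant 4. The powers of the level
  measure add up to \<open>1 / N + 1 - 1 / p = 1 - 1 / q\<close>, and multiplication by
  \<open>s powr (q - 1)\<close>, a power \<open>1 - 1 / q\<close> of \<open>s powr q\<close>, makes
  the estimate invariant under scaling of the level.\<close>

lemma level_measure_doubling:
  fixes u :: "'a::euclidean_space \<Rightarrow> real" and p :: real
  assumes \<Omega>: "open \<Omega>" "bounded \<Omega>" and p: "1 \<le> p" "p < DIM('a)" and u: "C1_approx \<Omega> p C u g"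
    and q: "q = DIM('a) * p / (DIM('a) - p)" and s: "C \<le> s" "0 < s"
  shows "(2 * s) powr q * level_measure \<Omega> u (2 * s) \<le>
    (4 * (2 / measure lborel (ball (0::'a) 1)) powr (1 / DIM('a)) * 2 powr q
     * (\<integral>x. indicator {x \<in> \<Omega>. s < u x \<and> u x \<le> 2 * s} x * norm (g x) powr p \<partial>lebesgue_on \<Omega>) powr (1 / p))
    * (s powr q * level_measure \<Omega> u s) powr (1 - 1 / q)"
proof -
  define N where "N = real DIM('a)"
  have N: "0 < N" "p < N" using p by (auto simp: N_def)
  have q1: "1 / q = 1 / p - 1 / N" using p N by (simp add: q N_def field_simps)
  have q0: "0 < q" using p N by (simp add: q N_def)
  define \<omega> where "\<omega> = measure lborel (ball (0::'a) 1)"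
  have \<omega>: "0 < \<omega>" by (simp add: \<omega>_def content_ball_pos)
  define \<mu> where "\<mu> = level_measure \<Omega> u"
  have \<mu>0: "0 \<le> \<mu> t" for t by (simp add: \<mu>_def level_measure_def)
  have fin: "\<Omega> \<in> lmeasurable" by (rule open_bounded_lmeasurable[OF \<Omega>])
  interpret finite_measure "lebesgue_on \<Omega>" by (rule finite_measure_lebesgue_on[OF fin])
  note um = C1_approx_mem[OF u]
  have [measurable]: "u \<in> borel_measurable (lebesgue_on \<Omega>)" using um by (simp add: mem_Lp_def)
  define Bd where "Bd = {x \<in> \<Omega>. s < u x \<and> u x \<le> 2 * s}"
  have Bdm: "Bd \<in> sets (lebesgue_on \<Omega>)"
  proof -
    have "{x \<in> space (lebesgue_on \<Omega>). s < u x \<and> u x \<le> 2 * s} \<in> sets (lebesgue_on \<Omega>)" by measurable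
    then show ?thesis by (simp add: Bd_def)
  qed
  have lm: "{x \<in> \<Omega>. s < u x} \<in> sets (lebesgue_on \<Omega>)"
  proof -
    have "{x \<in> space (lebesgue_on \<Omega>). s < u x} \<in> sets (lebesgue_on \<Omega>)" by measurable
    then show ?thesis by simp
  qed
  define e where "e = (\<integral>x. indicator Bd x * norm (g x) powr p \<partial>lebesgue_on \<Omega>)"
  have e0: "0 \<le> e" unfolding e_def by (rule Bochner_Integration.integral_nonneg) auto
  have "measure (lebesgue_on \<Omega>) Bd \<le> \<mu> s"
    unfolding \<mu>_def level_measure_def by (rule finite_measure_mono[OF _ lm]) (auto simp: Bd_def)
  then have hol: "(\<integral>x. indicator Bd x * norm (g x) \<partial>lebesgue_on \<Omega>) \<le> 2 * e powr (1 / p) * \<mu> s powr (1 - 1 / p)"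
    using Holder_set[OF um(2) p(1) Bdm] p
    by (intro order_trans[OF Holder_set[OF um(2) p(1) Bdm]])
       (auto simp: e_def[symmetric] emeasure_eq_measure intro!: mult_left_mono powr_mono2)
  have "s * \<mu> (2 * s) \<le> 2 * ((2 * \<mu> s / \<omega>) powr (1 / N) * (\<integral>x. indicator Bd x * norm (g x) \<partial>lebesgue_on \<Omega>))"
    using level_measure_band[OF \<Omega> p(1) u s(1), of "2 * s"] s(2) by (simp add: \<mu>_def \<omega>_def N_def Bd_def)
  also have "\<dots> \<le> 2 * ((2 * \<mu> s / \<omega>) powr (1 / N) * (2 * e powr (1 / p) * \<mu> s powr (1 - 1 / p)))"
    using hol by (intro mult_left_mono) auto
  also have "(2 * \<mu> s / \<omega>) powr (1 / N) = (2 / \<omega>) powr (1 / N) * \<mu> s powr (1 / N)"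
    using powr_mult[of "2 / \<omega>" "\<mu> s" "1 / N"] by simp
  also have "2 * ((2 / \<omega>) powr (1 / N) * \<mu> s powr (1 / N) * (2 * e powr (1 / p) * \<mu> s powr (1 - 1 / p)))
      = 4 * (2 / \<omega>) powr (1 / N) * e powr (1 / p) * \<mu> s powr (1 - 1 / q)"
    using powr_add[of "\<mu> s" "1 / N" "1 - 1 / p"] by (simp add: q1 algebra_simps)
  finally have 1: "s * \<mu> (2 * s) \<le> 4 * (2 / \<omega>) powr (1 / N) * e powr (1 / p) * \<mu> s powr (1 - 1 / q)" .
  have sq: "s powr q = s * s powr (q - 1)" using s(2) by (simp add: powr_diff)
  have "(2 * s) powr q * \<mu> (2 * s) = 2 powr q * s powr (q - 1) * (s * \<mu> (2 * s))"
    using s(2) by (simp add: powr_mult sq)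
  also have "\<dots> \<le> 2 powr q * s powr (q - 1) * (4 * (2 / \<omega>) powr (1 / N) * e powr (1 / p) * \<mu> s powr (1 - 1 / q))"
    by (intro mult_left_mono 1) auto
  also have "\<dots> = (4 * (2 / \<omega>) powr (1 / N) * 2 powr q * e powr (1 / p)) * (s powr (q - 1) * \<mu> s powr (1 - 1 / q))"
    by (simp add: mult_ac)
  also have "s powr (q - 1) = (s powr q) powr (1 - 1 / q)"
    using q0 by (simp add: powr_powr right_diff_distrib)
  also have "(s powr q) powr (1 - 1 / q) * \<mu> s powr (1 - 1 / q) = (s powr q * \<mu> s) powr (1 - 1 / q)"
    by (simp add: powr_mult)
  finally show ?thesis by (simp add: \<mu>_def \<omega>_def N_def e_def Bd_def)
qed

text \<open>The strong type Sobolev estimate from the weak one, by summation over dyadic levels.\<close>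

lemma sobolev_integrable_subcritical:
  fixes u :: "'a::euclidean_space \<Rightarrow> real" and p :: real
  assumes \<Omega>: "open \<Omega>" "bounded \<Omega>" and p: "1 \<le> p" "p < DIM('a)" and u: "C1_approx \<Omega> p C u g"
    and q: "q = DIM('a) * p / (DIM('a) - p)" and s: "C \<le> s" "0 < s"
  shows "integrable (lebesgue_on \<Omega>) (\<lambda>x. if s < u x then u x powr q else 0)"
proof -
  define N where "N = real DIM('a)"
  have N: "0 < N" "p < N" using p by (auto simp: N_def)
  have qN: "q = N * p / (N - p)" by (simp add: q N_def)
  have qp: "p \<le> q"
  proof -
    have "p * (N - p) \<le> N * p" using p N by (simp add: algebra_simps)
    then show ?thesis using N by (simp add: qN le_divide_eq)
  qed
  have q1: "1 \<le> q" using p qp by linarith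
  have fin: "\<Omega> \<in> lmeasurable" by (rule open_bounded_lmeasurable[OF \<Omega>])
  interpret finite_measure "lebesgue_on \<Omega>" by (rule finite_measure_lebesgue_on[OF fin])
  note um = C1_approx_mem[OF u]
  have [measurable]: "u \<in> borel_measurable (lebesgue_on \<Omega>)" "g \<in> borel_measurable (lebesgue_on \<Omega>)"
    using um by (auto simp: mem_Lp_def)
  define Bd where "Bd k = {x \<in> \<Omega>. 2 ^ k * s < u x \<and> u x \<le> 2 ^ Suc k * s}" for k :: nat
  have Bdm[measurable]: "Bd k \<in> sets (lebesgue_on \<Omega>)" for k
  proof -
    have "{x \<in> space (lebesgue_on \<Omega>). 2 ^ k * s < u x \<and> u x \<le> 2 ^ Suc k * s} \<in> sets (lebesgue_on \<Omega>)" by measurable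
    then show ?thesis by (simp add: Bd_def)
  qed
  define e where "e k = (\<integral>x. indicator (Bd k) x * norm (g x) powr p \<partial>lebesgue_on \<Omega>)" for k
  have ig: "integrable (lebesgue_on \<Omega>) (\<lambda>x. norm (g x) powr p)" using um by (simp add: mem_Lp_def)
  have ie: "integrable (lebesgue_on \<Omega>) (\<lambda>x. indicator (Bd k) x * norm (g x) powr p)" for k
    using integrable_real_mult_indicator[OF Bdm ig] by (simp add: mult.commute)
  have e0: "0 \<le> e k" for k unfolding e_def by (rule Bochner_Integration.integral_nonneg) auto
  define M where "M = Lp_pow (lebesgue_on \<Omega>) p g"
  have M0: "0 \<le> M" by (simp add: M_def Lp_pow_nonneg)
  have esum: "(\<Sum>k<n. e k) \<le> M" for n
  proof -
    have "(\<Sum>k<n. e k) = (\<integral>x. (\<Sum>k<n. indicator (Bd k) x * norm (g x) powr p) \<partial>lebesgue_on \<Omega>)"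
      unfolding e_def by (rule Bochner_Integration.integral_sum[symmetric]) (rule ie)
    also have "\<dots> \<le> M"
      unfolding M_def Lp_pow_def
    proof (rule integral_mono[OF _ ig])
      show "integrable (lebesgue_on \<Omega>) (\<lambda>x. \<Sum>k<n. indicator (Bd k) x * norm (g x) powr p)"
        by (intro Bochner_Integration.integrable_sum ie)
      fix x assume x: "x \<in> space (lebesgue_on \<Omega>)"
      have "(\<Sum>k<n. indicator (Bd k) x * norm (g x) powr p) = (\<Sum>k<n. indicator (Bd k) x) * norm (g x) powr p"
        by (simp add: sum_distrib_right)
      also have "(\<Sum>k<n. indicator (Bd k) x :: real) = (\<Sum>k<n. if 2 ^ k * s < u x \<and> u x \<le> 2 ^ Suc k * s then 1 else 0)"
        using x by (intro sum.cong) (auto simp: Bd_def)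
      also have "\<dots> \<le> 1" unfolding dyadic_indicator_sum[OF s(2)] by simp
      finally show "(\<Sum>k<n. indicator (Bd k) x * norm (g x) powr p) \<le> norm (g x) powr p"
        by (simp add: mult_right_mono)
    qed
    finally show ?thesis .
  qed
  have eM: "e k \<le> M" for k
  proof -
    have "e k \<le> (\<Sum>k<Suc k. e k)" using e0 by (intro member_le_sum) auto
    then show ?thesis using esum[of "Suc k"] by linarith
  qed
  define K where "K = 4 * (2 / measure lborel (ball (0::'a) 1)) powr (1 / DIM('a)) * 2 powr q"
  have K0: "0 \<le> K" by (simp add: K_def)
  \<comment> \<open>The terms of a dyadic layer cake sum; up to the factor \<open>2 powr q\<close>
    their sum bounds the integral of \<open>u powr q\<close> over \<open>{u > s}\<close>.\<close>
  define a where "a k = (2 ^ k * s) powr q * level_measure \<Omega> u (2 ^ k * s)" for k :: nat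
  have a0: "0 \<le> a k" for k by (simp add: a_def level_measure_def)
  have step: "a (Suc k) \<le> (K * e k powr (1 / p)) * a k powr (1 - 1 / q)" for k
  proof -
    have "s \<le> 2 ^ k * s" using s by (simp add: mult_right_mono)
    then have "C \<le> 2 ^ k * s" "0 < 2 ^ k * s" using s by linarith+
    from level_measure_doubling[OF \<Omega> p u q this] show ?thesis
      by (simp add: a_def e_def Bd_def K_def mult.assoc)
  qed
  have "summable a"
  proof (rule summable_of_contraction[OF a0])
    show "a (Suc k) \<le> a k / 2 + (2 * (K * e k powr (1 / p))) powr q" for k
      by (rule le_half_add_powr[OF a0 _ q1 step]) (use K0 in auto)
    \<comment> \<open>The gain of truncation: since \<open>q \<ge> p\<close>, the power
      \<open>e k powr (q / p)\<close> is at most \<open>M powr (q / p - 1)\<close> times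
      \<open>e k\<close>, and the energies \<open>e k\<close> of disjoint bands sum to at most
      \<open>M\<close>.\<close>
    show "(\<Sum>k<n. (2 * (K * e k powr (1 / p))) powr q) \<le> (2 * K) powr q * M powr (q / p - 1) * M" for n
    proof -
      have "(2 * (K * e k powr (1 / p))) powr q \<le> (2 * K) powr q * M powr (q / p - 1) * e k" for k
      proof -
        have "(2 * (K * e k powr (1 / p))) powr q = (2 * K) powr q * (e k powr (q / p))"
          using powr_mult[of "2 * K" "e k powr (1 / p)" q] by (simp add: powr_powr mult.assoc)
        also have "e k powr (q / p) \<le> M powr (q / p - 1) * e k"
        proof (cases "e k = 0")
          case False
          then have "0 < e k" using e0[of k] by simp
          then have "e k powr (q / p) = e k powr (q / p - 1) * e k" by (simp add: powr_diff)
          also have "\<dots> \<le> M powr (q / p - 1) * e k"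
            using e0[of k] eM[of k] qp p by (intro mult_right_mono powr_mono2) auto
          finally show ?thesis .
        qed simp
        finally show ?thesis by (simp add: mult_left_mono mult.assoc)
      qed
      then have "(\<Sum>k<n. (2 * (K * e k powr (1 / p))) powr q) \<le> (\<Sum>k<n. (2 * K) powr q * M powr (q / p - 1) * e k)"
        by (intro sum_mono)
      also have "\<dots> = (2 * K) powr q * M powr (q / p - 1) * (\<Sum>k<n. e k)"
        by (simp add: sum_distrib_left)
      also have "\<dots> \<le> (2 * K) powr q * M powr (q / p - 1) * M"
        by (intro mult_left_mono esum) auto
      finally show ?thesis .
    qed
  qed
  \<comment> \<open>If \<open>u x\<close> lies in the \<open>k\<close>-th dyadic band then
    \<open>u x\<close> is at most twice the lower end, so the single term \<open>f k x\<close>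
    already dominates \<open>u x powr q\<close>.\<close>
  define f where "f k x = 2 powr q * (2 ^ k * s) powr q * indicator {x \<in> \<Omega>. 2 ^ k * s < u x} x" for k :: nat and x
  have lm: "{x \<in> \<Omega>. c < u x} \<in> sets (lebesgue_on \<Omega>)" for c
  proof -
    have "{x \<in> space (lebesgue_on \<Omega>). c < u x} \<in> sets (lebesgue_on \<Omega>)" by measurable
    then show ?thesis by simp
  qed
  have fm[measurable]: "f k \<in> borel_measurable (lebesgue_on \<Omega>)" for k
    unfolding f_def using lm by measurable
  have f0: "0 \<le> f k x" for k x by (simp add: f_def)
  have intf: "(\<integral>\<^sup>+x. ennreal (f k x) \<partial>lebesgue_on \<Omega>) = ennreal (2 powr q * a k)" for k
  proof -
    have "(\<integral>\<^sup>+x. ennreal (f k x) \<partial>lebesgue_on \<Omega>)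
        = (\<integral>\<^sup>+x. ennreal (2 powr q * (2 ^ k * s) powr q) * indicator {x \<in> \<Omega>. 2 ^ k * s < u x} x \<partial>lebesgue_on \<Omega>)"
      unfolding f_def by (rule nn_integral_cong) (auto simp: indicator_def)
    also have "\<dots> = ennreal (2 powr q * (2 ^ k * s) powr q) * ennreal (level_measure \<Omega> u (2 ^ k * s))"
      using lm by (simp add: nn_integral_cmult_indicator emeasure_eq_measure level_measure_def)
    also have "\<dots> = ennreal (2 powr q * a k)"
      by (simp add: a_def ennreal_mult'[symmetric] level_measure_def mult.assoc)
    finally show ?thesis .
  qed
  have le: "ennreal (if s < u x then u x powr q else 0) \<le> (\<Sum>k. ennreal (f k x))" if "x \<in> \<Omega>" for x
  proof (cases "s < u x")
    case True
    obtain k where k: "2 ^ k * s < u x" "u x \<le> 2 ^ Suc k * s" using dyadic_cover[OF s(2) True] .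
    have "u x powr q \<le> (2 * (2 ^ k * s)) powr q"
      using k s True q1 by (intro powr_mono2) (auto simp: mult.assoc)
    also have "\<dots> = f k x" using k(1) that by (simp add: f_def powr_mult)
    finally have "ennreal (u x powr q) \<le> ennreal (f k x)" by (rule ennreal_leI)
    also have "\<dots> = (\<Sum>k\<in>{k}. ennreal (f k x))" by simp
    also have "\<dots> \<le> (\<Sum>k. ennreal (f k x))" by (intro sum_le_suminf) auto
    finally show ?thesis using True by simp
  qed simp
  have "(\<integral>\<^sup>+x. ennreal (if s < u x then u x powr q else 0) \<partial>lebesgue_on \<Omega>) \<le> (\<integral>\<^sup>+x. (\<Sum>k. ennreal (f k x)) \<partial>lebesgue_on \<Omega>)"
    by (rule nn_integral_mono) (use le in simp)
  also have "\<dots> = (\<Sum>k. \<integral>\<^sup>+x. ennreal (f k x) \<partial>lebesgue_on \<Omega>)"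
    by (rule nn_integral_suminf) measurable
  also have "\<dots> = (\<Sum>k. ennreal (2 powr q * a k))" by (simp add: intf)
  also have "\<dots> < \<infinity>"
    using \<open>summable a\<close> a0 by (simp add: suminf_ennreal2 summable_mult)
  finally have "(\<integral>\<^sup>+x. ennreal (norm (if s < u x then u x powr q else 0)) \<partial>lebesgue_on \<Omega>) < \<infinity>"
    by (simp cong: if_cong)
  then show ?thesis by (intro integrableI_bounded) measurable
qed

text \<open>For \<open>p\<close> equal to the dimension the exponent is \<open>p\<close> itself, and
  p-integrability of \<open>u\<close> is enough.\<close>

lemma sobolev_integrable:
  fixes u :: "'a::euclidean_space \<Rightarrow> real" and p :: real
  assumes \<Omega>: "open \<Omega>" "bounded \<Omega>" and p: "1 \<le> p" "p \<le> DIM('a)" and u: "C1_approx \<Omega> p C u g"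
    and s: "C \<le> s" "0 < s"
  shows "integrable (lebesgue_on \<Omega>) (\<lambda>x. if s < u x then u x powr sharp_exponent DIM('a) p else 0)"
proof (cases "p < DIM('a)")
  case True
  then have eq: "sharp_exponent DIM('a) p = DIM('a) * p / (DIM('a) - p)" by (simp add: sharp_exponent_def)
  show ?thesis
    unfolding eq by (rule sobolev_integrable_subcritical[OF \<Omega> p(1) True u refl s])
next
  case False
  then have [simp]: "sharp_exponent DIM('a) p = p" using p by (simp add: sharp_exponent_def)
  note um = C1_approx_mem[OF u]
  have [measurable]: "u \<in> borel_measurable (lebesgue_on \<Omega>)" using um by (simp add: mem_Lp_def)
  have "integrable (lebesgue_on \<Omega>) (\<lambda>x. norm (u x) powr p)" using um by (simp add: mem_Lp_def)
  then show ?thesis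
    by (rule Bochner_Integration.integrable_bound) (use s in auto)
qed

section \<open>Good truncation levels\<close>

lemma interval_cell:
  fixes a \<delta> r :: real
  assumes "0 < \<delta>" "a < r" "r \<le> a + real n * \<delta>"
  obtains j where "j < n" "a + real j * \<delta> < r" "r \<le> a + real (Suc j) * \<delta>"
    "\<And>k. a + real k * \<delta> < r \<Longrightarrow> r \<le> a + real (Suc k) * \<delta> \<Longrightarrow> k = j"
proof -
  have "\<exists>j<n. a + real j * \<delta> < r \<and> r \<le> a + real (Suc j) * \<delta>"
    using assms(3)
  proof (induction n)
    case 0
    then show ?case using assms by simp
  next
    case (Suc n)
    show ?case
    proof (cases "r \<le> a + real n * \<delta>")
      case True
      then show ?thesis using Suc.IH less_SucI by blast
    next
      case False
      then show ?thesis using Suc.prems by (intro exI[of _ n]) auto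
    qed
  qed
  then obtain j where j: "j < n" "a + real j * \<delta> < r" "r \<le> a + real (Suc j) * \<delta>" by blast
  have "k = j" if "a + real k * \<delta> < r" "r \<le> a + real (Suc k) * \<delta>" for k
  proof -
    have "real k * \<delta> < real (Suc j) * \<delta>" "real j * \<delta> < real (Suc k) * \<delta>" using that j by linarith+
    then have "real k < real (Suc j)" "real j < real (Suc k)" using assms(1) by (simp_all add: mult_less_cancel_right)
    then show ?thesis by linarith
  qed
  with j that show thesis by blast
qed

text \<open>Testing the subgradient inequality with the unit vector \<open>sgn \<zeta>\<close>
  bounds \<open>norm \<zeta>\<close> by an increment of \<open>H\<close> over a compact set. Every
  subgradient at a level in \<open>[a, b]\<close> is covered, so the bound does not depend on how
  they are selected.\<close>

lemma subgradient_bounded: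
  fixes H :: "real \<times> 'a::euclidean_space \<Rightarrow> real"
  assumes H: "continuous_on UNIV H"
  obtains B where "0 < B" "\<And>t \<zeta>. t \<in> {a..b} \<Longrightarrow> (\<forall>\<xi>. H (t, \<xi>) \<ge> H (t, 0) + \<zeta> \<bullet> \<xi>) \<Longrightarrow> norm \<zeta> \<le> B"
proof -
  have "bounded (H ` ({a..b} \<times> cball 0 1))"
    by (intro compact_imp_bounded compact_continuous_image compact_Times)
      (use H in \<open>auto intro: continuous_on_subset\<close>)
  then obtain B where B: "B > 0" "\<And>z. z \<in> {a..b} \<times> cball 0 1 \<Longrightarrow> \<bar>H z\<bar> \<le> B"
    by (auto simp: bounded_pos)
  have "norm \<zeta> \<le> 2 * B" if t: "t \<in> {a..b}" and \<zeta>: "\<forall>\<xi>. H (t, \<xi>) \<ge> H (t, 0) + \<zeta> \<bullet> \<xi>" for t \<zeta>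
  proof (cases "\<zeta> = 0")
    case False
    have "\<zeta> \<bullet> sgn \<zeta> = norm \<zeta>" using False by (simp add: sgn_div_norm dot_square_norm power2_eq_square)
    then have "norm \<zeta> \<le> H (t, sgn \<zeta>) - H (t, 0)" using \<zeta>[rule_format, of "sgn \<zeta>"] by linarith
    also have "\<dots> \<le> 2 * B"
    proof -
      have "norm (sgn \<zeta>) = 1" using False by (simp add: norm_sgn)
      then have "(t, sgn \<zeta>) \<in> {a..b} \<times> cball 0 1" "(t, 0) \<in> {a..b} \<times> cball (0::'a) 1" using t by auto
      then show ?thesis using B(2)[of "(t, sgn \<zeta>)"] B(2)[of "(t, 0)"] by linarith
    qed
    finally show ?thesis .
  qed (use B in simp)
  then show thesis using that[of "2 * B"] B(1) by simp
qed

text \<open>On \<open>{x. a < u x \<le> b}\<close> the function \<open>u\<close> is replaced by a step function, so that one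
  subgradient per step suffices and no measurable selection is needed. The gradient integrates to
  zero over each level band; cutting off at \<open>norm (g x) \<le> R\<close> makes \<open>H\<close> uniformly continuous.\<close>

lemma subgradient_inequality_truncated:
  fixes u :: "'a::euclidean_space \<Rightarrow> real" and H :: "real \<times> 'a \<Rightarrow> real"
  assumes \<Omega>: "open \<Omega>" "bounded \<Omega>" and p: "1 \<le> p" and u: "C1_approx \<Omega> p C u g"
    and H: "continuous_on UNIV H" and sub: "\<forall>t. \<exists>\<zeta>. \<forall>\<xi>. H (t, \<xi>) \<ge> H (t, 0) + \<zeta> \<bullet> \<xi>"
    and ab: "C \<le> a" "a < b"
    and B: "0 < B" "\<And>t \<zeta>. t \<in> {a..b} \<Longrightarrow> (\<forall>\<xi>. H (t, \<xi>) \<ge> H (t, 0) + \<zeta> \<bullet> \<xi>) \<Longrightarrow> norm \<zeta> \<le> B"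
    and R: "0 \<le> R" and \<epsilon>: "0 < \<epsilon>"
    and i: "integrable (lebesgue_on \<Omega>) (\<lambda>x. if a < u x \<and> u x \<le> b \<and> norm (g x) \<le> R then H (u x, g x) - H (u x, 0) else 0)"
  shows "0 \<le> (\<integral>x. (if a < u x \<and> u x \<le> b \<and> norm (g x) \<le> R then H (u x, g x) - H (u x, 0) else 0)
     + 2 * \<epsilon> + (if R < norm (g x) then B * norm (g x) else 0) \<partial>lebesgue_on \<Omega>)"
proof -
  have fin: "\<Omega> \<in> lmeasurable" by (rule open_bounded_lmeasurable[OF \<Omega>])
  interpret finite_measure "lebesgue_on \<Omega>" by (rule finite_measure_lebesgue_on[OF fin])
  note um = C1_approx_mem[OF u]
  have [measurable]: "u \<in> borel_measurable (lebesgue_on \<Omega>)" "g \<in> borel_measurable (lebesgue_on \<Omega>)"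
    using um by (auto simp: mem_Lp_def)
  have ig: "integrable (lebesgue_on \<Omega>) g" by (rule mem_Lp_imp_integrable(1)[OF um(2) p])
  have "uniformly_continuous_on ({a..b} \<times> cball 0 R) H"
    by (intro compact_uniformly_continuous compact_Times) (use H in \<open>auto intro: continuous_on_subset\<close>)
  then obtain d where d: "d > 0" "\<And>z z'. z \<in> {a..b} \<times> cball 0 R \<Longrightarrow> z' \<in> {a..b} \<times> cball 0 R \<Longrightarrow>
      dist z' z < d \<Longrightarrow> dist (H z') (H z) < \<epsilon>"
    unfolding uniformly_continuous_on_def using \<epsilon> by metis
  obtain n where n: "(b - a) / d < real n" using reals_Archimedean2 by blast
  have n0: "0 < real n" using n d(1) ab by (metis diff_gt_0_iff_gt divide_pos_pos less_trans)
  define \<delta> where "\<delta> = (b - a) / real n"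
  have \<delta>: "0 < \<delta>" "\<delta> < d" "a + real n * \<delta> = b"
    using n n0 d(1) ab by (auto simp: \<delta>_def field_simps)
  define t where "t j = a + real (Suc j) * \<delta>" for j
  have tmem: "t j \<in> {a..b}" if "j < n" for j
  proof -
    have "real (Suc j) * \<delta> \<le> real n * \<delta>" using that \<delta>(1) by (intro mult_right_mono) auto
    then show ?thesis using \<delta> by (auto simp: t_def)
  qed
  obtain Z where Z: "\<And>t \<xi>. H (t, \<xi>) \<ge> H (t, 0) + Z t \<bullet> \<xi>" using sub by metis
  define gb where "gb j x = (if a + real j * \<delta> < u x \<and> u x \<le> t j then g x else 0)" for j x
  have apb: "C1_approx \<Omega> p 0 (\<lambda>x. max 0 (min (u x - (a + real j * \<delta>)) (t j - (a + real j * \<delta>)))) (gb j)" for j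
    unfolding gb_def by (rule C1_approx_band[OF \<Omega> p u]) (use ab \<delta> in \<open>auto simp: t_def algebra_simps add_increasing2\<close>)
  have zero: "(\<integral>x. gb j x \<partial>lebesgue_on \<Omega>) = 0" for j
    by (rule C1_approx_integral_gradient_eq_0[OF \<Omega> p apb])
  have igb: "integrable (lebesgue_on \<Omega>) (gb j)" for j
    by (rule mem_Lp_imp_integrable(1)[OF C1_approx_mem(2)[OF apb] p])
  have iZ: "integrable (lebesgue_on \<Omega>) (\<lambda>x. Z (t j) \<bullet> gb j x)" for j
    by (rule integrable_inner_right[OF igb])
  have Zzero: "(\<integral>x. Z (t j) \<bullet> gb j x \<partial>lebesgue_on \<Omega>) = 0" for j
    using integral_inner_right[of "Z (t j)" "lebesgue_on \<Omega>" "gb j"] igb zero by simp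
  \<comment> \<open>A pointwise majorant of the step subgradient paired with \<open>g\<close>. The
    \<open>2 * \<epsilon>\<close> pays for moving from \<open>t j\<close> to \<open>u x\<close> at
    the two arguments \<open>g x\<close> and \<open>0\<close>; the last term covers gradients longer
    than \<open>R\<close>, where only the bound \<open>B\<close> is available.\<close>
  define D where "D x = (if a < u x \<and> u x \<le> b \<and> norm (g x) \<le> R then H (u x, g x) - H (u x, 0) else 0)
     + 2 * \<epsilon> + (if R < norm (g x) then B * norm (g x) else 0)" for x
  have iB: "integrable (lebesgue_on \<Omega>) (\<lambda>x. if R < norm (g x) then B * norm (g x) else 0)"
    by (rule Bochner_Integration.integrable_bound[of _ "\<lambda>x. B * norm (g x)"]) (use ig B(1) in auto)
  have iD: "integrable (lebesgue_on \<Omega>) D" unfolding D_def using i iB by simp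
  have pt: "(\<Sum>j<n. Z (t j) \<bullet> gb j x) \<le> D x" for x
  proof (cases "a < u x \<and> u x \<le> b")
    case False
    have "gb j x = 0" if "j < n" for j
    proof -
      have "0 \<le> real j * \<delta>" using \<delta>(1) by simp
      then have "\<not> (a + real j * \<delta> < u x \<and> u x \<le> t j)" using False tmem[OF that] by auto
      then show ?thesis unfolding gb_def by (rule if_not_P)
    qed
    then have "(\<Sum>j<n. Z (t j) \<bullet> gb j x) = 0" by simp
    also have "\<dots> \<le> D x" using False \<epsilon> B(1) by (auto simp: D_def)
    finally show ?thesis .
  next
    case True
    then have au: "a < u x" "u x \<le> a + real n * \<delta>" using \<delta>(3) by auto
    obtain j where j: "j < n" "a + real j * \<delta> < u x" "u x \<le> a + real (Suc j) * \<delta>"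
      "\<And>k. a + real k * \<delta> < u x \<Longrightarrow> u x \<le> a + real (Suc k) * \<delta> \<Longrightarrow> k = j"
      using interval_cell[OF \<delta>(1) au] by blast
    have "(\<Sum>k<n. Z (t k) \<bullet> gb k x) = (\<Sum>k<n. if k = j then Z (t j) \<bullet> g x else 0)"
    proof (intro sum.cong refl)
      fix k
      show "Z (t k) \<bullet> gb k x = (if k = j then Z (t j) \<bullet> g x else 0)"
      proof (cases "k = j")
        case True
        have "gb j x = g x" unfolding gb_def t_def using j(2,3) by (intro if_P conjI)
        then show ?thesis using True by simp
      next
        case False
        then have "\<not> (a + real k * \<delta> < u x \<and> u x \<le> t k)" using j(4) unfolding t_def by blast
        then have "gb k x = 0" unfolding gb_def by (rule if_not_P)
        then show ?thesis using False by simp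
      qed
    qed
    also have "\<dots> = Z (t j) \<bullet> g x" using j(1) by simp
    also have "\<dots> \<le> D x"
    proof (cases "norm (g x) \<le> R")
      case True
      have "real (Suc j) * \<delta> = real j * \<delta> + \<delta>" by (simp add: algebra_simps)
      then have "dist (t j) (u x) < d" using j(2,3) \<delta>(2) unfolding dist_real_def t_def by linarith
      then have dd: "dist (t j, \<xi>) (u x, \<xi>) < d" for \<xi> :: 'a by (simp add: dist_prod_def)
      have c: "\<bar>H (t j, \<xi>) - H (u x, \<xi>)\<bar> < \<epsilon>" if "norm \<xi> \<le> R" for \<xi>
        using d(2)[OF _ _ dd, of \<xi>] tmem[OF j(1)] that \<open>a < u x \<and> u x \<le> b\<close> by (auto simp: dist_real_def)
      have "Z (t j) \<bullet> g x \<le> H (t j, g x) - H (t j, 0)" using Z[of "t j" "g x"] by linarith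
      also have "\<dots> \<le> H (u x, g x) - H (u x, 0) + 2 * \<epsilon>"
        using c[OF True] c[of 0] R by (auto simp: abs_less_iff)
      also have "\<dots> = D x" using True \<open>a < u x \<and> u x \<le> b\<close> by (simp add: D_def)
      finally show ?thesis .
    next
      case False
      have "Z (t j) \<bullet> g x \<le> norm (Z (t j)) * norm (g x)" by (rule norm_cauchy_schwarz)
      also have "\<dots> \<le> B * norm (g x)"
        using Z by (intro mult_right_mono B(2)[OF tmem[OF j(1)]]) auto
      also have "\<dots> \<le> D x" using False \<epsilon> by (simp add: D_def)
      finally show ?thesis .
    qed
    finally show ?thesis .
  qed
  have "0 = (\<Sum>j<n. \<integral>x. Z (t j) \<bullet> gb j x \<partial>lebesgue_on \<Omega>)" by (simp add: Zzero)
  also have "\<dots> = (\<integral>x. (\<Sum>j<n. Z (t j) \<bullet> gb j x) \<partial>lebesgue_on \<Omega>)"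
    by (rule Bochner_Integration.integral_sum[symmetric]) (rule iZ)
  also have "\<dots> \<le> (\<integral>x. D x \<partial>lebesgue_on \<Omega>)"
    by (rule integral_mono[OF _ iD pt]) (intro Bochner_Integration.integrable_sum iZ)
  finally show ?thesis by (simp add: D_def)
qed

text \<open>In the truncated inequality first \<open>\<epsilon>\<close> tends to 0 and then
  \<open>R\<close> to infinity. The majorants are \<open>\<bar>H (u x, g x)\<bar> + M\<close>, with
  \<open>M\<close> bounding \<open>H (t, 0)\<close> on the compact band, and
  \<open>B * norm (g x)\<close>. Boundedness of the band is essential for both.\<close>

lemma subgradient_inequality:
  fixes u :: "'a::euclidean_space \<Rightarrow> real" and H :: "real \<times> 'a \<Rightarrow> real"
  assumes \<Omega>: "open \<Omega>" "bounded \<Omega>" and p: "1 \<le> p" and u: "C1_approx \<Omega> p C u g"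
    and H: "continuous_on UNIV H" and sub: "\<forall>t. \<exists>\<zeta>. \<forall>\<xi>. H (t, \<xi>) \<ge> H (t, 0) + \<zeta> \<bullet> \<xi>"
    and ab: "C \<le> a" "a < b" and iH: "integrable (lebesgue_on \<Omega>) (\<lambda>x. H (u x, g x))"
  shows "integrable (lebesgue_on \<Omega>) (\<lambda>x. if a < u x \<and> u x \<le> b then H (u x, 0) else 0)"
    "(\<integral>x. (if a < u x \<and> u x \<le> b then H (u x, 0) else 0) \<partial>lebesgue_on \<Omega>)
       \<le> (\<integral>x. (if a < u x \<and> u x \<le> b then H (u x, g x) else 0) \<partial>lebesgue_on \<Omega>)"
proof -
  have fin: "\<Omega> \<in> lmeasurable" by (rule open_bounded_lmeasurable[OF \<Omega>])
  interpret finite_measure "lebesgue_on \<Omega>" by (rule finite_measure_lebesgue_on[OF fin])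
  note um = C1_approx_mem[OF u]
  have [measurable]: "u \<in> borel_measurable (lebesgue_on \<Omega>)" "g \<in> borel_measurable (lebesgue_on \<Omega>)"
    using um by (auto simp: mem_Lp_def)
  have [measurable]: "H \<in> borel_measurable borel" using H by (rule borel_measurable_continuous_onI)
  have ig: "integrable (lebesgue_on \<Omega>) g" by (rule mem_Lp_imp_integrable(1)[OF um(2) p])
  have "bounded ((\<lambda>t. H (t, 0)) ` {a..b})"
    by (intro compact_imp_bounded compact_continuous_image continuous_on_compose2[OF H]) (auto intro!: continuous_intros)
  then obtain M where M: "M > 0" "\<And>t. t \<in> {a..b} \<Longrightarrow> \<bar>H (t, 0)\<bar> \<le> M"
    by (auto simp: bounded_pos)
  show i0: "integrable (lebesgue_on \<Omega>) (\<lambda>x. if a < u x \<and> u x \<le> b then H (u x, 0) else 0)"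
    by (rule Bochner_Integration.integrable_bound[of _ "\<lambda>x. M"]) (use M in auto)
  have i1: "integrable (lebesgue_on \<Omega>) (\<lambda>x. if a < u x \<and> u x \<le> b then H (u x, g x) else 0)"
    by (rule Bochner_Integration.integrable_bound[OF iH]) auto
  obtain B where B: "0 < B" "\<And>t \<zeta>. t \<in> {a..b} \<Longrightarrow> (\<forall>\<xi>. H (t, \<xi>) \<ge> H (t, 0) + \<zeta> \<bullet> \<xi>) \<Longrightarrow> norm \<zeta> \<le> B"
    using subgradient_bounded[OF H] by blast
  define J where "J R x = (if a < u x \<and> u x \<le> b \<and> norm (g x) \<le> R then H (u x, g x) - H (u x, 0) else 0)" for R x
  define J' where "J' R x = (if R < norm (g x) then B * norm (g x) else 0)" for R x
  have dom: "integrable (lebesgue_on \<Omega>) (\<lambda>x. \<bar>H (u x, g x)\<bar> + M)" using iH by simp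
  have Jb: "\<bar>J R x\<bar> \<le> \<bar>H (u x, g x)\<bar> + M" for R x
    using M(1) M(2)[of "u x"] by (auto simp: J_def)
  have iJ: "integrable (lebesgue_on \<Omega>) (J R)" for R
    by (rule Bochner_Integration.integrable_bound[OF dom]) (use Jb M(1) in \<open>auto simp: J_def[abs_def] intro!: AE_I2\<close>)
  have iJ': "integrable (lebesgue_on \<Omega>) (J' R)" for R
    unfolding J'_def[abs_def]
    by (rule Bochner_Integration.integrable_bound[of _ "\<lambda>x. B * norm (g x)"]) (use ig B(1) in auto)
  have nonneg: "0 \<le> (\<integral>x. J (real R) x \<partial>lebesgue_on \<Omega>) + (\<integral>x. J' (real R) x \<partial>lebesgue_on \<Omega>)" for R :: nat
  proof -
    define m where "m = measure (lebesgue_on \<Omega>) \<Omega>"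
    have m: "0 \<le> m" by (simp add: m_def)
    have "0 \<le> (\<integral>x. J (real R) x \<partial>lebesgue_on \<Omega>) + (\<integral>x. J' (real R) x \<partial>lebesgue_on \<Omega>) + \<eta>" if \<eta>: "0 < \<eta>" for \<eta>
    proof -
      define \<epsilon> where "\<epsilon> = \<eta> / (2 * (m + 1))"
      have \<epsilon>: "0 < \<epsilon>" using \<eta> m by (simp add: \<epsilon>_def)
      have \<epsilon>m: "2 * \<epsilon> * m \<le> \<eta>" using \<eta> m by (simp add: \<epsilon>_def field_simps)
      have "0 \<le> (\<integral>x. J (real R) x + 2 * \<epsilon> + J' (real R) x \<partial>lebesgue_on \<Omega>)"
        using subgradient_inequality_truncated[OF \<Omega> p u H sub ab B _ \<epsilon>, where R = "real R"] iJ
        by (simp add: J_def[abs_def] J'_def[abs_def])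
      also have "\<dots> = (\<integral>x. J (real R) x \<partial>lebesgue_on \<Omega>) + 2 * \<epsilon> * m + (\<integral>x. J' (real R) x \<partial>lebesgue_on \<Omega>)"
        using iJ iJ' by (simp add: m_def)
      finally show ?thesis using \<epsilon>m by linarith
    qed
    then show ?thesis by (metis field_le_epsilon)
  qed
  have conv_ev: "\<forall>\<^sub>F R in sequentially. norm (g x) \<le> real R" for x
    using eventually_ge_at_top[of "nat \<lceil>norm (g x)\<rceil>"] by eventually_elim linarith
  have "(\<lambda>R. \<integral>x. J (real R) x \<partial>lebesgue_on \<Omega>) \<longlonglongrightarrow>
      (\<integral>x. (if a < u x \<and> u x \<le> b then H (u x, g x) - H (u x, 0) else 0) \<partial>lebesgue_on \<Omega>)"
  proof (rule integral_dominated_convergence[OF _ _ dom])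
    show "AE x in lebesgue_on \<Omega>. (\<lambda>R. J (real R) x) \<longlonglongrightarrow> (if a < u x \<and> u x \<le> b then H (u x, g x) - H (u x, 0) else 0)"
    proof (rule AE_I2, rule tendsto_eventually)
      fix x
      show "\<forall>\<^sub>F R in sequentially. J (real R) x = (if a < u x \<and> u x \<le> b then H (u x, g x) - H (u x, 0) else 0)"
        using conv_ev[of x] by eventually_elim (auto simp: J_def)
    qed
  qed (use Jb iJ in \<open>auto intro: borel_measurable_integrable\<close>)
  moreover have "(\<lambda>R. \<integral>x. J' (real R) x \<partial>lebesgue_on \<Omega>) \<longlonglongrightarrow> (\<integral>x. 0 \<partial>lebesgue_on \<Omega>)"
  proof (rule integral_dominated_convergence[of _ _ _ "\<lambda>x. B * norm (g x)"])
    show "AE x in lebesgue_on \<Omega>. (\<lambda>R. J' (real R) x) \<longlonglongrightarrow> 0"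
    proof (rule AE_I2, rule tendsto_eventually)
      fix x
      show "\<forall>\<^sub>F R in sequentially. J' (real R) x = 0"
        using conv_ev[of x] by eventually_elim (auto simp: J'_def)
    qed
  qed (use iJ' ig B(1) in \<open>auto simp: J'_def intro: borel_measurable_integrable\<close>)
  ultimately have "(\<lambda>R. (\<integral>x. J (real R) x \<partial>lebesgue_on \<Omega>) + (\<integral>x. J' (real R) x \<partial>lebesgue_on \<Omega>)) \<longlonglongrightarrow>
      (\<integral>x. (if a < u x \<and> u x \<le> b then H (u x, g x) - H (u x, 0) else 0) \<partial>lebesgue_on \<Omega>) + (\<integral>x. 0 \<partial>lebesgue_on \<Omega>)"
    by (rule tendsto_add)
  from LIMSEQ_le_const[OF this, of 0] nonneg
  have "0 \<le> (\<integral>x. (if a < u x \<and> u x \<le> b then H (u x, g x) - H (u x, 0) else 0) \<partial>lebesgue_on \<Omega>)"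
    by simp
  also have "\<dots> = (\<integral>x. (if a < u x \<and> u x \<le> b then H (u x, g x) else 0) - (if a < u x \<and> u x \<le> b then H (u x, 0) else 0) \<partial>lebesgue_on \<Omega>)"
    by (rule Bochner_Integration.integral_cong) auto
  also have "\<dots> = (\<integral>x. (if a < u x \<and> u x \<le> b then H (u x, g x) else 0) \<partial>lebesgue_on \<Omega>)
       - (\<integral>x. (if a < u x \<and> u x \<le> b then H (u x, 0) else 0) \<partial>lebesgue_on \<Omega>)"
    by (rule Bochner_Integration.integral_diff[OF i1 i0])
  finally show "(\<integral>x. (if a < u x \<and> u x \<le> b then H (u x, 0) else 0) \<partial>lebesgue_on \<Omega>)
       \<le> (\<integral>x. (if a < u x \<and> u x \<le> b then H (u x, g x) else 0) \<partial>lebesgue_on \<Omega>)" by simp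
qed

lemma integrable_bounded_exhaustion:
  fixes f :: "'a \<Rightarrow> real" and r :: "'a \<Rightarrow> real"
  assumes f: "f \<in> borel_measurable M" "\<And>x. 0 \<le> f x"
    and i: "\<And>n::nat. integrable M (\<lambda>x. if r x \<le> a + real n then f x else 0)"
    and b: "\<And>n::nat. (\<integral>x. (if r x \<le> a + real n then f x else 0) \<partial>M) \<le> \<Lambda>"
  shows "integrable M f"
proof -
  define F where "F n x = ennreal (if r x \<le> a + real n then f x else 0)" for n :: nat and x
  have Fm: "F n \<in> borel_measurable M" for n
    unfolding F_def using borel_measurable_integrable[OF i[of n]] by measurable
  have inc: "incseq F"
    unfolding incseq_def le_fun_def F_def using f(2) by (auto intro!: ennreal_leI)
  have "(\<integral>\<^sup>+x. ennreal (f x) \<partial>M) \<le> (\<integral>\<^sup>+x. (SUP n. F n x) \<partial>M)"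
  proof (rule nn_integral_mono)
    fix x
    obtain n :: nat where "r x - a \<le> real n" using real_arch_simple by blast
    then have "ennreal (f x) = F n x" by (simp add: F_def)
    also have "\<dots> \<le> (SUP n. F n x)" by (rule SUP_upper) simp
    finally show "ennreal (f x) \<le> (SUP n. F n x)" .
  qed
  also have "\<dots> = (SUP n. \<integral>\<^sup>+x. F n x \<partial>M)"
    by (rule nn_integral_monotone_convergence_SUP[OF inc Fm])
  also have "\<dots> \<le> ennreal \<Lambda>"
  proof (rule SUP_least)
    fix n
    have "(\<integral>\<^sup>+x. F n x \<partial>M) = ennreal (\<integral>x. (if r x \<le> a + real n then f x else 0) \<partial>M)"
      unfolding F_def by (rule nn_integral_eq_integral[OF i]) (use f(2) in auto)
    also have "\<dots> \<le> ennreal \<Lambda>" by (rule ennreal_leI[OF b])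
    finally show "(\<integral>\<^sup>+x. F n x \<partial>M) \<le> ennreal \<Lambda>" .
  qed
  finally have "(\<integral>\<^sup>+x. ennreal (norm (f x)) \<partial>M) < \<infinity>"
    using f(2) by (simp add: le_less_trans)
  then show ?thesis by (intro integrableI_bounded f(1))
qed

lemma nonneg_almost_min:
  fixes f :: "real \<Rightarrow> real"
  assumes "\<And>s. 0 \<le> f s"
  shows "\<exists>s\<ge>t. \<forall>s'\<ge>s. f s \<le> f s' + 1"
proof -
  define m where "m = Inf (f ` {t..})"
  have bdd: "bdd_below (f ` {t..})" using assms by (auto intro!: bdd_belowI)
  have "m < m + 1" by simp
  then obtain s where s: "t \<le> s" "f s < m + 1"
    unfolding m_def using cInf_lessD[of "f ` {t..}" "Inf (f ` {t..}) + 1"] by auto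
  have "m \<le> f s'" if "s \<le> s'" for s' unfolding m_def by (rule cInf_lower[OF _ bdd]) (use that s in auto)
  then have "\<forall>s'\<ge>s. f s \<le> f s' + 1" using s(2) by (smt (verit))
  then show ?thesis using s(1) by blast
qed

text \<open>The positive part of \<open>H (u, 0)\<close> is at most \<open>H (u, 0) + B\<close>,
  where \<open>B\<close> dominates the negative part and is integrable by the Sobolev embedding. The
  subgradient inequality then bounds the integral over \<open>{T < u \<le> T + 1 + n}\<close>
  independently of \<open>n\<close>, and \<open>n\<close> tends to infinity.\<close>

lemma upper_level_integrable:
  fixes u :: "'a::euclidean_space \<Rightarrow> real" and H :: "real \<times> 'a \<Rightarrow> real" and p c d T :: real
  assumes \<Omega>: "open \<Omega>" "bounded \<Omega>" and p: "1 \<le> p" "p \<le> DIM('a)" and u: "C1_approx \<Omega> p C u g"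
    and H: "continuous_on UNIV H" and sub: "\<forall>t. \<exists>\<zeta>. \<forall>\<xi>. H (t, \<xi>) \<ge> H (t, 0) + \<zeta> \<bullet> \<xi>"
    and lower: "\<And>t. H (t, 0) \<ge> c * \<bar>t\<bar> powr sharp_exponent DIM('a) p + d"
    and iH: "integrable (lebesgue_on \<Omega>) (\<lambda>x. H (u x, g x))" and T: "C \<le> T" "0 < T"
  shows "integrable (lebesgue_on \<Omega>) (\<lambda>x. if T < u x then max 0 (H (u x, 0)) else 0)"
proof -
  define q where "q = sharp_exponent DIM('a) p"
  have fin: "\<Omega> \<in> lmeasurable" by (rule open_bounded_lmeasurable[OF \<Omega>])
  interpret finite_measure "lebesgue_on \<Omega>" by (rule finite_measure_lebesgue_on[OF fin])
  note um = C1_approx_mem[OF u]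
  have [measurable]: "u \<in> borel_measurable (lebesgue_on \<Omega>)" "g \<in> borel_measurable (lebesgue_on \<Omega>)"
    using um by (auto simp: mem_Lp_def)
  have [measurable]: "H \<in> borel_measurable borel" using H by (rule borel_measurable_continuous_onI)
  define B where "B x = \<bar>c\<bar> * (if T < u x then u x powr q else 0) + \<bar>d\<bar>" for x
  have iB: "integrable (lebesgue_on \<Omega>) B"
    unfolding B_def q_def using sobolev_integrable[OF \<Omega> p u T] by simp
  have neg: "- H (u x, 0) \<le> B x" if "T < u x" for x
  proof -
    have "- \<bar>c\<bar> * u x powr q \<le> c * u x powr q" by (intro mult_right_mono) auto
    moreover have "H (u x, 0) \<ge> c * u x powr q + d" using lower[of "u x"] that T by (simp add: q_def)
    moreover have "B x = \<bar>c\<bar> * u x powr q + \<bar>d\<bar>" using that by (simp add: B_def)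
    ultimately show ?thesis by simp
  qed
  have B0: "0 \<le> B x" for x by (simp add: B_def)
  define \<Lambda> where "\<Lambda> = (\<integral>x. \<bar>H (u x, g x)\<bar> \<partial>lebesgue_on \<Omega>) + (\<integral>x. B x \<partial>lebesgue_on \<Omega>)"
  define f where "f x = (if T < u x then max 0 (H (u x, 0)) else 0)" for x
  have fm[measurable]: "f \<in> borel_measurable (lebesgue_on \<Omega>)" unfolding f_def by measurable
  have "integrable (lebesgue_on \<Omega>) f"
  proof (rule integrable_bounded_exhaustion[where r = u and a = "T + 1" and \<Lambda> = \<Lambda>])
    show "f \<in> borel_measurable (lebesgue_on \<Omega>)" by (rule fm)
    fix n :: nat
    \<comment> \<open>The extra 1 keeps the band nondegenerate for \<open>n = 0\<close>.\<close>
    have Tb: "T < T + 1 + real n" by simp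
    note sg = subgradient_inequality[OF \<Omega> p(1) u H sub T(1) Tb iH]
    let ?h = "\<lambda>x. if T < u x \<and> u x \<le> T + 1 + real n then H (u x, 0) else 0"
    let ?f = "\<lambda>x. if u x \<le> T + 1 + real n then f x else 0"
    have le: "?f x \<le> ?h x + B x" for x using neg[of x] B0[of x] by (auto simp: f_def)
    show i: "integrable (lebesgue_on \<Omega>) ?f"
    proof (rule Bochner_Integration.integrable_bound[OF sg(1)])
      show "?f \<in> borel_measurable (lebesgue_on \<Omega>)" by measurable
    qed (auto simp: f_def)
    have "(\<integral>x. ?f x \<partial>lebesgue_on \<Omega>) \<le> (\<integral>x. ?h x + B x \<partial>lebesgue_on \<Omega>)"
      by (rule integral_mono[OF i _ le]) (use sg(1) iB in simp)
    also have "\<dots> = (\<integral>x. ?h x \<partial>lebesgue_on \<Omega>) + (\<integral>x. B x \<partial>lebesgue_on \<Omega>)"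
      by (rule Bochner_Integration.integral_add[OF sg(1) iB])
    also have "(\<integral>x. ?h x \<partial>lebesgue_on \<Omega>) \<le> (\<integral>x. (if T < u x \<and> u x \<le> T + 1 + real n then H (u x, g x) else 0) \<partial>lebesgue_on \<Omega>)"
      by (rule sg(2))
    also have "\<dots> \<le> (\<integral>x. \<bar>H (u x, g x)\<bar> \<partial>lebesgue_on \<Omega>)"
      by (rule integral_mono_AE') (use iH in auto)
    finally show "(\<integral>x. ?f x \<partial>lebesgue_on \<Omega>) \<le> \<Lambda>" by (simp add: \<Lambda>_def)
  qed (simp add: f_def)
  then show ?thesis by (simp add: f_def[abs_def])
qed

lemma good_truncation_level:
  fixes u :: "'a::euclidean_space \<Rightarrow> real" and H :: "real \<times> 'a \<Rightarrow> real" and p c d T \<epsilon> :: real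
  assumes \<Omega>: "open \<Omega>" "bounded \<Omega>" and p: "1 \<le> p" "p \<le> DIM('a)" and u: "C1_approx \<Omega> p C u g"
    and H: "continuous_on UNIV H" and sub: "\<forall>t. \<exists>\<zeta>. \<forall>\<xi>. H (t, \<xi>) \<ge> H (t, 0) + \<zeta> \<bullet> \<xi>"
    and lower: "\<And>t. H (t, 0) \<ge> c * \<bar>t\<bar> powr sharp_exponent DIM('a) p + d"
    and iH: "integrable (lebesgue_on \<Omega>) (\<lambda>x. H (u x, g x))" and \<epsilon>: "0 < \<epsilon>"
  obtains t where "T \<le> t" "\<bar>H (t, 0)\<bar> * level_measure \<Omega> u t < \<epsilon>"
proof -
  define q where "q = sharp_exponent DIM('a) p"
  have q0: "0 \<le> q"
    using p by (auto simp: q_def sharp_exponent_def)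
  define T0 where "T0 = max C 1"
  have T0: "C \<le> T0" "0 < T0" by (auto simp: T0_def)
  have fin: "\<Omega> \<in> lmeasurable" by (rule open_bounded_lmeasurable[OF \<Omega>])
  interpret finite_measure "lebesgue_on \<Omega>" by (rule finite_measure_lebesgue_on[OF fin])
  note um = C1_approx_mem[OF u]
  have [measurable]: "u \<in> borel_measurable (lebesgue_on \<Omega>)" using um by (auto simp: mem_Lp_def)
  have [measurable]: "H \<in> borel_measurable borel" using H by (rule borel_measurable_continuous_onI)
  define f where "f t = max 0 (H (t, 0))" for t
  have f0: "0 \<le> f t" for t by (simp add: f_def)
  \<comment> \<open>A majorant of \<open>\<bar>H (t, 0)\<bar>\<close> at all points with
    \<open>u x > t\<close>: \<open>f (u x) + 1\<close> controls the positive part by almost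
    minimality of \<open>t\<close>, and the terms with \<open>c\<close> and \<open>d\<close> control
    the negative part because the power is increasing.\<close>
  define \<psi> where "\<psi> x = (if T0 < u x then f (u x) else 0) + 1 + \<bar>c\<bar> * (if T0 < u x then u x powr q else 0) + \<bar>d\<bar>" for x
  have \<psi>0: "0 \<le> \<psi> x" for x using f0 by (simp add: \<psi>_def)
  have i\<psi>: "integrable (lebesgue_on \<Omega>) \<psi>"
    unfolding \<psi>_def q_def f_def
    using sobolev_integrable[OF \<Omega> p u T0] upper_level_integrable[OF \<Omega> p u H sub lower iH T0] by simp
  define I where "I t = (\<integral>x. (if t < u x then \<psi> x else 0) \<partial>lebesgue_on \<Omega>)" for t
  have iI: "integrable (lebesgue_on \<Omega>) (\<lambda>x. if t < u x then \<psi> x else 0)" for t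
  proof (rule Bochner_Integration.integrable_bound[OF i\<psi>])
    have [measurable]: "\<psi> \<in> borel_measurable (lebesgue_on \<Omega>)" by (rule borel_measurable_integrable[OF i\<psi>])
    show "(\<lambda>x. if t < u x then \<psi> x else 0) \<in> borel_measurable (lebesgue_on \<Omega>)" by measurable
  qed auto
  have "(\<lambda>n. I (real n)) \<longlonglongrightarrow> (\<integral>x. 0 \<partial>lebesgue_on \<Omega>)"
    unfolding I_def
  proof (rule integral_dominated_convergence[OF _ _ i\<psi>])
    show "AE x in lebesgue_on \<Omega>. (\<lambda>n. if real n < u x then \<psi> x else 0) \<longlonglongrightarrow> 0"
    proof (rule AE_I2, rule tendsto_eventually)
      fix x
      show "\<forall>\<^sub>F n in sequentially. (if real n < u x then \<psi> x else 0) = 0"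
        using eventually_ge_at_top[of "nat \<lceil>u x\<rceil>"]
      proof eventually_elim
        case (elim n)
        then have "u x \<le> real n" by linarith
        then show ?case by simp
      qed
    qed
  qed (use \<psi>0 in \<open>auto intro: borel_measurable_integrable[OF iI]\<close>)
  then have "\<forall>\<^sub>F n in sequentially. I (real n) < \<epsilon>"
    using \<epsilon> by (intro order_tendstoD(2)) auto
  moreover have "\<forall>\<^sub>F n in sequentially. max T T0 \<le> real n"
    using filterlim_real_sequentially unfolding filterlim_at_top by (rule spec)
  ultimately obtain n :: nat where n: "I (real n) < \<epsilon>" "max T T0 \<le> real n"
    using eventually_happens'[OF sequentially_bot eventually_conj] by blast
  \<comment> \<open>The tail is made small at level \<open>n\<close> first. Raising the level from
    \<open>n\<close> to an almost minimal one only shrinks it.\<close>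
  obtain t where t: "real n \<le> t" "\<forall>s\<ge>t. f t \<le> f s + 1"
    using nonneg_almost_min[of f "real n"] f0 by auto
  have tT: "T \<le> t" "T0 \<le> t" "0 < t" using t(1) n(2) T0 by auto
  have lm: "{x \<in> \<Omega>. t < u x} \<in> sets (lebesgue_on \<Omega>)"
  proof -
    have "{x \<in> space (lebesgue_on \<Omega>). t < u x} \<in> sets (lebesgue_on \<Omega>)" by measurable
    then show ?thesis by simp
  qed
  have "\<bar>H (t, 0)\<bar> * level_measure \<Omega> u t = (\<integral>x. \<bar>H (t, 0)\<bar> * indicator {x \<in> \<Omega>. t < u x} x \<partial>lebesgue_on \<Omega>)"
  proof -
    have "{x \<in> \<Omega>. t < u x} \<inter> \<Omega> = {x \<in> \<Omega>. t < u x}" by auto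
    then show ?thesis using lm by (simp add: level_measure_def)
  qed
  also have "\<dots> \<le> I t"
    unfolding I_def
  proof (rule integral_mono[OF _ iI])
    show "integrable (lebesgue_on \<Omega>) (\<lambda>x. \<bar>H (t, 0)\<bar> * indicator {x \<in> \<Omega>. t < u x} x)"
      using lm by (intro integrable_mult_right) (simp add: emeasure_eq_measure)
    fix x assume x: "x \<in> space (lebesgue_on \<Omega>)"
    show "\<bar>H (t, 0)\<bar> * indicator {x \<in> \<Omega>. t < u x} x \<le> (if t < u x then \<psi> x else 0)"
    proof (cases "t < u x")
      case True
      have "t powr q \<le> u x powr q" using True tT q0 by (intro powr_mono2) auto
      then have "\<bar>c\<bar> * t powr q \<le> \<bar>c\<bar> * u x powr q" by (intro mult_left_mono) auto
      moreover have "\<bar>c * t powr q\<bar> = \<bar>c\<bar> * t powr q" by (simp add: abs_mult)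
      moreover have "H (t, 0) \<ge> c * t powr q + d" using lower[of t] tT by (simp add: q_def)
      moreover have "f t \<le> f (u x) + 1" using t(2) True by simp
      moreover have "H (t, 0) \<le> f t" "0 \<le> f t" by (auto simp: f_def)
      ultimately have "\<bar>H (t, 0)\<bar> \<le> f (u x) + 1 + \<bar>c\<bar> * u x powr q + \<bar>d\<bar>"
        using f0[of "u x"] by linarith
      then show ?thesis using True x tT by (simp add: \<psi>_def)
    qed simp
  qed
  also have "\<dots> \<le> I (real n)"
    unfolding I_def using t(1) \<psi>0 by (intro integral_mono iI) auto
  also have "\<dots> < \<epsilon>" by (rule n(1))
  finally show thesis using that[OF tT(1)] by blast
qed

text \<open>The maximum with \<open>C\<close> keeps the removed part in the space with zero boundary
  values, and \<open>Suc k\<close> pushes the levels strictly beyond \<open>k\<close>.\<close>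

lemma good_truncation_levels:
  fixes u :: "'a::euclidean_space \<Rightarrow> real" and H :: "real \<times> 'a \<Rightarrow> real" and p c d T :: real
  assumes \<Omega>: "open \<Omega>" "bounded \<Omega>" and p: "1 \<le> p" "p \<le> DIM('a)" and u: "C1_approx \<Omega> p C u g"
    and H: "continuous_on UNIV H" and sub: "\<forall>t. \<exists>\<zeta>. \<forall>\<xi>. H (t, \<xi>) \<ge> H (t, 0) + \<zeta> \<bullet> \<xi>"
    and lower: "\<And>t. H (t, 0) \<ge> c * \<bar>t\<bar> powr sharp_exponent DIM('a) p + d"
    and iH: "integrable (lebesgue_on \<Omega>) (\<lambda>x. H (u x, g x))"
  obtains t where "\<And>k::nat. max C (real (Suc k)) \<le> t k" "(\<lambda>k. \<bar>H (t k, 0)\<bar> * level_measure \<Omega> u (t k)) \<longlonglongrightarrow> 0"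
proof -
  have "\<exists>t. max C (real (Suc k)) \<le> t \<and> \<bar>H (t, 0)\<bar> * level_measure \<Omega> u t < inverse (real (Suc k))" for k
    using good_truncation_level[OF \<Omega> p u H sub lower iH, of "inverse (real (Suc k))" "max C (real (Suc k))"]
    by (metis inverse_positive_iff_positive of_nat_0_less_iff zero_less_Suc)
  then obtain t where t: "\<And>k. max C (real (Suc k)) \<le> t k" "\<And>k. \<bar>H (t k, 0)\<bar> * level_measure \<Omega> u (t k) < inverse (real (Suc k))"
    by metis
  have "(\<lambda>k. \<bar>H (t k, 0)\<bar> * level_measure \<Omega> u (t k)) \<longlonglongrightarrow> 0"
    by (rule tendsto_sandwich[OF _ _ tendsto_const LIMSEQ_inverse_real_of_nat])
      (use t(2) in \<open>auto simp: level_measure_def intro!: always_eventually less_imp_le\<close>)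
  with t(1) that show thesis by blast
qed

section \<open>Convergence of the truncations\<close>

theorem autonomous_Linf_regular:
  fixes \<Omega> :: "'a::euclidean_space set" and p c d :: real and H :: "real \<times> 'a \<Rightarrow> real"
  assumes \<Omega>: "open \<Omega>" "bounded \<Omega>" and p: "1 \<le> p" "p \<le> DIM('a)"
    and \<phi>: "\<phi> \<in> W1p UNIV p \<inter> Linf UNIV"
    and H: "continuous_on UNIV H" and L: "\<And>x t \<xi>. x \<in> \<Omega> \<Longrightarrow> L x t \<xi> = H (t, \<xi>)"
    and sub: "\<forall>t. \<exists>\<zeta>. \<forall>\<xi>. H (t, \<xi>) \<ge> H (t, 0) + \<zeta> \<bullet> \<xi>"
    and lower: "\<And>t. H (t, 0) \<ge> c * \<bar>t\<bar> powr sharp_exponent DIM('a) p + d"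
    and u: "u \<in> admissible \<Omega> p \<phi> L"
  shows "Linf_regular_at \<Omega> p \<phi> L u"
proof -
  have p0: "0 \<le> p" "0 < p" using p by auto
  have fin: "\<Omega> \<in> lmeasurable" by (rule open_bounded_lmeasurable[OF \<Omega>])
  have \<Omega>l: "\<Omega> \<in> sets lebesgue" by (rule open_sets_lebesgue[OF \<Omega>(1)])
  interpret finite_measure "lebesgue_on \<Omega>" by (rule finite_measure_lebesgue_on[OF fin])
  obtain w where w: "w \<in> W1p0 \<Omega> p" "u = (\<lambda>x. \<phi> x + w x)"
    using u by (auto simp: admissible_def W1p_bdry_def)
  obtain gw where gw: "C1_approx \<Omega> p 0 w gw" using W1p0_imp_C1_approx[OF \<Omega> p(1) w(1)] .
  obtain C g\<phi> where C: "0 \<le> C" "C1_approx \<Omega> p C \<phi> g\<phi>" using W1p_Linf_C1_approx[OF \<Omega> p(1) \<phi>] .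
  define g where "g x = g\<phi> x + gw x" for x
  have ap: "C1_approx \<Omega> p C u g"
    using C1_approx_add[OF \<Omega> p0(1) C(2) gw] by (simp add: w(2) g_def[abs_def])
  have ap': "C1_approx \<Omega> p C (\<lambda>x. - u x) (\<lambda>x. - g x)" by (rule C1_approx_uminus[OF ap])
  note um = C1_approx_mem[OF ap]
  have [measurable]: "u \<in> borel_measurable (lebesgue_on \<Omega>)" "g \<in> borel_measurable (lebesgue_on \<Omega>)"
    using um by (auto simp: mem_Lp_def)
  have [measurable]: "H \<in> borel_measurable borel" using H by (rule borel_measurable_continuous_onI)
  \<comment> \<open>The Lagrangian is defined through the chosen \<open>weak_gradient\<close>;
    almost everywhere any explicit gradient may take its place.\<close>
  have lag: "AE x in lebesgue_on \<Omega>. lagrangian_along \<Omega> L z x = H (z x, h x)"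
    if "C1_approx \<Omega> p D z h" for D z h
    using weak_gradient_eq[OF \<Omega>(1) C1_approx_weak_gradient[OF \<Omega> p(1) that]] AE_space[of "lebesgue_on \<Omega>"]
    by eventually_elim (simp add: lagrangian_along_def L)
  have lagm: "lagrangian_along \<Omega> L z \<in> borel_measurable (lebesgue_on \<Omega>)"
    if "C1_approx \<Omega> p D z h" for D z h
  proof (rule borel_measurable_AE_on[OF \<Omega>l])
    have [measurable]: "z \<in> borel_measurable (lebesgue_on \<Omega>)" "h \<in> borel_measurable (lebesgue_on \<Omega>)"
      using C1_approx_mem[OF that] by (auto simp: mem_Lp_def)
    show "(\<lambda>x. H (z x, h x)) \<in> borel_measurable (lebesgue_on \<Omega>)" by measurable
    show "AE x in lebesgue_on \<Omega>. H (z x, h x) = lagrangian_along \<Omega> L z x"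
      using lag[OF that] by eventually_elim simp
  qed
  have iLu: "integrable (lebesgue_on \<Omega>) (lagrangian_along \<Omega> L u)" using u by (simp add: admissible_def)
  have iH: "integrable (lebesgue_on \<Omega>) (\<lambda>x. H (u x, g x))"
    by (rule integrable_cong_AE_imp[OF iLu]) (use lag[OF ap] in auto)
  obtain t where t: "\<And>k::nat. max C (real (Suc k)) \<le> t k"
      "(\<lambda>k. \<bar>H (t k, 0)\<bar> * level_measure \<Omega> u (t k)) \<longlonglongrightarrow> 0"
    using good_truncation_levels[OF \<Omega> p ap H sub lower iH] by blast
  \<comment> \<open>The reflection satisfies \<open>H' (- u x, - g x) = H (u x, g x)\<close> and
    inherits both conditions, with subgradient \<open>- \<zeta>\<close> and the same
    \<open>c\<close>, \<open>d\<close>. Upper levels for \<open>- u\<close> are therefore lower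
    levels for \<open>u\<close>.\<close>
  define H' where "H' z = H (- fst z, - snd z)" for z
  have H': "continuous_on UNIV H'"
    unfolding H'_def by (intro continuous_on_compose2[OF H] continuous_intros) auto
  have sub': "\<forall>t. \<exists>\<zeta>. \<forall>\<xi>. H' (t, \<xi>) \<ge> H' (t, 0) + \<zeta> \<bullet> \<xi>"
  proof
    fix t
    obtain \<zeta> where "\<And>\<xi>. H (- t, \<xi>) \<ge> H (- t, 0) + \<zeta> \<bullet> \<xi>" using sub by blast
    from this[of "- \<xi>" for \<xi>] show "\<exists>\<zeta>. \<forall>\<xi>. H' (t, \<xi>) \<ge> H' (t, 0) + \<zeta> \<bullet> \<xi>"
      by (intro exI[of _ "- \<zeta>"]) (simp add: H'_def)
  qed
  have lower': "H' (t, 0) \<ge> c * \<bar>t\<bar> powr sharp_exponent DIM('a) p + d" for t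
    using lower[of "- t"] by (simp add: H'_def)
  have iH': "integrable (lebesgue_on \<Omega>) (\<lambda>x. H' (- u x, - g x))" using iH by (simp add: H'_def)
  obtain s where s: "\<And>k::nat. max C (real (Suc k)) \<le> s k"
      "(\<lambda>k. \<bar>H' (s k, 0)\<bar> * level_measure \<Omega> (\<lambda>x. - u x) (s k)) \<longlonglongrightarrow> 0"
    using good_truncation_levels[OF \<Omega> p ap' H' sub' lower' iH'] by blast
  have tk: "C \<le> t k" "real k < t k" "C \<le> s k" "real k < s k" "0 < t k" "0 < s k" for k
    using t(1)[of k] s(1)[of k] by auto
  \<comment> \<open>The part removed by truncation. It has zero boundary values because both levels
    are at least \<open>C\<close>, so subtracting it leaves the boundary values of \<open>u\<close>
    untouched.\<close>
  define R where "R k x = max 0 (u x - t k) - max 0 (- u x - s k)" for k x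
  define hR where "hR k x = (if t k < u x then g x else 0) - (if s k < - u x then - g x else 0)" for k x
  have apR: "C1_approx \<Omega> p 0 (R k) (hR k)" for k
    using C1_approx_diff[OF \<Omega> p0(1) C1_approx_pos_part[OF \<Omega> p(1) ap tk(1)[of k]] C1_approx_pos_part[OF \<Omega> p(1) ap' tk(3)[of k]]]
    by (simp add: R_def[abs_def] hR_def[abs_def])
  define U where "U k x = u x - R k x" for k x
  define G where "G k x = g x - hR k x" for k x
  have apU: "C1_approx \<Omega> p C (U k) (G k)" for k
    using C1_approx_diff[OF \<Omega> p0(1) ap apR[of k]] by (simp add: U_def[abs_def] G_def[abs_def])
  have mid: "U k x = u x \<and> G k x = g x" if "- s k \<le> u x" "u x \<le> t k" for k x
    using that by (simp add: U_def G_def R_def hR_def)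
  have top: "U k x = t k \<and> G k x = 0" if "t k < u x" for k x
    using that tk(5,6)[of k] by (auto simp: U_def G_def R_def hR_def)
  have bot: "U k x = - s k \<and> G k x = 0" if "u x < - s k" for k x
    using that tk(5,6)[of k] by (auto simp: U_def G_def R_def hR_def)
  \<comment> \<open>Between the levels the Lagrangian along \<open>u\<close> itself is kept, so that
    the difference of the two Lagrangians vanishes there and only the two level sets
    contribute.\<close>
  define \<Lambda> where "\<Lambda> k x = (if t k < u x then H (t k, 0) else if u x < - s k then H (- s k, 0) else lagrangian_along \<Omega> L u x)" for k x
  have lagU: "AE x in lebesgue_on \<Omega>. lagrangian_along \<Omega> L (U k) x = \<Lambda> k x" for k
    using lag[OF apU[of k]] lag[OF ap]
  proof eventually_elim
    case (elim x)
    show ?case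
      using mid[of k x] top[of k x] bot[of x k] elim by (auto simp: \<Lambda>_def not_less)
  qed
  have Lum[measurable]: "lagrangian_along \<Omega> L u \<in> borel_measurable (lebesgue_on \<Omega>)"
    by (rule borel_measurable_integrable[OF iLu])
  have \<Lambda>m[measurable]: "\<Lambda> k \<in> borel_measurable (lebesgue_on \<Omega>)" for k unfolding \<Lambda>_def by measurable
  have i\<Lambda>: "integrable (lebesgue_on \<Omega>) (\<Lambda> k)" for k
  proof (rule Bochner_Integration.integrable_bound[OF _ \<Lambda>m])
    show "integrable (lebesgue_on \<Omega>) (\<lambda>x. \<bar>lagrangian_along \<Omega> L u x\<bar> + (\<bar>H (t k, 0)\<bar> + \<bar>H (- s k, 0)\<bar>))"
      using iLu by simp
  qed (auto simp: \<Lambda>_def)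
  have iLU: "integrable (lebesgue_on \<Omega>) (lagrangian_along \<Omega> L (U k))" for k
    by (rule integrable_cong_AE_imp[OF i\<Lambda> lagm[OF apU]]) (use lagU[of k] in auto)
  have "U k \<in> admissible \<Omega> p \<phi> L \<inter> Linf \<Omega>" for k
  proof
    have "C1_approx \<Omega> p 0 (\<lambda>x. w x - R k x) (\<lambda>x. gw x - hR k x)"
      using C1_approx_diff[OF \<Omega> p0(1) gw apR[of k]] by simp
    then have "(\<lambda>x. w x - R k x) \<in> W1p0 \<Omega> p" by (rule C1_approx_imp_W1p0[OF \<Omega> p(1)])
    moreover have "U k = (\<lambda>x. \<phi> x + (w x - R k x))" by (simp add: U_def[abs_def] w(2) add_diff_eq)
    ultimately have "U k \<in> W1p_bdry \<Omega> p \<phi>" unfolding W1p_bdry_def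
      by (intro image_eqI[where x = "\<lambda>x. w x - R k x"])
    then show "U k \<in> admissible \<Omega> p \<phi> L" using iLU[of k] by (simp add: admissible_def)
    have "\<bar>U k x\<bar> \<le> max (t k) (s k)" for x
      using mid[of k x] top[of k x] bot[of x k] tk(5,6)[of k] by (cases "t k < u x"; cases "u x < - s k") auto
    then show "U k \<in> Linf \<Omega>"
      using C1_approx_mem(1)[OF apU[of k]] by (auto simp: Linf_def mem_Lp_def)
  qed
  moreover have "(\<lambda>k. W1p_norm \<Omega> p (\<lambda>x. U k x - u x)) \<longlonglongrightarrow> 0"
  proof -
    have "(\<lambda>x. U k x - u x) = (\<lambda>x. - R k x)" for k by (simp add: U_def)
    moreover note apmR = C1_approx_uminus[OF apR]
    note weak = C1_approx_weak_gradient[OF \<Omega> p(1) apmR]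
    have Rm: "(\<lambda>x. - R k x) \<in> borel_measurable (lebesgue_on \<Omega>)" "(\<lambda>x. - hR k x) \<in> borel_measurable (lebesgue_on \<Omega>)" for k
      using C1_approx_mem[OF apmR[of k]] by (auto simp: mem_Lp_def)
    have ev: "\<forall>\<^sub>F k in sequentially. - s k \<le> u x \<and> u x \<le> t k" for x
      using eventually_ge_at_top[of "nat \<lceil>\<bar>u x\<bar>\<rceil>"]
    proof eventually_elim
      case (elim k)
      then have "\<bar>u x\<bar> \<le> real k" by linarith
      then show ?case using tk(2,4)[of k] by linarith
    qed
    have "(\<lambda>k. Lp_pow (lebesgue_on \<Omega>) p (\<lambda>x. - R k x - 0)) \<longlonglongrightarrow> 0"
    proof (rule Lp_dominated_convergence[OF Rm(1) _ um(1) p0(2), where B = 1])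
      show "AE x in lebesgue_on \<Omega>. (\<lambda>k. - R k x) \<longlonglongrightarrow> 0"
      proof (rule AE_I2, rule tendsto_eventually)
        fix x
        show "\<forall>\<^sub>F k in sequentially. - R k x = 0"
          using ev[of x] by eventually_elim (simp add: R_def)
      qed
      show "AE x in lebesgue_on \<Omega>. norm (- R k x - 0) \<le> 1 * norm (u x)" for k
        using tk(5,6)[of k] by (auto simp: R_def max_def intro!: AE_I2)
    qed auto
    moreover have "(\<lambda>k. Lp_pow (lebesgue_on \<Omega>) p (\<lambda>x. - hR k x - 0)) \<longlonglongrightarrow> 0"
    proof (rule Lp_dominated_convergence[OF Rm(2) _ um(2) p0(2), where B = 1])
      show "AE x in lebesgue_on \<Omega>. (\<lambda>k. - hR k x) \<longlonglongrightarrow> 0"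
      proof (rule AE_I2, rule tendsto_eventually)
        fix x
        show "\<forall>\<^sub>F k in sequentially. - hR k x = 0"
          using ev[of x] by eventually_elim (simp add: hR_def)
      qed
      show "AE x in lebesgue_on \<Omega>. norm (- hR k x - 0) \<le> 1 * norm (g x)" for k
        using tk(5,6)[of k] by (auto simp: hR_def intro!: AE_I2)
    qed auto
    ultimately show ?thesis
      using W1p_norm_tendsto_iff[OF \<Omega>(1) p0(2) weak Rm(2)] by simp
  qed
  moreover have "(\<lambda>k. \<integral>x. \<bar>lagrangian_along \<Omega> L (U k) x - lagrangian_along \<Omega> L u x\<bar> \<partial>lebesgue_on \<Omega>) \<longlonglongrightarrow> 0"
  proof -
    \<comment> \<open>Both levels exceed \<open>k\<close>, so every point altered by truncation
      satisfies \<open>\<bar>u x\<bar> > k\<close>. The tail can thus be taken at \<open>k\<close>,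
      whatever the levels are.\<close>
    define tail where "tail k = (\<integral>x. (if real k < \<bar>u x\<bar> then \<bar>lagrangian_along \<Omega> L u x\<bar> else 0) \<partial>lebesgue_on \<Omega>)" for k
    have itail: "integrable (lebesgue_on \<Omega>) (\<lambda>x. if real k < \<bar>u x\<bar> then \<bar>lagrangian_along \<Omega> L u x\<bar> else 0)" for k
      by (rule Bochner_Integration.integrable_bound[OF iLu]) auto
    have tail0: "tail \<longlonglongrightarrow> 0"
    proof -
      have "(\<lambda>k. tail k) \<longlonglongrightarrow> (\<integral>x. 0 \<partial>lebesgue_on \<Omega>)"
        unfolding tail_def
      proof (rule integral_dominated_convergence[of _ _ _ "\<lambda>x. \<bar>lagrangian_along \<Omega> L u x\<bar>"])
        show "AE x in lebesgue_on \<Omega>. (\<lambda>k. if real k < \<bar>u x\<bar> then \<bar>lagrangian_along \<Omega> L u x\<bar> else 0) \<longlonglongrightarrow> 0"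
        proof (rule AE_I2, rule tendsto_eventually)
          fix x
          show "\<forall>\<^sub>F k in sequentially. (if real k < \<bar>u x\<bar> then \<bar>lagrangian_along \<Omega> L u x\<bar> else 0) = 0"
            using eventually_ge_at_top[of "nat \<lceil>\<bar>u x\<bar>\<rceil>"]
          proof eventually_elim
            case (elim k)
            then have "\<bar>u x\<bar> \<le> real k" by linarith
            then show ?case by simp
          qed
        qed
      qed (use iLu in auto)
      then show ?thesis by simp
    qed
    have lm: "{x \<in> \<Omega>. r < u x} \<in> sets (lebesgue_on \<Omega>)" "{x \<in> \<Omega>. r < - u x} \<in> sets (lebesgue_on \<Omega>)" for r
    proof -
      have "{x \<in> space (lebesgue_on \<Omega>). r < u x} \<in> sets (lebesgue_on \<Omega>)"
        "{x \<in> space (lebesgue_on \<Omega>). r < - u x} \<in> sets (lebesgue_on \<Omega>)" by measurable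
      then show "{x \<in> \<Omega>. r < u x} \<in> sets (lebesgue_on \<Omega>)" "{x \<in> \<Omega>. r < - u x} \<in> sets (lebesgue_on \<Omega>)" by simp_all
    qed
    define A1 where "A1 k = \<bar>H (t k, 0)\<bar> * level_measure \<Omega> u (t k)" for k
    define A2 where "A2 k = \<bar>H' (s k, 0)\<bar> * level_measure \<Omega> (\<lambda>x. - u x) (s k)" for k
    have le: "(\<integral>x. \<bar>lagrangian_along \<Omega> L (U k) x - lagrangian_along \<Omega> L u x\<bar> \<partial>lebesgue_on \<Omega>) \<le> A1 k + A2 k + tail k" for k
    proof -
      define f1 where "f1 x = \<bar>H (t k, 0)\<bar> * indicator {x \<in> \<Omega>. t k < u x} x" for x
      define f2 where "f2 x = \<bar>H' (s k, 0)\<bar> * indicator {x \<in> \<Omega>. s k < - u x} x" for x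
      have i12: "integrable (lebesgue_on \<Omega>) f1" "integrable (lebesgue_on \<Omega>) f2"
        unfolding f1_def f2_def using lm by (intro integrable_mult_right; simp add: emeasure_eq_measure)+
      have sp: "{x \<in> \<Omega>. P x} \<inter> \<Omega> = {x \<in> \<Omega>. P x}" for P by auto
      have e12: "(\<integral>x. f1 x \<partial>lebesgue_on \<Omega>) = A1 k" "(\<integral>x. f2 x \<partial>lebesgue_on \<Omega>) = A2 k"
        unfolding f1_def f2_def A1_def A2_def level_measure_def by (simp_all add: sp)
      have "(\<integral>x. \<bar>lagrangian_along \<Omega> L (U k) x - lagrangian_along \<Omega> L u x\<bar> \<partial>lebesgue_on \<Omega>)
         \<le> (\<integral>x. f1 x + f2 x + (if real k < \<bar>u x\<bar> then \<bar>lagrangian_along \<Omega> L u x\<bar> else 0) \<partial>lebesgue_on \<Omega>)"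
      proof (rule integral_mono_AE)
        show "integrable (lebesgue_on \<Omega>) (\<lambda>x. \<bar>lagrangian_along \<Omega> L (U k) x - lagrangian_along \<Omega> L u x\<bar>)"
          using iLU iLu by simp
        show "integrable (lebesgue_on \<Omega>) (\<lambda>x. f1 x + f2 x + (if real k < \<bar>u x\<bar> then \<bar>lagrangian_along \<Omega> L u x\<bar> else 0))"
          by (intro Bochner_Integration.integrable_add i12 itail)
        show "AE x in lebesgue_on \<Omega>. \<bar>lagrangian_along \<Omega> L (U k) x - lagrangian_along \<Omega> L u x\<bar>
           \<le> f1 x + f2 x + (if real k < \<bar>u x\<bar> then \<bar>lagrangian_along \<Omega> L u x\<bar> else 0)"
          using lagU[of k] AE_space
        proof eventually_elim
          case (elim x)
          then have x: "x \<in> \<Omega>" by simp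
          have nn: "0 \<le> f1 x" "0 \<le> f2 x" by (auto simp: f1_def f2_def)
          consider "t k < u x" | "u x < - s k" | "- s k \<le> u x" "u x \<le> t k" by linarith
          then show ?case
          proof cases
            case 1
            then have "f1 x = \<bar>H (t k, 0)\<bar>" "real k < \<bar>u x\<bar>" "\<Lambda> k x = H (t k, 0)"
              using x tk(2)[of k] by (auto simp: f1_def \<Lambda>_def)
            then show ?thesis using elim(1) nn by simp
          next
            case 2
            then have "f2 x = \<bar>H (- s k, 0)\<bar>" "real k < \<bar>u x\<bar>" "\<Lambda> k x = H (- s k, 0)"
              using x tk(4-6)[of k] by (auto simp: f2_def H'_def \<Lambda>_def)
            then show ?thesis using elim(1) nn by simp
          next
            case 3
            then have "\<Lambda> k x = lagrangian_along \<Omega> L u x" by (simp add: \<Lambda>_def)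
            then show ?thesis using elim(1) nn by simp
          qed
        qed
      qed
      also have "\<dots> = A1 k + A2 k + tail k"
        using i12 itail[of k] by (simp add: e12 tail_def)
      finally show ?thesis .
    qed
    have "(\<lambda>k. A1 k + A2 k + tail k) \<longlonglongrightarrow> 0 + 0 + 0"
      unfolding A1_def A2_def by (intro tendsto_add t(2) s(2) tail0)
    then have lim: "(\<lambda>k. A1 k + A2 k + tail k) \<longlonglongrightarrow> 0" by simp
    show ?thesis
      by (rule tendsto_sandwich[OF _ _ tendsto_const lim])
        (use le in \<open>auto intro!: always_eventually Bochner_Integration.integral_nonneg\<close>)
  qed
  ultimately show ?thesis unfolding Linf_regular_at_def by blast
qed

text \<open>The result for Euclidean spaces, read in \<open>real ^ 'n\<close>, whose dimension is
  \<open>CARD('n)\<close>.\<close>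

theorem theorem3p3:
  fixes \<Omega> :: "(real ^ 'n) set"
    and p :: real
    and \<phi> :: "real ^ 'n \<Rightarrow> real"
    and H :: "real \<times> (real ^ 'n) \<Rightarrow> real"
    and L :: "real ^ 'n \<Rightarrow> real \<Rightarrow> real ^ 'n \<Rightarrow> real"
    and u :: "real ^ 'n \<Rightarrow> real"
  assumes "open \<Omega>" and "bounded \<Omega>"
    and "1 \<le> p" and "p \<le> real CARD('n)"
    and "\<phi> \<in> W1p UNIV p \<inter> Linf UNIV"
    and "continuous_on UNIV H"
    and "\<And>x t \<xi>. x \<in> \<Omega> \<Longrightarrow> L x t \<xi> = H (t, \<xi>)"
    and "\<forall>t. \<exists>\<zeta>. \<forall>\<xi>. H (t, \<xi>) \<ge> H (t, 0) + \<zeta> \<bullet> \<xi>"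
    and "\<exists>c d. \<forall>t. H (t, 0) \<ge> c * \<bar>t\<bar> powr sharp_exponent CARD('n) p + d"
    and "u \<in> admissible \<Omega> p \<phi> L"
  shows "Linf_regular_at \<Omega> p \<phi> L u"
proof -
  obtain c d where "\<And>t. H (t, 0) \<ge> c * \<bar>t\<bar> powr sharp_exponent CARD('n) p + d"
    using assms(9) by blast
  then show ?thesis
    using assms by (intro autonomous_Linf_regular[where H = H and c = c and d = d]) auto
qed

end
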